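(* Let $\mathfrak{g}$ be a finite dimensional reductive Lie algebra over $\mathbb{C}$, let $d\ge 1$, let $V(\lambda_1),\dots,V(\lambda_d)$ be finite dimensional irreducible $\mathfrak{g}$-modules with highest weights $\lambda_1,\dots,\lambda_d$, and let $\vec p=(p_1,\dots,p_d)\in\mathbb{C}^d$ with $p_1,\dots,p_d$ distinct. Let $\vec V_{\vec p}(\vec\lambda)=V(\lambda_1)\otimes\cdots\otimes V(\lambda_d)$ be the corresponding evaluation module for $\mathfrak{g}[t]=\mathfrak{g}\otimes\mathbb{C}[t]$, and let $$\vec V_{\vec p}(\vec\lambda)=\bigoplus_\mu \vec V_{\vec p}(\vec\lambda)[\mu]$$ be its decomposition into (nonzero) isotypic components as a $\mathfrak{g}$-module, where $\vec V_{\vec p}(\vec\lambda)[\mu]$ is the isotypic component of highest weight $\mu$. Then each isotypic component $\vec V_{\vec p}(\vec\lambda)[\mu]$ is an irreducible module for $\mathfrak{g}\times[U(\mathfrak{g}[t])]^{\mathfrak{g}}$; that is, it has no proper nonzero subspace stable under both $\mathfrak{g}$ and $[U(\mathfrak{g}[t])]^{\mathfrak{g}}$.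
   Context: $\mathfrak{g}[t]=\mathfrak{g}\otimes\mathbb{C}[t]$ is the Lie algebra with bracket $[x(P),y(Q)]=[x,y](PQ)$, where $x(P):=x\otimes P$ for $x\in\mathfrak{g}$, $P\in\mathbb{C}[t]$; $\mathfrak{g}$ is identified with the subalgebra $\mathfrak{g}\otimes 1$. $U(\mathfrak{g}[t])$ is its universal enveloping algebra, and $[U(\mathfrak{g}[t])]^{\mathfrak{g}}$ is the subalgebra of elements commuting with $\mathfrak{g}$ (the invariants under the adjoint action of $\mathfrak{g}$). Evaluation module: for $\vec\lambda=(\lambda_1,\dots,\lambda_d)$ and $\vec p=(p_1,\dots,p_d)\in\mathbb{C}^d$, $\vec V_{\vec p}(\vec\lambda)$ is the vector space $V(\lambda_1)\otimes\cdots\otimes V(\lambda_d)$ with $\mathfrak{g}[t]$-action $$x(P)\cdot(v_1\otimes\cdots\otimes v_d)=\sum_{i=1}^d P(p_i)\,v_1\otimes\cdots\otimes x\cdot v_i\otimes\cdots\otimes v_d .$$ Its restriction to $\mathfrak{g}$ is the usual tensor product $\mathfrak{g}$-module. Since $[U(\mathfrak{g}[t])]^{\mathfrak{g}}$ commutes with $\mathfrak{g}$, it stabilizes each $\mathfrak{g}$-isotypic component, so both $\mathfrak{g}$ and $[U(\mathfrak{g}[t])]^{\mathfrak{g}}$ act on each $\vec V_{\vec p}(\vec\lambda)[\mu]$ and their actions commute. *)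

theory Defs
  imports
    Complex_Main
    "HOL-Library.FuncSet"
    "HOL-Library.Function_Algebras"
    "HOL-Library.Poly_Mapping"
    "HOL-Computational_Algebra.Polynomial"
    "HOL-Algebra.QuotRing"
begin

section \<open>Lie algebras and their modules\<close>

locale lie_algebra = vector_space scale
  for scale :: "complex \<Rightarrow> 'g::ab_group_add \<Rightarrow> 'g" +
  fixes bracket :: "'g \<Rightarrow> 'g \<Rightarrow> 'g"
  assumes bracket_linear_left: "Vector_Spaces.linear scale scale (\<lambda>x. bracket x y)"
    and bracket_linear_right: "Vector_Spaces.linear scale scale (bracket x)"
    and bracket_self: "bracket x x = 0"
    and jacobi: "bracket x (bracket y z) + bracket y (bracket z x) + bracket z (bracket x y) = 0"

definition finite_dim :: "(complex \<Rightarrow> 'v::ab_group_add \<Rightarrow> 'v) \<Rightarrow> 'v set \<Rightarrow> bool" where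
  "finite_dim scale M \<longleftrightarrow> (\<exists>B. finite B \<and> module.span scale B = M)"

definition lie_ideal ::
  "(complex \<Rightarrow> 'g::ab_group_add \<Rightarrow> 'g) \<Rightarrow> ('g \<Rightarrow> 'g \<Rightarrow> 'g) \<Rightarrow> 'g set \<Rightarrow> bool" where
  "lie_ideal scale bracket I \<longleftrightarrow>
     module.subspace scale I \<and> (\<forall>x. \<forall>y\<in>I. bracket x y \<in> I)"

text \<open>Reductive means that the adjoint module is completely reducible: every ideal has a
  complementary ideal.\<close>

definition reductive_lie_algebra ::
  "(complex \<Rightarrow> 'g::ab_group_add \<Rightarrow> 'g) \<Rightarrow> ('g \<Rightarrow> 'g \<Rightarrow> 'g) \<Rightarrow> bool" where
  "reductive_lie_algebra scale bracket \<longleftrightarrow>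
     lie_algebra scale bracket \<and>
     (\<forall>I. lie_ideal scale bracket I \<longrightarrow>
        (\<exists>J. lie_ideal scale bracket J \<and> I \<inter> J = {0} \<and> (\<forall>x. \<exists>a\<in>I. \<exists>b\<in>J. x = a + b)))"

text \<open>Modules are carried by a subspace \<open>M\<close> of an ambient complex vector space, so that a family of
  modules of different dimensions fits into one type. The values of \<open>\<rho> x\<close> outside \<open>M\<close> are
  irrelevant.\<close>

locale lie_module = lie_algebra scale bracket + V: vector_space scaleV
  for scale :: "complex \<Rightarrow> 'g::ab_group_add \<Rightarrow> 'g" and bracket
    and scaleV :: "complex \<Rightarrow> 'v::ab_group_add \<Rightarrow> 'v" +
  fixes M :: "'v set" and \<rho> :: "'g \<Rightarrow> 'v \<Rightarrow> 'v"
  assumes subspace_carrier: "V.subspace M"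
    and act_closed: "v \<in> M \<Longrightarrow> \<rho> x v \<in> M"
    and act_add_left: "v \<in> M \<Longrightarrow> \<rho> (x + y) v = \<rho> x v + \<rho> y v"
    and act_scale_left: "v \<in> M \<Longrightarrow> \<rho> (scale c x) v = scaleV c (\<rho> x v)"
    and act_add_right: "v \<in> M \<Longrightarrow> w \<in> M \<Longrightarrow> \<rho> x (v + w) = \<rho> x v + \<rho> x w"
    and act_scale_right: "v \<in> M \<Longrightarrow> \<rho> x (scaleV c v) = scaleV c (\<rho> x v)"
    and act_bracket: "v \<in> M \<Longrightarrow> \<rho> (bracket x y) v = \<rho> x (\<rho> y v) - \<rho> y (\<rho> x v)"

definition invariant_subspace ::
  "(complex \<Rightarrow> 'v::ab_group_add \<Rightarrow> 'v) \<Rightarrow> ('v \<Rightarrow> 'v) set \<Rightarrow> 'v set \<Rightarrow> bool" where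
  "invariant_subspace scale Ops N \<longleftrightarrow>
     module.subspace scale N \<and> (\<forall>T\<in>Ops. \<forall>v\<in>N. T v \<in> N)"

definition irreducible_under ::
  "(complex \<Rightarrow> 'v::ab_group_add \<Rightarrow> 'v) \<Rightarrow> ('v \<Rightarrow> 'v) set \<Rightarrow> 'v set \<Rightarrow> bool" where
  "irreducible_under scale Ops M \<longleftrightarrow>
     invariant_subspace scale Ops M \<and> M \<noteq> {0} \<and>
     (\<forall>N. invariant_subspace scale Ops N \<and> N \<subseteq> M \<longrightarrow> N = {0} \<or> N = M)"

definition irreducible_lie_module where
  "irreducible_lie_module scale bracket scaleV M \<rho> \<longleftrightarrow>
     lie_module scale bracket scaleV M \<rho> \<and> irreducible_under scaleV (range \<rho>) M"

definition lie_module_isomorphic ::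
  "(complex \<Rightarrow> 'v::ab_group_add \<Rightarrow> 'v) \<Rightarrow> 'v set \<Rightarrow> ('g \<Rightarrow> 'v \<Rightarrow> 'v) \<Rightarrow>
   (complex \<Rightarrow> 'w::ab_group_add \<Rightarrow> 'w) \<Rightarrow> 'w set \<Rightarrow> ('g \<Rightarrow> 'w \<Rightarrow> 'w) \<Rightarrow> bool" where
  "lie_module_isomorphic scaleV M \<rho> scaleW N \<sigma> \<longleftrightarrow>
     (\<exists>\<phi>. bij_betw \<phi> M N \<and>
        (\<forall>v\<in>M. \<forall>w\<in>M. \<phi> (v + w) = \<phi> v + \<phi> w) \<and>
        (\<forall>c. \<forall>v\<in>M. \<phi> (scaleV c v) = scaleW c (\<phi> v)) \<and>
        (\<forall>x. \<forall>v\<in>M. \<phi> (\<rho> x v) = \<sigma> x (\<phi> v)))"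

text \<open>The isotypic component of type \<open>(S, \<sigma>)\<close> of the module \<open>(M, \<rho>)\<close>: the sum of all
  submodules of \<open>M\<close> isomorphic to \<open>S\<close>.\<close>

definition isotypic_component ::
  "(complex \<Rightarrow> 'v::ab_group_add \<Rightarrow> 'v) \<Rightarrow> 'v set \<Rightarrow> ('g \<Rightarrow> 'v \<Rightarrow> 'v) \<Rightarrow>
   (complex \<Rightarrow> 's::ab_group_add \<Rightarrow> 's) \<Rightarrow> 's set \<Rightarrow> ('g \<Rightarrow> 's \<Rightarrow> 's) \<Rightarrow> 'v set" where
  "isotypic_component scaleV M \<rho> scaleS S \<sigma> =
     module.span scaleV (\<Union>{N. N \<subseteq> M \<and> invariant_subspace scaleV (range \<rho>) N \<and>
                               lie_module_isomorphic scaleV N \<rho> scaleS S \<sigma>})"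


section \<open>The current algebra\<close>

text \<open>\<open>\<gg>[t] = \<gg> \<otimes> \<complex>[t]\<close> is realised as the space of polynomials in \<open>t\<close> with coefficients
  in \<open>\<gg>\<close>; the pure tensor \<open>x \<otimes> P\<close> is the polynomial whose coefficients are \<open>P\<^sub>n x\<close>.\<close>

definition current_scale ::
  "(complex \<Rightarrow> 'g::ab_group_add \<Rightarrow> 'g) \<Rightarrow> complex \<Rightarrow> 'g poly \<Rightarrow> 'g poly" where
  "current_scale scale c X = map_poly (scale c) X"

definition current_elem ::
  "(complex \<Rightarrow> 'g::ab_group_add \<Rightarrow> 'g) \<Rightarrow> 'g \<Rightarrow> complex poly \<Rightarrow> 'g poly" where
  "current_elem scale x P = map_poly (\<lambda>c. scale c x) P"

definition current_bracket ::
  "('g::ab_group_add \<Rightarrow> 'g \<Rightarrow> 'g) \<Rightarrow> 'g poly \<Rightarrow> 'g poly \<Rightarrow> 'g poly" where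
  "current_bracket bracket X Y =
     (\<Sum>i\<le>degree X. \<Sum>j\<le>degree Y. monom (bracket (coeff X i) (coeff Y j)) (i + j))"

definition current_eval ::
  "(complex \<Rightarrow> 'g::ab_group_add \<Rightarrow> 'g) \<Rightarrow> 'g poly \<Rightarrow> complex \<Rightarrow> 'g" where
  "current_eval scale X c = (\<Sum>n\<le>degree X. scale (c ^ n) (coeff X n))"


section \<open>The universal enveloping algebra\<close>

text \<open>The free unital associative algebra on a set is the monoid algebra of the free monoid; the
  universal enveloping algebra is its quotient by the two-sided ideal that forces the generators to
  be linear in the Lie algebra (which gives the tensor algebra) and commutators to be brackets.\<close>

datatype 'a free_monoid = Word (letters: "'a list")

instantiation free_monoid :: (type) monoid_add
begin

definition zero_free_monoid :: "'a free_monoid" where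
  "0 = Word []"

definition plus_free_monoid :: "'a free_monoid \<Rightarrow> 'a free_monoid \<Rightarrow> 'a free_monoid" where
  "v + w = Word (letters v @ letters w)"

instance
  by standard (simp_all add: zero_free_monoid_def plus_free_monoid_def)

end

type_synonym 'a free_algebra = "'a free_monoid \<Rightarrow>\<^sub>0 complex"

definition free_const :: "complex \<Rightarrow> 'a free_algebra" where
  "free_const c = Poly_Mapping.single 0 c"

definition free_gen :: "'a \<Rightarrow> 'a free_algebra" where
  "free_gen x = Poly_Mapping.single (Word [x]) 1"

definition free_ring :: "'a free_algebra ring" where
  "free_ring = \<lparr>carrier = UNIV, mult = (*), one = 1, zero = 0, add = (+)\<rparr>"

definition uea_relations ::
  "(complex \<Rightarrow> 'l::ab_group_add \<Rightarrow> 'l) \<Rightarrow> ('l \<Rightarrow> 'l \<Rightarrow> 'l) \<Rightarrow> 'l free_algebra set" where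
  "uea_relations scale bracket =
     {free_gen (x + y) - free_gen x - free_gen y | x y. True} \<union>
     {free_gen (scale c x) - free_const c * free_gen x | c x. True} \<union>
     {free_gen x * free_gen y - free_gen y * free_gen x - free_gen (bracket x y) | x y. True}"

definition uea_ideal ::
  "(complex \<Rightarrow> 'l::ab_group_add \<Rightarrow> 'l) \<Rightarrow> ('l \<Rightarrow> 'l \<Rightarrow> 'l) \<Rightarrow> 'l free_algebra set" where
  "uea_ideal scale bracket = Idl\<^bsub>free_ring\<^esub> (uea_relations scale bracket)"

definition uea ::
  "(complex \<Rightarrow> 'l::ab_group_add \<Rightarrow> 'l) \<Rightarrow> ('l \<Rightarrow> 'l \<Rightarrow> 'l) \<Rightarrow> 'l free_algebra set ring" where
  "uea scale bracket = free_ring Quot (uea_ideal scale bracket)"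

definition uea_gen ::
  "(complex \<Rightarrow> 'l::ab_group_add \<Rightarrow> 'l) \<Rightarrow> ('l \<Rightarrow> 'l \<Rightarrow> 'l) \<Rightarrow> 'l \<Rightarrow> 'l free_algebra set" where
  "uea_gen scale bracket x = uea_ideal scale bracket +>\<^bsub>free_ring\<^esub> free_gen x"

definition free_act ::
  "(complex \<Rightarrow> 'v::ab_group_add \<Rightarrow> 'v) \<Rightarrow> ('l \<Rightarrow> 'v \<Rightarrow> 'v) \<Rightarrow> 'l free_algebra \<Rightarrow> 'v \<Rightarrow> 'v" where
  "free_act scaleV \<rho> f v =
     (\<Sum>w\<in>Poly_Mapping.keys f. scaleV (Poly_Mapping.lookup f w) (foldr \<rho> (letters w) v))"

text \<open>The action of a residue class is that of any of its representatives; see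
  \<open>lie_module.uea_act_eq\<close> below for independence of the choice.\<close>

definition uea_act ::
  "(complex \<Rightarrow> 'v::ab_group_add \<Rightarrow> 'v) \<Rightarrow> ('l \<Rightarrow> 'v \<Rightarrow> 'v) \<Rightarrow>
   'l free_algebra set \<Rightarrow> 'v \<Rightarrow> 'v" where
  "uea_act scaleV \<rho> u v = the_elem ((\<lambda>f. free_act scaleV \<rho> f v) ` u)"

text \<open>\<open>[U(\<gg>[t])]\<^sup>\<gg>\<close>: the elements of \<open>U(\<gg>[t])\<close> commuting with \<open>\<gg> = \<gg> \<otimes> 1\<close>.\<close>

definition current_uea_invariants ::
  "(complex \<Rightarrow> 'g::ab_group_add \<Rightarrow> 'g) \<Rightarrow> ('g \<Rightarrow> 'g \<Rightarrow> 'g) \<Rightarrow> 'g poly free_algebra set set" where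
  "current_uea_invariants scale bracket =
     (let U = uea (current_scale scale) (current_bracket bracket);
          \<iota> = uea_gen (current_scale scale) (current_bracket bracket)
      in {u \<in> carrier U. \<forall>x. u \<otimes>\<^bsub>U\<^esub> \<iota> (current_elem scale x 1) = \<iota> (current_elem scale x 1) \<otimes>\<^bsub>U\<^esub> u})"


section \<open>Tensor products and evaluation modules\<close>

definition multilinear_on ::
  "(complex \<Rightarrow> 'v::ab_group_add \<Rightarrow> 'v) \<Rightarrow> nat \<Rightarrow> (nat \<Rightarrow> 'v set) \<Rightarrow>
   (complex \<Rightarrow> 'w::ab_group_add \<Rightarrow> 'w) \<Rightarrow> ((nat \<Rightarrow> 'v) \<Rightarrow> 'w) \<Rightarrow> bool" where
  "multilinear_on scale d V scaleW f \<longleftrightarrow>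
     (\<forall>v \<in> Pi\<^sub>E {..<d} V. \<forall>i<d.
        (\<forall>x\<in>V i. \<forall>y\<in>V i. f (v(i := x + y)) = f (v(i := x)) + f (v(i := y))) \<and>
        (\<forall>c. \<forall>x\<in>V i. f (v(i := scale c x)) = scaleW c (f (v(i := x)))))"

text \<open>\<open>V\<^sub>0 \<otimes> \<dots> \<otimes> V\<^sub>d\<^sub>-\<^sub>1\<close> is realised inside the dual of the space of
  multilinear forms on \<open>V\<^sub>0 \<times> \<dots> \<times> V\<^sub>d\<^sub>-\<^sub>1\<close>: a pure tensor
  \<open>v\<^sub>0 \<otimes> \<dots> \<otimes> v\<^sub>d\<^sub>-\<^sub>1\<close> is the evaluation of forms at \<open>(v\<^sub>0, \<dots>, v\<^sub>d\<^sub>-\<^sub>1)\<close>, and the tensor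
  product is the span of the pure tensors (its universal property is \<open>tensor_space_universal\<close>
  below). Functionals are extended by \<open>0\<close> to functions that are not multilinear.\<close>

definition tensor_scale ::
  "complex \<Rightarrow> (((nat \<Rightarrow> 'v) \<Rightarrow> complex) \<Rightarrow> complex) \<Rightarrow> (((nat \<Rightarrow> 'v) \<Rightarrow> complex) \<Rightarrow> complex)" where
  "tensor_scale c \<phi> = (\<lambda>f. c * \<phi> f)"

definition pure_tensor ::
  "(complex \<Rightarrow> 'v::ab_group_add \<Rightarrow> 'v) \<Rightarrow> nat \<Rightarrow> (nat \<Rightarrow> 'v set) \<Rightarrow>
   (nat \<Rightarrow> 'v) \<Rightarrow> (((nat \<Rightarrow> 'v) \<Rightarrow> complex) \<Rightarrow> complex)" where
  "pure_tensor scaleV d V v = (\<lambda>f. if multilinear_on scaleV d V (*) f then f v else 0)"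

definition tensor_space ::
  "(complex \<Rightarrow> 'v::ab_group_add \<Rightarrow> 'v) \<Rightarrow> nat \<Rightarrow> (nat \<Rightarrow> 'v set) \<Rightarrow>
   (((nat \<Rightarrow> 'v) \<Rightarrow> complex) \<Rightarrow> complex) set" where
  "tensor_space scaleV d V = module.span tensor_scale (pure_tensor scaleV d V ` Pi\<^sub>E {..<d} V)"

text \<open>The action of \<open>\<gg>[t]\<close> on the evaluation module, written as the transpose of an operator on
  multilinear forms; see \<open>evaluation_data.evaluation_act_pure_tensor\<close> below for the usual formula
  on pure tensors.\<close>

definition evaluation_act ::
  "(complex \<Rightarrow> 'g::ab_group_add \<Rightarrow> 'g) \<Rightarrow> (complex \<Rightarrow> 'v::ab_group_add \<Rightarrow> 'v) \<Rightarrow> nat \<Rightarrow>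
   (nat \<Rightarrow> 'v set) \<Rightarrow> (nat \<Rightarrow> 'g \<Rightarrow> 'v \<Rightarrow> 'v) \<Rightarrow> (nat \<Rightarrow> complex) \<Rightarrow>
   'g poly \<Rightarrow> (((nat \<Rightarrow> 'v) \<Rightarrow> complex) \<Rightarrow> complex) \<Rightarrow> (((nat \<Rightarrow> 'v) \<Rightarrow> complex) \<Rightarrow> complex)" where
  "evaluation_act scale scaleV d V \<rho> p X \<phi> =
     (\<lambda>f. if multilinear_on scaleV d V (*) f
          then \<phi> (\<lambda>v. \<Sum>i<d. f (v(i := \<rho> i (current_eval scale X (p i)) (v i))))
          else 0)"


section \<open>Basic properties\<close>

lemma (in lie_algebra)
  shows bracket_add_left: "bracket (x + y) z = bracket x z + bracket y z"
    and bracket_add_right: "bracket z (x + y) = bracket z x + bracket z y"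
    and bracket_scale_left: "bracket (scale c x) y = scale c (bracket x y)"
    and bracket_scale_right: "bracket y (scale c x) = scale c (bracket y x)"
    and bracket_zero_left: "bracket 0 x = 0"
    and bracket_zero_right: "bracket x 0 = 0"
proof -
  interpret L: Vector_Spaces.linear scale scale "\<lambda>x. bracket x z" for z
    by (rule bracket_linear_left)
  interpret R: Vector_Spaces.linear scale scale "bracket z" for z
    by (rule bracket_linear_right)
  show "bracket (x + y) z = bracket x z + bracket y z" by (rule L.add)
  show "bracket z (x + y) = bracket z x + bracket z y" by (rule R.add)
  show "bracket (scale c x) y = scale c (bracket x y)" by (rule L.scale)
  show "bracket y (scale c x) = scale c (bracket y x)" by (rule R.scale)
  show "bracket 0 x = 0" by (rule L.zero)
  show "bracket x 0 = 0" by (rule R.zero)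
qed

lemma (in lie_algebra) bracket_skew: "bracket x y = - bracket y x"
proof -
  have "0 = bracket (x + y) (x + y)" by (simp add: bracket_self)
  also have "\<dots> = bracket x y + bracket y x"
    unfolding bracket_add_left bracket_add_right by (simp add: bracket_self)
  finally have "bracket x y + bracket y x = 0" by simp
  then show ?thesis by (simp add: eq_neg_iff_add_eq_0)
qed

lemma (in lie_algebra) coeff_current_bracket:
  "coeff (current_bracket bracket X Y) n = (\<Sum>i\<le>n. bracket (coeff X i) (coeff Y (n - i)))"
proof -
  let ?b = "\<lambda>i j. bracket (coeff X i) (coeff Y j)"
  have "coeff (current_bracket bracket X Y) n =
      (\<Sum>i\<le>degree X. \<Sum>j\<le>degree Y. if i + j = n then ?b i j else 0)"
    by (simp add: current_bracket_def coeff_sum)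
  also have "\<dots> = (\<Sum>i\<le>degree X. if i \<le> n then ?b i (n - i) else 0)"
  proof (rule sum.cong[OF refl])
    fix i
    show "(\<Sum>j\<le>degree Y. if i + j = n then ?b i j else 0) = (if i \<le> n then ?b i (n - i) else 0)"
    proof (cases "i \<le> n")
      case True
      have "(\<Sum>j\<le>degree Y. if i + j = n then ?b i j else 0) =
          (\<Sum>j\<le>degree Y. if n - i = j then ?b i j else 0)"
        using True by (intro sum.cong) auto
      also have "\<dots> = ?b i (n - i)"
        by (auto simp: coeff_eq_0 bracket_zero_right)
      finally show ?thesis using True by simp
    qed auto
  qed
  also have "\<dots> = (\<Sum>i\<in>{..degree X} \<inter> {..n}. ?b i (n - i))"
    by (subst sum.inter_restrict) simp_all
  also have "\<dots> = (\<Sum>i\<le>n. ?b i (n - i))"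
    by (intro sum.mono_neutral_left) (auto simp: bracket_zero_left intro!: le_degree)
  finally show ?thesis .
qed

lemma (in lie_algebra) coeff_current_scale:
  "coeff (current_scale scale c X) n = scale c (coeff X n)"
  by (simp add: current_scale_def coeff_map_poly)

lemma (in lie_algebra) coeff_current_elem:
  "coeff (current_elem scale x P) n = scale (coeff P n) x"
  by (simp add: current_elem_def coeff_map_poly)

lemma (in lie_algebra) current_bracket_elem:
  "current_bracket bracket (current_elem scale x P) (current_elem scale y Q) =
     current_elem scale (bracket x y) (P * Q)"
  by (rule poly_eqI)
     (simp add: coeff_current_bracket coeff_current_elem coeff_mult bracket_scale_left
        bracket_scale_right scale_sum_left mult.commute)

lemma current_poly_induct [case_names add monom]:
  assumes "\<And>X Y. P X \<Longrightarrow> P Y \<Longrightarrow> P (X + Y)" and "\<And>a n. P (monom a n)"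
  shows "P (X :: 'g::ab_group_add poly)"
proof -
  have "P (\<Sum>i\<le>n. monom (coeff X i) i)" for n
    by (induction n) (simp_all add: assms)
  then show ?thesis by (metis poly_as_sum_of_monoms)
qed

lemma (in lie_algebra) current_vector_space: "vector_space (current_scale scale)"
  by unfold_locales
     (simp_all add: poly_eq_iff coeff_current_scale scale_left_distrib scale_right_distrib)

lemma (in lie_algebra) current_bracket_monom:
  "current_bracket bracket (monom a i) (monom b j) = monom (bracket a b) (i + j)"
proof (rule poly_eqI)
  fix n
  have "coeff (current_bracket bracket (monom a i) (monom b j)) n =
     (\<Sum>k\<le>n. if k = i then (if i + j = n then bracket a b else 0) else 0)"
    unfolding coeff_current_bracket
    by (intro sum.cong refl) (auto simp: bracket_zero_left bracket_zero_right)
  also have "\<dots> = coeff (monom (bracket a b) (i + j)) n"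
    by simp
  finally show "coeff (current_bracket bracket (monom a i) (monom b j)) n =
      coeff (monom (bracket a b) (i + j)) n" .
qed

lemma (in lie_algebra)
  shows current_bracket_add_left:
      "current_bracket bracket (X + Y) Z = current_bracket bracket X Z + current_bracket bracket Y Z"
    and current_bracket_add_right:
      "current_bracket bracket Z (X + Y) = current_bracket bracket Z X + current_bracket bracket Z Y"
    and current_bracket_scale_left:
      "current_bracket bracket (current_scale scale c X) Y =
         current_scale scale c (current_bracket bracket X Y)"
    and current_bracket_scale_right:
      "current_bracket bracket Y (current_scale scale c X) =
         current_scale scale c (current_bracket bracket Y X)"
  by (simp_all add: poly_eq_iff coeff_current_bracket coeff_current_scale bracket_add_left
        bracket_add_right bracket_scale_left bracket_scale_right sum.distrib scale_sum_right)

lemma (in lie_algebra) current_bracket_skew: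
  "current_bracket bracket X Y = - current_bracket bracket Y X"
proof (induction X rule: current_poly_induct)
  case (monom a i)
  show ?case
  proof (induction Y rule: current_poly_induct)
    case (monom b j)
    show ?case using bracket_skew[of a b]
      by (simp add: current_bracket_monom add.commute minus_monom)
  qed (simp add: current_bracket_add_left current_bracket_add_right)
qed (simp add: current_bracket_add_left current_bracket_add_right)

lemma (in lie_algebra) current_lie_algebra:
  "lie_algebra (current_scale scale) (current_bracket bracket)"
proof -
  let ?B = "current_bracket bracket"
  interpret C: vector_space "current_scale scale" by (rule current_vector_space)
  have J: "?B X (?B Y Z) + ?B Y (?B Z X) + ?B Z (?B X Y) = 0" for X Y Z
  proof (induction X rule: current_poly_induct)
    case (add X X')
    have "?B (X + X') (?B Y Z) + ?B Y (?B Z (X + X')) + ?B Z (?B (X + X') Y) =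
        (?B X (?B Y Z) + ?B Y (?B Z X) + ?B Z (?B X Y)) +
        (?B X' (?B Y Z) + ?B Y (?B Z X') + ?B Z (?B X' Y))"
      by (simp add: current_bracket_add_left current_bracket_add_right algebra_simps)
    then show ?case using add by simp
  next
    case (monom a i)
    show ?case
    proof (induction Y rule: current_poly_induct)
      case (add Y Y')
      have "?B (monom a i) (?B (Y + Y') Z) + ?B (Y + Y') (?B Z (monom a i)) + ?B Z (?B (monom a i) (Y + Y')) =
          (?B (monom a i) (?B Y Z) + ?B Y (?B Z (monom a i)) + ?B Z (?B (monom a i) Y)) +
          (?B (monom a i) (?B Y' Z) + ?B Y' (?B Z (monom a i)) + ?B Z (?B (monom a i) Y'))"
        by (simp add: current_bracket_add_left current_bracket_add_right algebra_simps)
      then show ?case using add by simp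
    next
      case (monom b j)
      show ?case
      proof (induction Z rule: current_poly_induct)
        case (add Z Z')
        let ?X = "monom a i" and ?Y = "monom b j"
        have "?B ?X (?B ?Y (Z + Z')) + ?B ?Y (?B (Z + Z') ?X) + ?B (Z + Z') (?B ?X ?Y) =
            (?B ?X (?B ?Y Z) + ?B ?Y (?B Z ?X) + ?B Z (?B ?X ?Y)) +
            (?B ?X (?B ?Y Z') + ?B ?Y (?B Z' ?X) + ?B Z' (?B ?X ?Y))"
          by (simp only: current_bracket_add_left current_bracket_add_right ac_simps)
        then show ?case using add by simp
      next
        case (monom c k)
        have e: "j + (k + i) = i + (j + k)" "k + (i + j) = i + (j + k)"
          by simp_all
        show ?case
          by (simp only: current_bracket_monom e add_monom jacobi) simp
      qed
    qed
  qed
  have S: "?B X X = 0" for X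
  proof -
    have "?B X X = - ?B X X" by (rule current_bracket_skew)
    then have "current_scale scale 2 (?B X X) = 0"
      by (metis C.scale_left_distrib C.scale_one one_add_one eq_neg_iff_add_eq_0)
    then show ?thesis by simp
  qed
  show ?thesis
    by unfold_locales
       (simp_all add: C.module_axioms current_bracket_add_left current_bracket_add_right
          current_bracket_scale_left current_bracket_scale_right S J)
qed

lemma (in lie_algebra) current_eval_upto:
  assumes "degree X \<le> N"
  shows "current_eval scale X c = (\<Sum>n\<le>N. scale (c ^ n) (coeff X n))"
  unfolding current_eval_def using assms
  by (intro sum.mono_neutral_left) (auto simp: coeff_eq_0 not_le)

lemma (in lie_algebra) current_eval_add:
  "current_eval scale (X + Y) c = current_eval scale X c + current_eval scale Y c"
proof -
  let ?N = "max (degree X) (degree Y)"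
  have "degree (X + Y) \<le> ?N" by (rule degree_add_le_max)
  then show ?thesis
    by (simp add: current_eval_upto[of _ ?N] scale_right_distrib sum.distrib)
qed

lemma (in lie_algebra) current_eval_scale:
  "current_eval scale (current_scale scale a X) c = scale a (current_eval scale X c)"
proof -
  have "degree (current_scale scale a X) \<le> degree X"
    by (rule degree_le) (auto simp: coeff_current_scale coeff_eq_0)
  then show ?thesis
    by (simp add: current_eval_upto[of _ "degree X"] coeff_current_scale scale_sum_right mult.commute)
qed

lemma (in lie_algebra) current_eval_monom:
  "current_eval scale (monom a n) c = scale (c ^ n) a"
proof -
  have "(\<Sum>k\<le>n. scale (c ^ k) (coeff (monom a n) k)) = (\<Sum>k\<le>n. if k = n then scale (c ^ n) a else 0)"
    by (intro sum.cong) auto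
  also have "\<dots> = scale (c ^ n) a" by simp
  finally show ?thesis by (simp add: current_eval_upto[OF degree_monom_le])
qed

lemma (in lie_algebra) current_eval_elem:
  "current_eval scale (current_elem scale x P) c = scale (poly P c) x"
proof -
  have "degree (current_elem scale x P) \<le> degree P"
    by (rule degree_le) (auto simp: coeff_current_elem coeff_eq_0)
  then show ?thesis
    by (simp add: current_eval_upto[of _ "degree P"] coeff_current_elem poly_altdef
        scale_sum_left mult.commute)
qed

lemma (in lie_algebra) current_eval_bracket:
  "current_eval scale (current_bracket bracket X Y) c =
     bracket (current_eval scale X c) (current_eval scale Y c)"
proof (induction X rule: current_poly_induct)
  case (monom a i)
  show ?case
    by (induction Y rule: current_poly_induct)
       (simp_all add: current_bracket_add_right current_eval_add bracket_add_right
          current_bracket_monom current_eval_monom bracket_scale_left bracket_scale_right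
          power_add mult.commute)
qed (simp add: current_bracket_add_left current_eval_add bracket_add_left)

lemma free_ring_ring: "ring (free_ring :: 'a free_algebra ring)"
proof (rule ringI)
  show "abelian_group (free_ring :: 'a free_algebra ring)"
    by (rule abelian_groupI) (auto simp: free_ring_def ac_simps intro: exI[of _ "- x" for x])
  show "Group.monoid (free_ring :: 'a free_algebra ring)"
    by (rule monoidI) (auto simp: free_ring_def mult.assoc)
qed (auto simp: free_ring_def algebra_simps)

lemma free_algebra_induct [case_names add single]:
  assumes "\<And>f g. P f \<Longrightarrow> P g \<Longrightarrow> P (f + g)" and "\<And>w c. P (Poly_Mapping.single w c)"
  shows "P (f :: 'a free_algebra)"
proof (induction f rule: update_induct)
  case const
  show ?case using assms(2)[of undefined 0] by simp
next
  case (update f w c)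
  have "Poly_Mapping.update w c f = f + Poly_Mapping.single w c"
    using update(1)
    by (intro poly_mapping_eqI)
       (auto simp: lookup_update lookup_add lookup_single in_keys_iff when_def)
  then show ?case using assms update by simp
qed

context lie_module
begin

lemma free_act_superset:
  assumes "finite A" "Poly_Mapping.keys f \<subseteq> A"
  shows "free_act scaleV \<rho> f v = (\<Sum>w\<in>A. scaleV (Poly_Mapping.lookup f w) (foldr \<rho> (letters w) v))"
  unfolding free_act_def using assms
  by (intro sum.mono_neutral_left) (auto simp: in_keys_iff)

lemma free_act_add: "free_act scaleV \<rho> (f + g) v = free_act scaleV \<rho> f v + free_act scaleV \<rho> g v"
proof -
  let ?A = "Poly_Mapping.keys f \<union> Poly_Mapping.keys g"
  have "finite ?A" "Poly_Mapping.keys (f + g) \<subseteq> ?A" by (simp_all add: keys_add)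
  then show ?thesis
    by (simp add: free_act_superset[of ?A] lookup_add V.scale_left_distrib sum.distrib)
qed

lemma free_act_single:
  "free_act scaleV \<rho> (Poly_Mapping.single w c) v = scaleV c (foldr \<rho> (letters w) v)"
  by (simp add: free_act_superset[of "{w}"])

lemma free_act_zero: "free_act scaleV \<rho> 0 v = 0"
  by (simp add: free_act_def)

lemma free_act_diff: "free_act scaleV \<rho> (f - g) v = free_act scaleV \<rho> f v - free_act scaleV \<rho> g v"
  using free_act_add[of "f - g" g v] by (simp add: algebra_simps)

lemma foldr_act_closed: "v \<in> M \<Longrightarrow> foldr \<rho> xs v \<in> M"
  by (induction xs) (auto simp: act_closed)

lemma foldr_act_linear:
  assumes "v \<in> M" "w \<in> M"
  shows "foldr \<rho> xs (v + w) = foldr \<rho> xs v + foldr \<rho> xs w"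
    and "foldr \<rho> xs (scaleV c v) = scaleV c (foldr \<rho> xs v)"
  using assms by (induction xs) (auto simp: act_add_right act_scale_right foldr_act_closed)

lemma free_act_closed: "v \<in> M \<Longrightarrow> free_act scaleV \<rho> f v \<in> M"
  by (induction f rule: free_algebra_induct)
     (auto simp: free_act_add free_act_single foldr_act_closed
       intro: V.subspace_add[OF subspace_carrier] V.subspace_scale[OF subspace_carrier])

lemma free_act_linear:
  assumes "v \<in> M" "w \<in> M"
  shows "free_act scaleV \<rho> f (v + w) = free_act scaleV \<rho> f v + free_act scaleV \<rho> f w"
    and "free_act scaleV \<rho> f (scaleV c v) = scaleV c (free_act scaleV \<rho> f v)"
proof -
  show "free_act scaleV \<rho> f (v + w) = free_act scaleV \<rho> f v + free_act scaleV \<rho> f w"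
    using assms by (induction f rule: free_algebra_induct)
      (simp_all add: free_act_add free_act_single foldr_act_linear V.scale_right_distrib)
  show "free_act scaleV \<rho> f (scaleV c v) = scaleV c (free_act scaleV \<rho> f v)"
    using assms by (induction f rule: free_algebra_induct)
      (simp_all add: free_act_add free_act_single foldr_act_linear V.scale_right_distrib mult.commute)
qed

lemma free_act_mult:
  assumes "v \<in> M"
  shows "free_act scaleV \<rho> (f * g) v = free_act scaleV \<rho> f (free_act scaleV \<rho> g v)"
proof (induction f rule: free_algebra_induct)
  case (single w c)
  show ?case
  proof (induction g rule: free_algebra_induct)
    case (add g h)
    then show ?case
      using assms by (simp add: distrib_left free_act_add free_act_linear free_act_closed)
  next
    case (single w' c')
    show ?case
      using assms by (simp add: mult_single free_act_single plus_free_monoid_def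
          foldr_act_linear foldr_act_closed)
  qed
qed (simp add: distrib_right free_act_add)

lemma free_act_uea_ideal:
  assumes "f \<in> uea_ideal scale bracket" "v \<in> M"
  shows "free_act scaleV \<rho> f v = 0"
proof -
  define K where "K = {f. \<forall>v\<in>M. free_act scaleV \<rho> f v = 0}"
  interpret R: ring "free_ring :: 'g free_algebra ring" by (rule free_ring_ring)
  have zero: "free_act scaleV \<rho> f 0 = 0" for f
    using free_act_linear(2)[of 0 0 f 0] V.subspace_0[OF subspace_carrier] by simp
  have inv: "\<ominus>\<^bsub>free_ring\<^esub> f = - f" for f :: "'g free_algebra"
    by (rule R.minus_equality) (auto simp: free_ring_def)
  have "ideal K free_ring"
  proof (rule idealI[OF free_ring_ring])
    show "subgroup K (add_monoid free_ring)"
    proof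
      fix f assume "f \<in> K"
      then have "- f \<in> K"
        using free_act_diff[of 0 f] by (auto simp: K_def free_act_zero)
      then show "inv\<^bsub>add_monoid free_ring\<^esub> f \<in> K"
        using inv[of f] by (simp add: a_inv_def)
    qed (auto simp: free_ring_def K_def free_act_add free_act_zero)
  qed (auto simp: free_ring_def K_def free_act_mult free_act_closed zero)
  moreover have "uea_relations scale bracket \<subseteq> K"
    by (auto simp: uea_relations_def K_def free_act_diff free_act_mult free_gen_def free_const_def
        free_act_single zero_free_monoid_def act_add_left act_scale_left act_bracket)
  ultimately have "uea_ideal scale bracket \<subseteq> K"
    unfolding uea_ideal_def by (rule R.genideal_minimal)
  then show ?thesis using assms by (auto simp: K_def)
qed

lemma uea_act_eq:
  assumes "u \<in> carrier (uea scale bracket)" "f \<in> u" "v \<in> M"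
  shows "uea_act scaleV \<rho> u v = free_act scaleV \<rho> f v"
proof -
  obtain g where u: "u = {h + g | h. h \<in> uea_ideal scale bracket}"
    using assms(1)
    by (auto simp: uea_def FactRing_def A_RCOSETS_def' a_r_coset_def' free_ring_def)
  have "free_act scaleV \<rho> h v = free_act scaleV \<rho> g v" if "h \<in> u" for h
    using that assms(3) by (auto simp: u free_act_add free_act_uea_ideal)
  then have "(\<lambda>h. free_act scaleV \<rho> h v) ` u = {free_act scaleV \<rho> f v}"
    using assms(2) by auto
  then show ?thesis by (simp add: uea_act_def)
qed

end

lemma tensor_vector_space: "vector_space tensor_scale"
  by unfold_locales (simp_all add: tensor_scale_def fun_eq_iff algebra_simps)

lemma multilinear_onD:
  assumes "multilinear_on scale d V scaleW f" "v \<in> Pi\<^sub>E {..<d} V" "i < d" "x \<in> V i"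
  shows "y \<in> V i \<Longrightarrow> f (v(i := x + y)) = f (v(i := x)) + f (v(i := y))"
    and "f (v(i := scale c x)) = scaleW c (f (v(i := x)))"
  using assms by (simp_all add: multilinear_on_def)

lemma PiE_lessThan_upd:
  "v \<in> Pi\<^sub>E {..<d} V \<Longrightarrow> i < (d::nat) \<Longrightarrow> x \<in> V i \<Longrightarrow> v(i := x) \<in> Pi\<^sub>E {..<d} V"
  by (auto simp: PiE_iff extensional_def)

lemma multilinear_on_pure_tensor:
  "multilinear_on scaleV d V tensor_scale (pure_tensor scaleV d V)"
  by (auto simp: multilinear_on_def pure_tensor_def tensor_scale_def fun_eq_iff)

lemma tensor_space_universal:
  fixes scaleV :: "complex \<Rightarrow> 'v::ab_group_add \<Rightarrow> 'v"
    and scaleW :: "complex \<Rightarrow> 'w::ab_group_add \<Rightarrow> 'w"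
  assumes W: "vector_space scaleW" and m: "multilinear_on scaleV d V scaleW m"
  shows "\<exists>g. Vector_Spaces.linear tensor_scale scaleW g \<and>
             (\<forall>v \<in> Pi\<^sub>E {..<d} V. g (pure_tensor scaleV d V v) = m v)"
proof -
  interpret T: vector_space tensor_scale by (rule tensor_vector_space)
  interpret W: vector_space scaleW by (rule W)
  interpret TW: vector_space_pair tensor_scale scaleW ..
  interpret C: vector_space "(*) :: complex \<Rightarrow> complex \<Rightarrow> complex"
    by unfold_locales (simp_all add: algebra_simps)
  interpret WC: vector_space_pair scaleW "(*) :: complex \<Rightarrow> complex \<Rightarrow> complex" ..
  let ?pure = "pure_tensor scaleV d V" and ?P = "Pi\<^sub>E {..<d} V"
  obtain B where B: "B \<subseteq> ?pure ` ?P" "T.independent B" "?pure ` ?P \<subseteq> T.span B"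
    by (rule T.maximal_independent_subset)
  define r where "r b = (SOME v. v \<in> ?P \<and> ?pure v = b)" for b
  have r: "r b \<in> ?P" "?pure (r b) = b" if "b \<in> B" for b
  proof -
    have "\<exists>v. v \<in> ?P \<and> ?pure v = b" using B(1) that by auto
    from someI_ex[OF this] show "r b \<in> ?P" "?pure (r b) = b" by (simp_all add: r_def)
  qed
  obtain g where g: "Vector_Spaces.linear tensor_scale scaleW g" "\<And>b. b \<in> B \<Longrightarrow> g b = m (r b)"
    using TW.linear_independent_extend[OF B(2), of "\<lambda>b. m (r b)"] by blast
  interpret g: Vector_Spaces.linear tensor_scale scaleW g by (rule g)
  have "g (?pure v) = m v" if v: "v \<in> ?P" for v
  proof (rule ccontr)
    assume ne: "g (?pure v) \<noteq> m v"
    have "?pure v \<in> T.span B" using B(3) v by blast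
    then obtain S c where S: "finite S" "S \<subseteq> B" "?pure v = (\<Sum>b\<in>S. tensor_scale (c b) b)"
      by (auto simp: T.span_explicit)
    have ind: "W.independent {m v - g (?pure v)}"
      using ne by simp
    obtain l where l: "Vector_Spaces.linear scaleW (*) l" "l (m v - g (?pure v)) = (1::complex)"
      using WC.linear_independent_extend[OF ind, of "\<lambda>_. 1"] by auto
    interpret l: Vector_Spaces.linear scaleW "(*)" l by (rule l)
    let ?f = "\<lambda>v. l (m v)"
    have f: "multilinear_on scaleV d V (*) ?f"
      using m by (auto simp: multilinear_on_def l.add l.scale)
    have "?f v = ?pure v ?f"
      using f by (simp add: pure_tensor_def)
    also have "\<dots> = (\<Sum>b\<in>S. c b * b ?f)"
      unfolding S(3) by (induction S rule: infinite_finite_induct) (simp_all add: tensor_scale_def)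
    also have "\<dots> = (\<Sum>b\<in>S. c b * l (g b))"
    proof (rule sum.cong[OF refl])
      fix b assume "b \<in> S"
      then have "b \<in> B" using S by blast
      then have "b ?f = ?pure (r b) ?f" by (simp add: r)
      also have "\<dots> = l (g b)" using f g(2)[OF \<open>b \<in> B\<close>] by (simp add: pure_tensor_def)
      finally show "c b * b ?f = c b * l (g b)" by simp
    qed
    also have "\<dots> = l (g (?pure v))"
      by (simp add: S(3) g.sum g.scale l.sum l.scale)
    finally show False using l(2) by (simp add: l.diff)
  qed
  then show ?thesis using g(1) by blast
qed

locale evaluation_data = lie_algebra scale bracket
  for scale :: "complex \<Rightarrow> 'g::ab_group_add \<Rightarrow> 'g" and bracket +
  fixes d :: nat
    and scaleV :: "complex \<Rightarrow> 'v::ab_group_add \<Rightarrow> 'v"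
    and V :: "nat \<Rightarrow> 'v set"
    and \<rho> :: "nat \<Rightarrow> 'g \<Rightarrow> 'v \<Rightarrow> 'v"
    and p :: "nat \<Rightarrow> complex"
  assumes modules: "i < d \<Longrightarrow> lie_module scale bracket scaleV (V i) (\<rho> i)"
begin

abbreviation "pure \<equiv> pure_tensor scaleV d V"
abbreviation "ev \<equiv> evaluation_act scale scaleV d V \<rho> p"
abbreviation "form \<equiv> multilinear_on scaleV d V (*)"

definition slot :: "nat \<Rightarrow> 'g \<Rightarrow> (nat \<Rightarrow> 'v) \<Rightarrow> (nat \<Rightarrow> 'v)" where
  "slot i x v = v(i := \<rho> i x (v i))"

lemma slot_PiE: "v \<in> Pi\<^sub>E {..<d} V \<Longrightarrow> i < d \<Longrightarrow> slot i x v \<in> Pi\<^sub>E {..<d} V"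
  unfolding slot_def by (intro PiE_lessThan_upd lie_module.act_closed[OF modules]) auto

lemma form_slot:
  assumes f: "form f" and i: "i < d"
  shows "form (\<lambda>v. f (slot i x v))"
  unfolding multilinear_on_def
proof (intro ballI allI impI conjI)
  fix v j
  assume v: "v \<in> Pi\<^sub>E {..<d} V" and j: "j < d"
  interpret I: lie_module scale bracket scaleV "V i" "\<rho> i" by (rule modules[OF i])
  have vi: "v(i := \<rho> i x (v i)) \<in> Pi\<^sub>E {..<d} V"
    using slot_PiE[OF v i] by (simp add: slot_def)
  have other: "slot i x (v(j := y)) = (v(i := \<rho> i x (v i)))(j := y)" if "i \<noteq> j" for y
    using that by (simp add: slot_def fun_upd_twist)
  have same: "slot i x (v(j := y)) = v(i := \<rho> i x y)" if "i = j" for y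
    using that by (simp add: slot_def)
  {
    fix y z assume y: "y \<in> V j" and z: "z \<in> V j"
    show "f (slot i x (v(j := y + z))) = f (slot i x (v(j := y))) + f (slot i x (v(j := z)))"
    proof (cases "i = j")
      case True
      then have y': "y \<in> V i" and z': "z \<in> V i" using y z by simp_all
      show ?thesis
        unfolding same[OF True] I.act_add_right[OF y' z']
        by (rule multilinear_onD(1)[OF f v i I.act_closed[OF y'] I.act_closed[OF z']])
    next
      case False
      then show ?thesis
        using y z by (simp add: other multilinear_onD(1)[OF f vi j])
    qed
  }
  fix c y assume y: "y \<in> V j"
  show "f (slot i x (v(j := scaleV c y))) = c * f (slot i x (v(j := y)))"
  proof (cases "i = j")
    case True
    then have y': "y \<in> V i" using y by simp
    show ?thesis
      unfolding same[OF True] I.act_scale_right[OF y']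
      by (rule multilinear_onD(2)[OF f v i I.act_closed[OF y']])
  next
    case False
    then show ?thesis
      using y by (simp add: other multilinear_onD(2)[OF f vi j])
  qed
qed

lemma form_sum: "(\<And>i. i \<in> A \<Longrightarrow> form (F i)) \<Longrightarrow> form (\<lambda>v. \<Sum>i\<in>A. F i v)"
  by (simp add: multilinear_on_def sum.distrib sum_distrib_left)

lemma ev_add: "ev X (\<phi> + \<psi>) = ev X \<phi> + ev X \<psi>"
  by (auto simp: evaluation_act_def fun_eq_iff)

lemma ev_scale: "ev X (tensor_scale c \<phi>) = tensor_scale c (ev X \<phi>)"
  by (auto simp: evaluation_act_def tensor_scale_def fun_eq_iff)

lemma ev_pure:
  assumes "v \<in> Pi\<^sub>E {..<d} V"
  shows "ev X (pure v) = (\<Sum>i<d. pure (slot i (current_eval scale X (p i)) v))"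
proof
  fix f
  have "(\<Sum>i\<in>A. pure (w i)) f = (\<Sum>i\<in>A. pure (w i) f)" for A :: "nat set" and w
    by (induction A rule: infinite_finite_induct) simp_all
  moreover have "form (\<lambda>v. \<Sum>i<d. f (slot i (current_eval scale X (p i)) v))" if "form f"
    by (intro form_sum form_slot that) simp
  ultimately show "ev X (pure v) f = (\<Sum>i<d. pure (slot i (current_eval scale X (p i)) v)) f"
    by (simp add: evaluation_act_def pure_tensor_def slot_def)
qed

lemma evaluation_act_pure_tensor:
  assumes v: "v \<in> Pi\<^sub>E {..<d} V"
  shows "ev (current_elem scale x P) (pure v) =
    (\<Sum>i<d. tensor_scale (poly P (p i)) (pure (v(i := \<rho> i x (v i)))))"
  unfolding ev_pure[OF v]
proof (intro sum.cong refl)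
  fix i assume "i \<in> {..<d}"
  then have i: "i < d" by simp
  interpret I: lie_module scale bracket scaleV "V i" "\<rho> i" by (rule modules[OF i])
  have vi: "v i \<in> V i" using v i by auto
  show "pure (slot i (current_eval scale (current_elem scale x P) (p i)) v) =
      tensor_scale (poly P (p i)) (pure (v(i := \<rho> i x (v i))))"
    using multilinear_onD(2)[OF multilinear_on_pure_tensor v i, of "\<rho> i x (v i)"] vi
    by (simp add: slot_def current_eval_elem I.act_scale_left I.act_closed)
qed

lemma pure_slot_linear:
  assumes v: "v \<in> Pi\<^sub>E {..<d} V" and i: "i < d"
  shows "pure (slot i (x + y) v) = pure (slot i x v) + pure (slot i y v)"
    and "pure (slot i (scale c x) v) = tensor_scale c (pure (slot i x v))"
proof -
  interpret I: lie_module scale bracket scaleV "V i" "\<rho> i" by (rule modules[OF i])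
  have vi: "v i \<in> V i" using v i by auto
  show "pure (slot i (x + y) v) = pure (slot i x v) + pure (slot i y v)"
    using multilinear_onD(1)[OF multilinear_on_pure_tensor v i, of "\<rho> i x (v i)" "\<rho> i y (v i)"] vi
    by (simp add: slot_def I.act_add_left I.act_closed)
  show "pure (slot i (scale c x) v) = tensor_scale c (pure (slot i x v))"
    using multilinear_onD(2)[OF multilinear_on_pure_tensor v i, of "\<rho> i x (v i)"] vi
    by (simp add: slot_def I.act_scale_left I.act_closed)
qed

lemma pure_slot_bracket:
  assumes v: "v \<in> Pi\<^sub>E {..<d} V" and i: "i < d"
  shows "pure (slot i (bracket x y) v) + pure (slot i y (slot i x v)) = pure (slot i x (slot i y v))"
proof -
  interpret I: lie_module scale bracket scaleV "V i" "\<rho> i" by (rule modules[OF i])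
  have vi: "v i \<in> V i" using v i by auto
  have "pure (v(i := \<rho> i (bracket x y) (v i) + \<rho> i y (\<rho> i x (v i)))) =
      pure (v(i := \<rho> i (bracket x y) (v i))) + pure (v(i := \<rho> i y (\<rho> i x (v i))))"
    by (rule multilinear_onD(1)[OF multilinear_on_pure_tensor v i])
       (simp_all only: I.act_closed vi)
  then show ?thesis
    by (simp add: slot_def I.act_bracket vi)
qed

lemma slot_commute: "i \<noteq> j \<Longrightarrow> slot i x (slot j y v) = slot j y (slot i x v)"
  by (simp add: slot_def fun_upd_twist)

lemma evaluation_lie_module:
  "lie_module (current_scale scale) (current_bracket bracket) tensor_scale (tensor_space scaleV d V) ev"
proof -
  interpret L: lie_algebra "current_scale scale" "current_bracket bracket"
    by (rule current_lie_algebra)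
  interpret T: vector_space tensor_scale by (rule tensor_vector_space)
  let ?T = "tensor_space scaleV d V"
  have subsp: "T.subspace ?T"
    unfolding tensor_space_def by (rule T.subspace_span)
  have pure_mem: "pure v \<in> ?T" if "v \<in> Pi\<^sub>E {..<d} V" for v
    unfolding tensor_space_def using that by (intro T.span_base) auto
  have induct: "Q \<phi>"
    if "\<phi> \<in> ?T" "Q 0" "\<And>\<phi> \<psi>. Q \<phi> \<Longrightarrow> Q \<psi> \<Longrightarrow> Q (\<phi> + \<psi>)" "\<And>c \<phi>. Q \<phi> \<Longrightarrow> Q (tensor_scale c \<phi>)"
       "\<And>v. v \<in> Pi\<^sub>E {..<d} V \<Longrightarrow> Q (pure v)" for Q \<phi>
  proof -
    have "T.subspace {\<phi>. Q \<phi>}" using that(2-4) by (simp add: T.subspace_def)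
    then show ?thesis
      using that(1,5) unfolding tensor_space_def
      by (metis (mono_tags, lifting) T.span_induct imageE mem_Collect_eq)
  qed
  have zero: "ev X 0 = 0" for X
    by (auto simp: evaluation_act_def fun_eq_iff)
  have sum: "ev X (sum F A) = (\<Sum>a\<in>A. ev X (F a))" for X F and A :: "nat set"
    by (induction A rule: infinite_finite_induct) (simp_all only: sum.infinite sum.empty sum.insert zero ev_add simp_thms)
  show ?thesis
  proof (unfold_locales, goal_cases)
    case 1
    show ?case by (rule subsp)
  next
    case (2 \<phi> X)
    then show ?case
    proof (rule induct[of \<phi> "\<lambda>\<phi>. ev X \<phi> \<in> ?T"])
      show "ev X 0 \<in> ?T" unfolding zero by (rule T.subspace_0[OF subsp])
      show "ev X (\<phi> + \<psi>) \<in> ?T" if "ev X \<phi> \<in> ?T" "ev X \<psi> \<in> ?T" for \<phi> \<psi>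
        unfolding ev_add using that by (rule T.subspace_add[OF subsp])
      show "ev X (tensor_scale c \<phi>) \<in> ?T" if "ev X \<phi> \<in> ?T" for c \<phi>
        unfolding ev_scale using that by (rule T.subspace_scale[OF subsp])
      show "ev X (pure v) \<in> ?T" if "v \<in> Pi\<^sub>E {..<d} V" for v
        unfolding ev_pure[OF that]
        by (rule T.subspace_sum[OF subsp]) (simp add: pure_mem slot_PiE that)
    qed
  next
    case (3 \<phi> X Y)
    then show ?case
    proof (rule induct[of \<phi> "\<lambda>\<phi>. ev (X + Y) \<phi> = ev X \<phi> + ev Y \<phi>"])
      show "ev (X + Y) (pure v) = ev X (pure v) + ev Y (pure v)" if "v \<in> Pi\<^sub>E {..<d} V" for v
        unfolding ev_pure[OF that] current_eval_add sum.distrib[symmetric]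
        by (intro sum.cong refl pure_slot_linear that) simp
    qed (simp_all only: zero ev_add ev_scale T.scale_right_distrib ac_simps add_0)
  next
    case (4 \<phi> c X)
    then show ?case
    proof (rule induct[of \<phi> "\<lambda>\<phi>. ev (current_scale scale c X) \<phi> = tensor_scale c (ev X \<phi>)"])
      show "ev (current_scale scale c X) (pure v) = tensor_scale c (ev X (pure v))"
        if "v \<in> Pi\<^sub>E {..<d} V" for v
        unfolding ev_pure[OF that] current_eval_scale T.scale_sum_right
        by (intro sum.cong refl pure_slot_linear that) simp
    qed (simp_all only: zero ev_add ev_scale T.scale_right_distrib T.scale_scale T.scale_zero_right mult.commute)
  next
    case (5 \<phi> \<psi> X)
    show ?case by (rule ev_add)
  next
    case (6 \<phi> X c)
    show ?case by (rule ev_scale)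
  next
    case (7 \<phi> X Y)
    then show ?case
    proof (rule induct[of \<phi> "\<lambda>\<phi>. ev (current_bracket bracket X Y) \<phi> =
          ev X (ev Y \<phi>) - ev Y (ev X \<phi>)"])
      fix v assume v: "v \<in> Pi\<^sub>E {..<d} V"
      let ?x = "\<lambda>i. current_eval scale X (p i)" and ?y = "\<lambda>i. current_eval scale Y (p i)"
      have swap: "(\<Sum>i<d. \<Sum>j<d. F i j) = (\<Sum>i<d. \<Sum>j<d. F j i)"
        for F :: "nat \<Rightarrow> nat \<Rightarrow> ((nat \<Rightarrow> 'v) \<Rightarrow> complex) \<Rightarrow> complex"
        by (rule sum.swap)
      have delta: "(\<Sum>i<d. \<Sum>j<d. if i = j then F i else 0) = (\<Sum>i<d. F i)"
        for F :: "nat \<Rightarrow> ((nat \<Rightarrow> 'v) \<Rightarrow> complex) \<Rightarrow> complex"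
        by (intro sum.cong refl)
           (simp only: sum.delta' finite_lessThan lessThan_iff if_True simp_thms)
      have "ev (current_bracket bracket X Y) (pure v) + ev Y (ev X (pure v)) =
          (\<Sum>i<d. pure (slot i (bracket (?x i) (?y i)) v)) +
          (\<Sum>i<d. \<Sum>j<d. pure (slot j (?y j) (slot i (?x i) v)))"
        by (simp only: ev_pure[OF v] sum current_eval_bracket) (simp add: ev_pure slot_PiE v)
      also have "\<dots> = (\<Sum>i<d. (\<Sum>j<d. if i = j then pure (slot i (bracket (?x i) (?y i)) v) else 0) +
             (\<Sum>j<d. pure (slot i (?y i) (slot j (?x j) v))))"
        unfolding swap[of "\<lambda>i j. pure (slot j (?y j) (slot i (?x i) v))"] delta sum.distrib ..
      also have "\<dots> = (\<Sum>i<d. \<Sum>j<d. (if i = j then pure (slot i (bracket (?x i) (?y i)) v) else 0) +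
             pure (slot i (?y i) (slot j (?x j) v)))"
        unfolding sum.distrib ..
      also have "\<dots> = (\<Sum>i<d. \<Sum>j<d. pure (slot j (?x j) (slot i (?y i) v)))"
        by (intro sum.cong refl) (auto simp: pure_slot_bracket v slot_commute)
      also have "\<dots> = ev X (ev Y (pure v))"
        by (simp only: ev_pure[OF v] sum) (simp add: ev_pure slot_PiE v)
      finally show "ev (current_bracket bracket X Y) (pure v) = ev X (ev Y (pure v)) - ev Y (ev X (pure v))"
        by (simp add: eq_diff_eq)
    qed (simp_all only: zero ev_add ev_scale T.scale_right_diff_distrib diff_self add_diff_add)
  qed
qed

end

end

theory Submission
  imports Defs "HOL-Computational_Algebra.Fundamental_Theorem_Algebra"
begin

text \<open>With the Lagrange polynomials \<open>P\<^sub>i\<close> of the evaluation points, \<open>x \<otimes> P\<^sub>i\<close> acts on the \<open>i\<close>-th tensor factor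
  alone. Burnside's theorem on each factor then shows that every linear operator on the evaluation
  module is the action of a polynomial in the elements \<open>b \<otimes> P\<^sub>i\<close>, \<open>b\<close> a basis element. Such
  polynomials of bounded degree form a finite dimensional module under the adjoint action, on which
  the center acts trivially, so an equivariant operator lifts to an invariant polynomial, that is, to
  an element of \<open>[U(\<gg>[t])]\<^sup>\<gg>\<close>. So any isomorphism between two simple submodules is the action of an
  invariant. A nonzero stable subspace of an isotypic component contains one of the
  simple submodules of the given type, hence all of them.\<close>

text \<open>The obstacle is that a simple submodule \<open>L\<close> of the tensor product comes
  without an equivariant complement, so an isomorphism \<open>L \<rightarrow> K\<close> cannot just
  be extended by zero to an equivariant operator. It is therefore realised as a linear map on
  \<open>L\<close> alone. The resulting polynomial is invariant up to polynomials that annihilate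
  \<open>L\<close>, and the correction is sought among these. Lifting takes place among polynomials
  and not in the module because the center may act on the tensor factors by nonzero scalars. The
  polynomials live in the free algebra: words of bounded length in finitely many letters visibly
  span a finite dimensional space there, and re-expanding each commutator in the letters makes the
  adjoint action exact. The enveloping algebra is reached by congruences modulo its defining ideal.
  Reductivity, given as the existence of complementary ideals, enters in two ways: the Lie algebra
  is the sum of its derived ideal and central elements, and the radical of a trace form has a
  complementary ideal on which the form is nondegenerate.\<close>

section \<open>Linear maps on subspaces of a complex vector space\<close>

locale complex_space = vector_space scale
  for scale :: "complex \<Rightarrow> 'v::ab_group_add \<Rightarrow> 'v"
begin

lemma finite_dim_basis:
  assumes "finite_dim scale V"
  obtains B where "finite B" "independent B" "span B = V"
proof -
  obtain S where S: "finite S" "span S = V" using assms by (auto simp: finite_dim_def)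
  obtain B where B: "B \<subseteq> S" "independent B" "S \<subseteq> span B"
    using maximal_independent_subset by blast
  then have "span B = V" using S(2) by (metis span_eq span_mono span_span subset_antisym)
  then show ?thesis using B S finite_subset that by blast
qed

lemma finite_dim_subspace: "finite_dim scale V \<Longrightarrow> subspace V"
  by (metis finite_dim_def subspace_span)

lemma finite_dim_extend_basis:
  assumes "finite_dim scale V" "A \<subseteq> V" "independent A"
  obtains B where "A \<subseteq> B" "finite B" "independent B" "span B = V"
proof -
  obtain S where S: "finite S" "span S = V" using assms by (auto simp: finite_dim_def)
  obtain B where B: "A \<subseteq> B" "B \<subseteq> V" "independent B" "V \<subseteq> span B"
    using maximal_independent_subset_extend[OF assms(2,3)] by blast
  have "span B = V" using B S by (metis span_mono span_span subset_antisym)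
  moreover have "finite B" using independent_span_bound[OF S(1) B(3)] B S by auto
  ultimately show ?thesis using B that by blast
qed

lemma finite_dim_mono:
  assumes V: "finite_dim scale V" and U: "subspace U" "U \<subseteq> V"
  shows "finite_dim scale U" and "U \<noteq> V \<Longrightarrow> dim U < dim V" and "dim U \<le> dim V"
proof -
  obtain A where A: "A \<subseteq> U" "independent A" "U \<subseteq> span A"
    using maximal_independent_subset by blast
  have spA: "span A = U" using A U(1) by (metis span_mono span_eq_iff subset_antisym)
  obtain B where B: "A \<subseteq> B" "finite B" "independent B" "span B = V"
    using finite_dim_extend_basis[OF V _ A(2)] A(1) U(2) by blast
  have dims: "dim U = card A" "dim V = card B"
    using dim_span_eq_card_independent[OF A(2)] dim_span_eq_card_independent[OF B(3)] spA B(4)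
    by auto
  show "finite_dim scale U" using spA B finite_subset by (auto simp: finite_dim_def)
  show "dim U \<le> dim V" using dims B by (simp add: card_mono)
  assume "U \<noteq> V"
  then have "A \<subset> B" using spA B by auto
  then show "dim U < dim V" using dims B by (simp add: psubset_card_mono)
qed

text \<open>Linearity is required on \<open>V\<close> only, since a module action is unconstrained
  off its carrier. The same function can thus be regarded as an operator on any stable
  subspace.\<close>

definition endo :: "'v set \<Rightarrow> ('v \<Rightarrow> 'v) \<Rightarrow> bool" where
  "endo V f \<longleftrightarrow> (\<forall>v\<in>V. f v \<in> V) \<and> (\<forall>v\<in>V. \<forall>w\<in>V. f (v + w) = f v + f w) \<and>
     (\<forall>c. \<forall>v\<in>V. f (scale c v) = scale c (f v))"

lemma endoD:
  assumes "endo V f" "v \<in> V"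
  shows "f v \<in> V" and "w \<in> V \<Longrightarrow> f (v + w) = f v + f w" and "f (scale c v) = scale c (f v)"
  using assms by (auto simp: endo_def)

lemma endo_zero: "endo V f \<Longrightarrow> subspace V \<Longrightarrow> f 0 = 0"
  using endoD(3)[of V f 0 0] subspace_0[of V] by simp

lemma endo_diff: "endo V f \<Longrightarrow> subspace V \<Longrightarrow> v \<in> V \<Longrightarrow> w \<in> V \<Longrightarrow> f (v - w) = f v - f w"
  using endoD(2)[of V f v "scale (-1) w"] endoD(3)[of V f w "-1"] subspace_scale[of V w "-1"] by simp

lemma endo_sum:
  assumes f: "endo V f" "subspace V"
  shows "(\<And>a. a \<in> A \<Longrightarrow> g a \<in> V) \<Longrightarrow> f (sum g A) = (\<Sum>a\<in>A. f (g a))"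
  by (induction A rule: infinite_finite_induct)
     (simp_all add: endo_zero[OF f] endoD(2)[OF f(1)] subspace_sum[OF f(2)])

lemma endo_comp: "endo V f \<Longrightarrow> endo V g \<Longrightarrow> endo V (\<lambda>v. f (g v))"
  by (auto simp: endo_def)

lemma endo_lin: "subspace V \<Longrightarrow> endo V f \<Longrightarrow> endo V g \<Longrightarrow> endo V (\<lambda>v. f v - scale c (g v))"
  by (auto simp: endo_def subspace_diff subspace_scale algebra_simps)

lemma endo_sub: "subspace V \<Longrightarrow> endo V f \<Longrightarrow> endo V g \<Longrightarrow> endo V (\<lambda>v. f v - g v)"
  using endo_lin[of V f g 1] by simp

lemma endo_shift: "subspace V \<Longrightarrow> endo V f \<Longrightarrow> endo V (\<lambda>v. f v - scale c v)"
  using endo_lin[of V f "\<lambda>v. v" c] by (simp add: endo_def)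

lemma endo_sum_fun:
  "subspace V \<Longrightarrow> (\<And>a. a \<in> A \<Longrightarrow> endo V (f a)) \<Longrightarrow> endo V (\<lambda>v. \<Sum>a\<in>A. f a v)"
  by (simp add: endo_def subspace_sum sum.distrib scale_sum_right)

lemma endo_funpow: "endo V f \<Longrightarrow> endo V (f ^^ n)"
  by (induction n) (auto simp: endo_def)

lemma endo_restrict: "endo V f \<Longrightarrow> U \<subseteq> V \<Longrightarrow> (\<And>v. v \<in> U \<Longrightarrow> f v \<in> U) \<Longrightarrow> endo U f"
  by (auto simp: endo_def subset_iff)

lemma endo_image: 
  assumes "endo V f" "subspace V"
  shows "subspace (f ` V)" "f ` V \<subseteq> V"
proof (rule subspaceI)
  show "f ` V \<subseteq> V" using endoD[OF assms(1)] by auto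
  show "0 \<in> f ` V" using endo_zero[OF assms] subspace_0[OF assms(2)] by (metis imageI)
  fix x y assume "x \<in> f ` V" "y \<in> f ` V"
  then show "x + y \<in> f ` V"
    using endoD[OF assms(1)] subspace_add[OF assms(2)] by (metis (no_types, opaque_lifting) image_iff)
next
  fix c x assume "x \<in> f ` V"
  then show "scale c x \<in> f ` V"
    using endoD[OF assms(1)] subspace_scale[OF assms(2)] by (metis (no_types, opaque_lifting) image_iff)
qed

lemma endo_eqI:
  assumes "endo V f" "endo V g" "subspace V" "span B = V" "\<And>b. b \<in> B \<Longrightarrow> f b = g b" "v \<in> V"
  shows "f v = g v"
proof -
  have "v \<in> {v \<in> V. f v = g v}"
  proof (rule subsetD[OF span_minimal])
    show "B \<subseteq> {v \<in> V. f v = g v}" using assms span_superset[of B] by auto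
    show "subspace {v \<in> V. f v = g v}"
      using assms(1-3) by (auto simp: subspace_def endo_def endo_zero)
  qed (use assms in auto)
  then show ?thesis by simp
qed

lemma linear_endo: "Vector_Spaces.linear scale scale f \<Longrightarrow> (\<And>v. v \<in> V \<Longrightarrow> f v \<in> V) \<Longrightarrow> endo V f"
proof -
  assume "Vector_Spaces.linear scale scale f" and closed: "\<And>v. v \<in> V \<Longrightarrow> f v \<in> V"
  then interpret f: Vector_Spaces.linear scale scale f by simp
  show ?thesis using closed by (simp add: endo_def f.add f.scale)
qed

lemma endo_from_basis:
  assumes "independent B" "span B = V" "\<And>b. b \<in> B \<Longrightarrow> g b \<in> V"
  obtains D where "endo V D" "\<And>b. b \<in> B \<Longrightarrow> D b = g b"
proof -
  interpret VV: vector_space_pair scale scale ..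
  obtain D where D: "Vector_Spaces.linear scale scale D" "\<And>b. b \<in> B \<Longrightarrow> D b = g b"
      "range D = span (g ` B)"
    using VV.linear_independent_extend_subspace[OF assms(1), of g] by blast
  have "span (g ` B) \<subseteq> V" using assms by (intro span_minimal) auto
  then have "endo V D" using D(1,3) by (intro linear_endo) auto
  then show ?thesis using D that by blast
qed

section \<open>Traces\<close>

text \<open>The choice of basis is immaterial by \<open>trace_eq\<close>, so proofs may use a basis
  adapted to a subspace.\<close>

definition trace :: "'v set \<Rightarrow> ('v \<Rightarrow> 'v) \<Rightarrow> complex" where
  "trace V f = (let B = SOME B. finite B \<and> independent B \<and> span B = V
                in \<Sum>b\<in>B. representation B (f b) b)"

lemma representation_expand:
  assumes "finite B" "independent B" "v \<in> span B"
  shows "(\<Sum>b\<in>B. scale (representation B v b) b) = v"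
  by (rule sum_representation_eq[OF assms(2,3,1)]) simp

lemma representation_lin_comb:
  assumes "independent B" "\<And>c. c \<in> C \<Longrightarrow> g c \<in> span B"
  shows "representation B (\<Sum>c\<in>C. scale (k c) (g c)) b = (\<Sum>c\<in>C. k c * representation B (g c) b)"
  using assms by (simp add: representation_sum representation_scale span_scale)

text \<open>Expanding \<open>f b\<close> in \<open>C\<close> and each \<open>c\<close> back in
  \<open>B\<close> turns both diagonal sums into the same double sum of products of
  coordinates.\<close>

lemma trace_basis_change:
  assumes f: "endo V f" and B: "finite B" "independent B" "span B = V"
    and C: "finite C" "independent C" "span C = V"
  shows "(\<Sum>b\<in>B. representation B (f b) b) = (\<Sum>c\<in>C. representation C (f c) c)"
proof -
  have V: "subspace V" using B by auto
  have inV: "b \<in> V" if "b \<in> B \<or> b \<in> C" for b using that B C span_base by blast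
  have fV: "f b \<in> V" if "b \<in> V" for b using endoD(1)[OF f that] .
  have "(\<Sum>b\<in>B. representation B (f b) b) =
     (\<Sum>b\<in>B. representation B (\<Sum>c\<in>C. scale (representation C (f b) c) c) b)"
    using C fV inV by (intro sum.cong refl) (simp add: representation_expand)
  also have "\<dots> = (\<Sum>b\<in>B. \<Sum>c\<in>C. representation C (f b) c * representation B c b)"
    by (intro sum.cong refl representation_lin_comb B(2)) (simp add: B(3) inV)
  also have "\<dots> = (\<Sum>c\<in>C. \<Sum>b\<in>B. representation C (f b) c * representation B c b)"
    by (rule sum.swap)
  also have "\<dots> = (\<Sum>c\<in>C. representation C (f (\<Sum>b\<in>B. scale (representation B c b) b)) c)"
  proof (intro sum.cong refl)
    fix c assume "c \<in> C"
    have "f (\<Sum>b\<in>B. scale (representation B c b) b) = (\<Sum>b\<in>B. scale (representation B c b) (f b))"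
      by (subst endo_sum[OF f V])
         (auto intro!: sum.cong simp: subspace_scale[OF V] inV endoD(3)[OF f])
    then show "(\<Sum>b\<in>B. representation C (f b) c * representation B c b) =
        representation C (f (\<Sum>b\<in>B. scale (representation B c b) b)) c"
      using representation_lin_comb[OF C(2), of B f] by (simp add: C(3) inV fV mult.commute)
  qed
  also have "\<dots> = (\<Sum>c\<in>C. representation C (f c) c)"
    using B inV by (intro sum.cong refl) (simp add: representation_expand)
  finally show ?thesis .
qed

lemma trace_eq:
  assumes "endo V f" "finite B" "independent B" "span B = V"
  shows "trace V f = (\<Sum>b\<in>B. representation B (f b) b)"
proof -
  have "\<exists>B. finite B \<and> independent B \<and> span B = V" using assms by blast
  from someI_ex[OF this] show ?thesis
    unfolding trace_def Let_def using trace_basis_change[OF assms(1)] assms by blast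
qed

lemma trace_cong:
  assumes "finite_dim scale V" "endo V f" "endo V g" "\<And>v. v \<in> V \<Longrightarrow> f v = g v"
  shows "trace V f = trace V g"
proof -
  obtain B where B: "finite B" "independent B" "span B = V" using finite_dim_basis assms(1) by blast
  then have "b \<in> V" if "b \<in> B" for b using span_base that by blast
  then show ?thesis by (simp add: trace_eq[OF _ B] assms)
qed

lemma trace_lin:
  assumes V: "finite_dim scale V" and f: "endo V f" and g: "endo V g"
  shows "trace V (\<lambda>v. f v - scale c (g v)) = trace V f - c * trace V g"
proof -
  obtain B where B: "finite B" "independent B" "span B = V" using finite_dim_basis V by blast
  have sV: "subspace V" using B by auto
  have inV: "b \<in> V" if "b \<in> B" for b using B span_base that by blast
  show ?thesis
    by (simp add: trace_eq[OF f B] trace_eq[OF g B] trace_eq[OF endo_lin[OF sV f g] B]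
       representation_diff[OF B(2)] representation_scale[OF B(2)] B endoD(1)[OF f] endoD(1)[OF g]
       inV subspace_scale[OF sV] sum_subtractf sum_distrib_left)
qed

lemma trace_zero: "finite_dim scale V \<Longrightarrow> trace V (\<lambda>v. 0) = 0"
  using trace_lin[of V "\<lambda>v. 0" "\<lambda>v. 0" 1]
  by (simp add: endo_def subspace_0 finite_dim_subspace)

lemma trace_scale:
  assumes V: "finite_dim scale V" and g: "endo V g"
  shows "trace V (\<lambda>v. scale c (g v)) = c * trace V g"
proof -
  have z: "endo V (\<lambda>v. 0)" using finite_dim_subspace[OF V] by (simp add: endo_def subspace_0)
  show ?thesis using trace_lin[OF V z g, of "-c"] by (simp add: trace_zero V)
qed

lemma trace_diff:
  assumes V: "finite_dim scale V" and f: "endo V f" and g: "endo V g"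
  shows "trace V (\<lambda>v. f v - g v) = trace V f - trace V g"
  using trace_lin[OF V f g, of 1] by simp

lemma trace_add:
  assumes V: "finite_dim scale V" and f: "endo V f" and g: "endo V g"
  shows "trace V (\<lambda>v. f v + g v) = trace V f + trace V g"
  using trace_lin[OF V f g, of "-1"] by simp

lemma trace_sum:
  assumes V: "finite_dim scale V" and "finite A" and f: "\<And>a. a \<in> A \<Longrightarrow> endo V (f a)"
  shows "trace V (\<lambda>v. \<Sum>a\<in>A. f a v) = (\<Sum>a\<in>A. trace V (f a))"
  using assms(2) f
proof (induction A rule: finite_induct)
  case (insert a A)
  then show ?case
    using trace_add[OF V, of "f a" "\<lambda>v. \<Sum>a\<in>A. f a v"] endo_sum_fun[OF finite_dim_subspace[OF V], of A f]
    by simp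
qed (simp add: trace_zero V)

lemma trace_comm:
  assumes V: "finite_dim scale V" and f: "endo V f" and g: "endo V g"
  shows "trace V (\<lambda>v. f (g v)) = trace V (\<lambda>v. g (f v))"
proof -
  obtain B where B: "finite B" "independent B" "span B = V" using finite_dim_basis V by blast
  have sV: "subspace V" using B by auto
  have inV: "b \<in> V" if "b \<in> B" for b using B span_base that by blast
  have key: "trace V (\<lambda>v. f (g v)) =
      (\<Sum>b\<in>B. \<Sum>c\<in>B. representation B (g b) c * representation B (f c) b)"
    if f: "endo V f" and g: "endo V g" for f g
    unfolding trace_eq[OF endo_comp[OF f g] B]
  proof (intro sum.cong refl)
    fix b assume b: "b \<in> B"
    have "f (g b) = f (\<Sum>c\<in>B. scale (representation B (g b) c) c)"
      using B endoD(1)[OF g inV[OF b]] by (simp add: representation_expand)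
    also have "\<dots> = (\<Sum>c\<in>B. scale (representation B (g b) c) (f c))"
      by (subst endo_sum[OF f sV])
         (auto intro!: sum.cong simp: subspace_scale[OF sV] inV endoD(3)[OF f])
    finally show "representation B (f (g b)) b = (\<Sum>c\<in>B. representation B (g b) c * representation B (f c) b)"
      using representation_lin_comb[OF B(2), of B f] by (simp add: B(3) inV endoD(1)[OF f])
  qed
  show ?thesis
    unfolding key[OF f g] key[OF g f] by (subst sum.swap) (simp add: mult.commute)
qed

text \<open>In a basis of \<open>V\<close> that extends a basis \<open>A\<close> of
  \<open>U\<close>, a vector outside \<open>A\<close> contributes nothing to the diagonal, because
  its image has coordinates in \<open>A\<close> only. For this the whole image of \<open>V\<close>
  must lie in \<open>U\<close>; stability of \<open>U\<close> would not suffice.\<close>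

lemma trace_restrict:
  assumes V: "finite_dim scale V" and f: "endo V f"
    and U: "subspace U" "U \<subseteq> V" "\<And>v. v \<in> V \<Longrightarrow> f v \<in> U"
  shows "trace V f = trace U f"
proof -
  obtain A where A: "finite A" "independent A" "span A = U"
    using finite_dim_basis finite_dim_mono(1)[OF V U(1,2)] by blast
  have "A \<subseteq> V" using A U span_superset by blast
  then obtain B where B: "A \<subseteq> B" "finite B" "independent B" "span B = V"
    using finite_dim_extend_basis[OF V _ A(2)] by blast
  have fU: "endo U f" using f U by (intro endo_restrict[OF f]) auto
  have inV: "b \<in> V" if "b \<in> B" for b using B span_base that by blast
  have "representation B (f b) b = (if b \<in> A then representation A (f b) b else 0)" if "b \<in> B" for b
  proof -
    have "f b \<in> span A" using A U inV[OF that] by auto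
    then have "representation B (f b) = representation A (f b)"
      using representation_extend[OF B(3) _ B(1)] by metis
    then show ?thesis using representation_ne_zero[of A "f b" b] by auto
  qed
  then have "trace V f = (\<Sum>b\<in>B. if b \<in> A then representation A (f b) b else 0)"
    unfolding trace_eq[OF f B(2-4)] by (intro sum.cong) auto
  also have "\<dots> = trace U f"
    unfolding trace_eq[OF fU A] using B A by (simp add: sum.If_cases Int_absorb1)
  finally show ?thesis .
qed

section \<open>Generalized eigenspaces\<close>

text \<open>The exponent may depend on the vector, so no dimension enters; a common exponent is
  found in \<open>nilpotent_uniform\<close>.\<close>

definition gen_eig :: "'v set \<Rightarrow> ('v \<Rightarrow> 'v) \<Rightarrow> complex \<Rightarrow> 'v set" where
  "gen_eig V f c = {v \<in> V. \<exists>m. ((\<lambda>v. f v - scale c v) ^^ m) v = 0}"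

lemma gen_eig_0: "gen_eig V f 0 = {v \<in> V. \<exists>m. (f ^^ m) v = 0}"
  by (simp add: gen_eig_def)

lemma funpow_zero_mono:
  assumes f: "endo V f" "subspace V" and "(f ^^ m) v = 0" "m \<le> n"
  shows "(f ^^ n) v = 0"
proof -
  have "(f ^^ k) 0 = 0" for k by (induction k) (simp_all add: endo_zero[OF f])
  then have "(f ^^ (n - m + m)) v = 0" using assms(3) by (simp only: funpow_add o_apply)
  then show ?thesis using assms(4) by simp
qed

lemma subspace_gen_eig:
  assumes f: "endo V f" "subspace V"
  shows "subspace (gen_eig V f c)"
proof -
  let ?h = "\<lambda>v. f v - scale c v"
  have h: "endo V ?h" by (rule endo_shift[OF f(2,1)])
  have hn: "endo V (?h ^^ n)" for n by (rule endo_funpow[OF h])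
  show ?thesis
  proof (rule subspaceI)
    show "0 \<in> gen_eig V f c"
      using subspace_0[OF f(2)] by (auto simp: gen_eig_def intro: exI[of _ 0])
  next
    fix x y assume "x \<in> gen_eig V f c" "y \<in> gen_eig V f c"
    then obtain m n where x: "x \<in> V" "(?h ^^ m) x = 0" and y: "y \<in> V" "(?h ^^ n) y = 0"
      by (auto simp: gen_eig_def)
    have "(?h ^^ max m n) (x + y) = 0"
      using funpow_zero_mono[OF h f(2) x(2), of "max m n"] funpow_zero_mono[OF h f(2) y(2), of "max m n"]
      by (simp only: endoD(2)[OF hn x(1) y(1)]) simp
    then show "x + y \<in> gen_eig V f c" using x y subspace_add[OF f(2)] by (auto simp: gen_eig_def)
  next
    fix a x assume "x \<in> gen_eig V f c"
    then obtain m where x: "x \<in> V" "(?h ^^ m) x = 0" by (auto simp: gen_eig_def)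
    have "(?h ^^ m) (scale a x) = 0" by (simp only: endoD(3)[OF hn x(1)] x(2) scale_zero_right)
    then show "scale a x \<in> gen_eig V f c" using x subspace_scale[OF f(2)] by (auto simp: gen_eig_def)
  qed
qed

lemma gen_eig_commuting:
  assumes f: "endo V f" "subspace V" and g: "endo V g" and fg: "\<And>v. v \<in> V \<Longrightarrow> f (g v) = g (f v)"
    and v: "v \<in> gen_eig V f c"
  shows "g v \<in> gen_eig V f c"
proof -
  let ?h = "\<lambda>v. f v - scale c v"
  have h: "endo V ?h" by (rule endo_shift[OF f(2,1)])
  obtain m where m: "v \<in> V" "(?h ^^ m) v = 0" using v by (auto simp: gen_eig_def)
  have hg: "?h (g w) = g (?h w)" if "w \<in> V" for w
    using that by (simp add: fg endo_diff[OF g f(2)] endoD[OF f(1)] endoD[OF g] subspace_scale[OF f(2)])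
  have "(?h ^^ k) (g v) = g ((?h ^^ k) v)" for k
  proof (induction k)
    case (Suc k)
    have "(?h ^^ k) v \<in> V" using endoD(1)[OF endo_funpow[OF h] m(1)] .
    then show ?case by (simp add: Suc hg)
  qed simp
  then have "(?h ^^ m) (g v) = 0" using m(2) endo_zero[OF g f(2)] by simp
  then show ?thesis using m endoD(1)[OF g] by (auto simp: gen_eig_def)
qed

lemma gen_eig_stable: "endo V f \<Longrightarrow> subspace V \<Longrightarrow> v \<in> gen_eig V f c \<Longrightarrow> f v \<in> gen_eig V f c"
  by (rule gen_eig_commuting) auto

lemma gen_eig_step:
  assumes "v \<in> V" "f v - scale c v \<in> gen_eig V f c"
  shows "v \<in> gen_eig V f c"
proof -
  obtain m where "((\<lambda>v. f v - scale c v) ^^ m) (f v - scale c v) = 0" using assms(2) by (auto simp: gen_eig_def)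
  then have "((\<lambda>v. f v - scale c v) ^^ Suc m) v = 0" by (simp only: funpow_Suc_right o_apply)
  then show ?thesis using assms(1) unfolding gen_eig_def by blast
qed

text \<open>Induction on the exponent that annihilates \<open>v\<close>. Later proofs apply
  \<open>f - c\<close> once and never handle its powers.\<close>

lemma gen_eig_induct [consumes 3, case_names zero step]:
  assumes f: "endo V f" "subspace V" and "v \<in> gen_eig V f c"
    and "P 0" and "\<And>v. v \<in> gen_eig V f c \<Longrightarrow> P (f v - scale c v) \<Longrightarrow> P v"
  shows "P v"
proof -
  let ?h = "\<lambda>v. f v - scale c v"
  have h: "endo V ?h" by (rule endo_shift[OF f(2,1)])
  have "v \<in> V \<Longrightarrow> (?h ^^ m) v = 0 \<Longrightarrow> P v" for m
  proof (induction m arbitrary: v)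
    case (Suc m)
    have "(?h ^^ m) (?h v) = 0" using Suc.prems by (simp only: funpow_Suc_right o_apply)
    then have "P (?h v)" using Suc endoD(1)[OF h] by blast
    moreover have "v \<in> gen_eig V f c" using Suc.prems by (auto simp only: gen_eig_def)
    ultimately show ?case using assms(5) by blast
  qed (use assms(4) in simp)
  then show ?thesis using assms(3) by (auto simp: gen_eig_def)
qed

lemma gen_eig_shift: "endo V f \<Longrightarrow> subspace V \<Longrightarrow> v \<in> gen_eig V f c \<Longrightarrow> f v - scale a v \<in> gen_eig V f c"
  by (simp add: gen_eig_stable subspace_gen_eig subspace_diff subspace_scale)

text \<open>On the generalized eigenspace of \<open>c\<close>, the map \<open>f - a\<close> is the
  nonzero scalar \<open>c - a\<close> plus the locally nilpotent \<open>f - c\<close>, hence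
  invertible. The induction first solves for \<open>(f - c) u\<close>, giving \<open>w'\<close>;
  then \<open>f - a\<close> sends \<open>u - w'\<close> to \<open>(c - a) u\<close>.\<close>

lemma gen_eig_solve:
  assumes f: "endo V f" "subspace V" and u: "u \<in> gen_eig V f c" and "c \<noteq> a"
  shows "\<exists>w\<in>gen_eig V f c. f w - scale a w = u"
  using f u
proof (induction rule: gen_eig_induct)
  case zero
  then show ?case using endo_zero[OF f] subspace_0[OF subspace_gen_eig[OF f]] by (intro bexI[of _ 0]) auto
next
  case (step u)
  then obtain w' where w': "w' \<in> gen_eig V f c" "f w' - scale a w' = f u - scale c u" by blast
  have V: "u \<in> V" "w' \<in> V" "u - w' \<in> V" using step w' f(2) by (auto simp: gen_eig_def subspace_diff)
  let ?w = "scale (inverse (c - a)) (u - w')"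
  have "f (u - w') - scale a (u - w') = (f u - scale a u) - (f w' - scale a w')"
    using V by (simp add: endo_diff[OF f] algebra_simps)
  also have "\<dots> = scale (c - a) u" unfolding w'(2) by (simp add: algebra_simps)
  finally have *: "f (u - w') - scale a (u - w') = scale (c - a) u" .
  have "f ?w - scale a ?w = scale (inverse (c - a)) (f (u - w')) - scale a ?w"
    using endoD(3)[OF f(1) V(3)] by simp
  also have "\<dots> = scale (inverse (c - a)) (f (u - w') - scale a (u - w'))"
    by (subst scale_left_commute) (rule scale_right_diff_distrib[symmetric])
  finally have "f ?w - scale a ?w = scale (inverse (c - a)) (f (u - w') - scale a (u - w'))" .
  then have "f ?w - scale a ?w = u" unfolding * using \<open>c \<noteq> a\<close> by simp
  moreover have "?w \<in> gen_eig V f c"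
    using step w' subspace_gen_eig[OF f] by (simp add: subspace_scale subspace_diff)
  ultimately show ?case by blast
qed

lemma gen_eig_inj:
  assumes f: "endo V f" "subspace V" and "v \<in> gen_eig V f c" "c \<noteq> a" "f v = scale a v"
  shows "v = 0"
proof -
  have "f v = scale a v \<longrightarrow> v = 0"
    using f assms(3)
  proof (induction rule: gen_eig_induct)
    case (step v)
    show ?case
    proof
      assume v: "f v = scale a v"
      then have eq: "f v - scale c v = scale (a - c) v" by (simp add: algebra_simps)
      have "f (scale (a - c) v) = scale a (scale (a - c) v)"
        using step v by (simp add: endoD[OF f(1)] gen_eig_def mult.commute)
      then show "v = 0" using step(2) \<open>c \<noteq> a\<close> unfolding eq by simp
    qed
  qed simp
  then show ?thesis using assms(5) by simp
qed

lemma gen_eig_disjoint: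
  assumes f: "endo V f" "subspace V" and v: "v \<in> gen_eig V f c" "v \<in> gen_eig V f a" and "c \<noteq> a"
  shows "v = 0"
proof -
  have "v \<in> gen_eig V f c \<longrightarrow> v = 0"
    using f v(2)
  proof (induction rule: gen_eig_induct)
    case (step v)
    then show ?case
      using gen_eig_shift[OF f, of v c a] gen_eig_inj[OF f _ \<open>c \<noteq> a\<close>, of v] by auto
  qed simp
  then show ?thesis using v by simp
qed

text \<open>A power of \<open>f - a\<close> that kills the term at \<open>a\<close> leaves a
  relation over the smaller set. By induction it kills the other terms as well, so each of these
  lies in two different generalized eigenspaces.\<close>

lemma gen_eig_independent:
  assumes f: "endo V f" "subspace V" and "finite S"
    and "\<And>c. c \<in> S \<Longrightarrow> v c \<in> gen_eig V f c" "(\<Sum>c\<in>S. v c) = 0" "c \<in> S"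
  shows "v c = 0"
  using assms(3-6)
proof (induction S arbitrary: v c rule: finite_induct)
  case (insert a S)
  let ?h = "\<lambda>v. f v - scale a v"
  have h: "endo V ?h" by (rule endo_shift[OF f(2,1)])
  obtain m where m: "(?h ^^ m) (v a) = 0" using insert.prems(1)[of a] by (auto simp: gen_eig_def)
  have inV: "v c \<in> V" if "c \<in> insert a S" for c using insert.prems(1)[OF that] by (auto simp: gen_eig_def)
  have hm: "endo V (?h ^^ m)" by (rule endo_funpow[OF h])
  have "(?h ^^ m) (\<Sum>c\<in>insert a S. v c) = (\<Sum>c\<in>insert a S. (?h ^^ m) (v c))"
    using inV by (rule endo_sum[OF hm f(2)])
  then have sum0: "(\<Sum>c\<in>S. (?h ^^ m) (v c)) = 0"
    unfolding insert.prems(2) using insert.hyps m endo_zero[OF hm f(2)] by simp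
  have "(?h ^^ k) w \<in> gen_eig V f c" if "w \<in> gen_eig V f c" for c w k
    using that by (induction k) (simp_all add: gen_eig_shift[OF f])
  then have "(?h ^^ m) (v c) = 0" if "c \<in> S" for c
    using insert.IH[of "\<lambda>c. (?h ^^ m) (v c)" c] insert.prems(1) sum0 that by simp
  then have "v c \<in> gen_eig V f a" if "c \<in> S" for c
    using inV that by (auto simp: gen_eig_def)
  then have S0: "v c = 0" if "c \<in> S" for c
    using gen_eig_disjoint[OF f insert.prems(1)] insert.hyps that by (metis insertCI)
  then have "v a = 0" using insert.prems(2) insert.hyps by simp
  then show ?case using S0 insert.prems(3) by auto
qed simp

abbreviation gen_eig_sum :: "'v set \<Rightarrow> ('v \<Rightarrow> 'v) \<Rightarrow> 'v set" where
  "gen_eig_sum V f \<equiv> span (\<Union>c. gen_eig V f c)"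

text \<open>The map \<open>f - a\<close> is onto on every summand except the one for
  \<open>a\<close>, so it can be inverted up to an error in that summand. With \<open>a = 0\<close>
  this is the Fitting decomposition used in \<open>invariant_lift\<close>.\<close>

lemma gen_eig_sum_solve:
  assumes f: "endo V f" "subspace V" and "u \<in> gen_eig_sum V f"
  shows "\<exists>w\<in>gen_eig_sum V f. u - (f w - scale a w) \<in> gen_eig V f a"
  using assms(3)
proof (induction rule: span_induct_alt)
  case base
  show ?case
    using subspace_0[OF subspace_gen_eig[OF f]] endo_zero[OF f] span_zero by (intro bexI[of _ 0]) auto
next
  case (step k x u)
  obtain w where w: "w \<in> gen_eig_sum V f" "u - (f w - scale a w) \<in> gen_eig V f a" using step by blast
  obtain c where x: "x \<in> gen_eig V f c" using step by blast
  have sumV: "gen_eig_sum V f \<subseteq> V"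
    by (intro span_minimal f) (auto simp: gen_eig_def)
  show ?case
  proof (cases "c = a")
    case True
    then have "scale k x + (u - (f w - scale a w)) \<in> gen_eig V f a"
      using w(2) x by (intro subspace_add subspace_scale subspace_gen_eig[OF f]) auto
    then have "scale k x + u - (f w - scale a w) \<in> gen_eig V f a" by (simp only: add_diff_eq)
    then show ?thesis using w by blast
  next
    case False
    obtain y where y: "y \<in> gen_eig V f c" "f y - scale a y = x" using gen_eig_solve[OF f x False] by blast
    have yV: "y \<in> V" using y by (simp add: gen_eig_def)
    have wV: "w \<in> V" using w sumV by blast
    have "f (scale k y + w) - scale a (scale k y + w) = scale k (f y - scale a y) + (f w - scale a w)"
      using yV wV subspace_scale[OF f(2)] by (simp add: endoD[OF f(1)] algebra_simps)
    then have "scale k x + u - (f (scale k y + w) - scale a (scale k y + w)) = u - (f w - scale a w)"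
      using y by simp
    moreover have "scale k y + w \<in> gen_eig_sum V f"
      using w(1) y(1) by (intro span_add span_scale[OF span_base]) auto
    ultimately show ?thesis using w(2) by metis
  qed
qed

text \<open>This strips one linear factor off an annihilating polynomial: the approximate solution
  \<open>w\<close> from \<open>gen_eig_sum_solve\<close> makes \<open>v - w\<close> a generalized
  eigenvector for \<open>a\<close>.\<close>

lemma gen_eig_sum_shift:
  assumes f: "endo V f" "subspace V" and v: "v \<in> V" "f v - scale a v \<in> gen_eig_sum V f"
  shows "v \<in> gen_eig_sum V f"
proof -
  have sumV: "gen_eig_sum V f \<subseteq> V"
    by (intro span_minimal f) (auto simp: gen_eig_def)
  obtain w where w: "w \<in> gen_eig_sum V f" "f v - scale a v - (f w - scale a w) \<in> gen_eig V f a"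
    using gen_eig_sum_solve[OF f v(2)] by blast
  have wV: "w \<in> V" using w sumV by blast
  have "f (v - w) - scale a (v - w) \<in> gen_eig V f a"
    using w(2) by (simp add: endo_diff[OF f v(1) wV] algebra_simps)
  then have "v - w \<in> gen_eig V f a"
    by (rule gen_eig_step[OF subspace_diff[OF f(2) v(1) wV]])
  then have "(v - w) + w \<in> gen_eig_sum V f" using w by (intro span_add) (auto intro: span_base)
  then show ?thesis by simp
qed

section \<open>Decomposition into generalized eigenspaces\<close>

definition poly_apply :: "('v \<Rightarrow> 'v) \<Rightarrow> complex poly \<Rightarrow> 'v \<Rightarrow> 'v" where
  "poly_apply f q v = (\<Sum>i\<le>degree q. scale (coeff q i) ((f ^^ i) v))"

lemma poly_apply_upto: "degree q \<le> n \<Longrightarrow> poly_apply f q v = (\<Sum>i\<le>n. scale (coeff q i) ((f ^^ i) v))"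
  unfolding poly_apply_def by (intro sum.mono_neutral_left) (auto simp: coeff_eq_0 not_le)

lemma poly_apply_linear_factor:
  assumes f: "endo V f" "subspace V" "v \<in> V"
  shows "poly_apply f ([:-a, 1:] * q) v = f (poly_apply f q v) - scale a (poly_apply f q v)"
proof -
  let ?n = "degree q"
  have inV: "(f ^^ i) v \<in> V" for i using endoD(1)[OF endo_funpow[OF f(1)] f(3)] .
  have deg: "degree ([:-a, 1:] * q) \<le> Suc ?n" "degree q \<le> Suc ?n"
    using degree_mult_le[of "[:-a, 1:]" q] by simp_all
  have cf: "coeff ([:-a, 1:] * q) i = coeff (pCons 0 q) i - a * coeff q i" for i by simp
  have "poly_apply f ([:-a, 1:] * q) v =
     (\<Sum>i\<le>Suc ?n. scale (coeff (pCons 0 q) i) ((f ^^ i) v)) - scale a (\<Sum>i\<le>Suc ?n. scale (coeff q i) ((f ^^ i) v))"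
    unfolding poly_apply_upto[OF deg(1)] cf scale_left_diff_distrib sum_subtractf scale_sum_right scale_scale ..
  also have "(\<Sum>i\<le>Suc ?n. scale (coeff q i) ((f ^^ i) v)) = poly_apply f q v"
    by (rule poly_apply_upto[OF deg(2), symmetric])
  also have "(\<Sum>i\<le>Suc ?n. scale (coeff (pCons 0 q) i) ((f ^^ i) v)) = (\<Sum>i\<le>?n. scale (coeff q i) (f ((f ^^ i) v)))"
    by (subst sum.atMost_Suc_shift) simp
  also have "\<dots> = f (poly_apply f q v)"
    unfolding poly_apply_def
    by (subst endo_sum[OF f(1,2)]) (auto intro!: sum.cong simp: endoD(3)[OF f(1) inV] subspace_scale[OF f(2)] inV)
  finally show ?thesis .
qed

lemma poly_apply_in: "endo V f \<Longrightarrow> subspace V \<Longrightarrow> v \<in> V \<Longrightarrow> poly_apply f q v \<in> V"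
  unfolding poly_apply_def
  by (intro subspace_sum subspace_scale) (auto intro: endoD(1)[OF endo_funpow])

text \<open>The first \<open>card B + 1\<close> iterates of \<open>v\<close> lie in a space spanned
  by \<open>card B\<close> vectors, so they satisfy a linear relation.\<close>

lemma annihilating_poly:
  assumes V: "finite_dim scale V" and f: "endo V f" and v: "v \<in> V"
  obtains q where "q \<noteq> 0" "poly_apply f q v = 0"
proof -
  obtain B where B: "finite B" "span B = V" using V by (auto simp: finite_dim_def)
  define g where "g i = (f ^^ i) v" for i
  have inV: "g i \<in> V" for i unfolding g_def using endoD(1)[OF endo_funpow[OF f] v] .
  show ?thesis
  proof (cases "inj_on g {..card B}")
    case True
    have "dependent (g ` {..card B})"
    proof (rule ccontr)
      assume "\<not> ?thesis"
      from independent_span_bound[OF B(1) this] have "card (g ` {..card B}) \<le> card B"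
        using inV B by blast
      then show False using True by (simp add: card_image)
    qed
    then obtain u where u: "(\<Sum>w\<in>g ` {..card B}. scale (u w) w) = 0" "\<exists>w\<in>g ` {..card B}. u w \<noteq> 0"
      by (auto simp: dependent_finite)
    define q where "q = (\<Sum>i\<le>card B. monom (u (g i)) i)"
    have cq: "coeff q i = (if i \<le> card B then u (g i) else 0)" for i
      by (simp add: q_def coeff_sum)
    have "degree q \<le> card B" by (rule degree_le) (simp add: cq)
    then have "poly_apply f q v = (\<Sum>i\<le>card B. scale (u (g i)) (g i))"
      by (simp add: poly_apply_upto cq g_def)
    also have "\<dots> = 0" using u(1) by (simp add: sum.reindex[OF True])
    finally have "poly_apply f q v = 0" .
    moreover have "q \<noteq> 0" using u(2) cq by (metis atMost_iff coeff_0 imageE)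
    ultimately show ?thesis using that by blast
  next
    \<comment> \<open>Coinciding iterates collapse in the image set, whose dependence then says
      nothing; here the difference of two monomials does the job.\<close>
    case False
    then obtain i j where ij: "i \<noteq> j" "g i = g j" by (auto simp: inj_on_def)
    define q where "q = monom (1::complex) i - monom 1 j"
    have "degree q \<le> max i j"
      unfolding q_def by (intro degree_diff_le) (auto simp: degree_monom_eq)
    then have "poly_apply f q v = (\<Sum>k\<le>max i j. scale (if k = i then 1 else 0) (g k)) - (\<Sum>k\<le>max i j. scale (if k = j then 1 else 0) (g k))"
      by (simp add: poly_apply_upto q_def g_def scale_left_diff_distrib sum_subtractf eq_commute)
    also have "\<dots> = g i - g j"
      by (simp add: if_distrib[of "\<lambda>c. scale c x" for x] cong: if_cong)
    finally have "poly_apply f q v = 0" using ij by simp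
    moreover have "coeff q i = 1" using ij by (simp add: q_def)
    then have "q \<noteq> 0" by auto
    ultimately show ?thesis using that by blast
  qed
qed

text \<open>Over the complex numbers an annihilating polynomial of \<open>v\<close> splits into
  linear factors. Each is removed by \<open>gen_eig_sum_shift\<close>, until a nonzero constant
  times \<open>v\<close> is left.\<close>

lemma gen_eig_sum_eq:
  assumes V: "finite_dim scale V" and f: "endo V f"
  shows "gen_eig_sum V f = V"
proof
  have sV: "subspace V" by (rule finite_dim_subspace[OF V])
  show "gen_eig_sum V f \<subseteq> V"
    by (intro span_minimal sV) (auto simp: gen_eig_def)
  show "V \<subseteq> gen_eig_sum V f"
  proof
    fix v assume v: "v \<in> V"
    have "q \<noteq> 0 \<Longrightarrow> poly_apply f q v \<in> gen_eig_sum V f \<Longrightarrow> v \<in> gen_eig_sum V f" for q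
    proof (induction "degree q" arbitrary: q)
      case 0
      then obtain c where "q = [:c:]" "c \<noteq> 0" by (metis degree_0_id degree_pCons_0 pCons_eq_0_iff degree_eq_zeroE)
      then have "scale (inverse c) (poly_apply f q v) = v" by (simp add: poly_apply_def)
      then show ?case using 0 by (metis span_scale)
    next
      case (Suc n)
      then have "\<not> constant (poly q)" by (simp add: constant_degree)
      then obtain a where "poly q a = 0" using fundamental_theorem_of_algebra by blast
      then obtain r where r: "q = [:-a, 1:] * r" by (metis poly_eq_0_iff_dvd dvdE)
      have "r \<noteq> 0" using Suc.prems(1) r by auto
      then have "degree q = Suc (degree r)" unfolding r by (subst degree_mult_eq) auto
      have "poly_apply f r v \<in> gen_eig_sum V f"
        using Suc.prems(2) unfolding r poly_apply_linear_factor[OF f sV v]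
        by (rule gen_eig_sum_shift[OF f sV poly_apply_in[OF f sV v]])
      with \<open>degree q = Suc (degree r)\<close> \<open>r \<noteq> 0\<close> show ?case using Suc.hyps by simp
    qed
    moreover obtain q where "q \<noteq> 0" "poly_apply f q v = 0" using annihilating_poly[OF V f v] by blast
    ultimately show "v \<in> gen_eig_sum V f" using span_zero by metis
  qed
qed

lemma eigenvector_exists:
  assumes V: "finite_dim scale V" "V \<noteq> {0}" and f: "endo V f"
  obtains c v where "v \<in> V" "v \<noteq> 0" "f v = scale c v"
proof -
  have sV: "subspace V" by (rule finite_dim_subspace[OF V(1)])
  have "\<exists>c. \<exists>v\<in>gen_eig V f c. v \<noteq> 0"
  proof (rule ccontr)
    assume "\<not> ?thesis"
    then have "gen_eig_sum V f \<subseteq> {0}" by (intro span_minimal) auto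
    then show False using gen_eig_sum_eq[OF V(1) f] V(2) subspace_0[OF sV] by auto
  qed
  then obtain c v where v: "v \<in> gen_eig V f c" "v \<noteq> 0" by blast
  have "v \<noteq> 0 \<longrightarrow> (\<exists>w\<in>V. w \<noteq> 0 \<and> f w = scale c w)"
    using f sV v(1)
  proof (induction rule: gen_eig_induct)
    case (step v)
    then show ?case by (cases "f v = scale c v") (auto simp: gen_eig_def)
  qed simp
  then show ?thesis using v that by blast
qed

text \<open>\<open>h\<close> is applied to the semisimple part of \<open>f\<close>.\<close>

lemma functional_calculus:
  assumes V: "finite_dim scale V" and f: "endo V f"
  obtains B \<mu> where "finite B" "independent B" "span B = V"
    "\<And>b. b \<in> B \<Longrightarrow> b \<in> gen_eig V f (\<mu> b)"
    "\<And>h. \<exists>D. endo V D \<and> (\<forall>c. \<forall>v\<in>gen_eig V f c. D v = scale (h c) v)"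
proof -
  have sV: "subspace V" by (rule finite_dim_subspace[OF V])
  obtain B where B: "B \<subseteq> (\<Union>c. gen_eig V f c)" "independent B" "(\<Union>c. gen_eig V f c) \<subseteq> span B"
    using maximal_independent_subset by blast
  have spB: "span B = V"
    using B gen_eig_sum_eq[OF V f] by (metis span_mono span_span subset_antisym)
  have finB: "finite B"
    using V independent_span_bound[OF _ B(2)] spB span_superset[of B] by (auto simp: finite_dim_def)
  define \<mu> where "\<mu> b = (SOME c. b \<in> gen_eig V f c)" for b
  have \<mu>: "b \<in> gen_eig V f (\<mu> b)" if "b \<in> B" for b
    using that B(1) unfolding \<mu>_def by (intro someI_ex[of "\<lambda>c. b \<in> gen_eig V f c"]) auto
  have inV: "b \<in> V" if "b \<in> B" for b using that \<mu> by (auto simp: gen_eig_def)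
  have "\<exists>D. endo V D \<and> (\<forall>c. \<forall>v\<in>gen_eig V f c. D v = scale (h c) v)" for h
  proof -
    have "scale (h (\<mu> b)) b \<in> V" if "b \<in> B" for b using inV[OF that] sV subspace_scale by blast
    then obtain D where D: "endo V D" "\<And>b. b \<in> B \<Longrightarrow> D b = scale (h (\<mu> b)) b"
      using endo_from_basis[OF B(2) spB, of "\<lambda>b. scale (h (\<mu> b)) b"] by blast
    have "D v = scale (h c) v" if v: "v \<in> gen_eig V f c" for c v
    proof -
      let ?r = "representation B v"
      define w where "w e = (\<Sum>b\<in>{b\<in>B. \<mu> b = e}. scale (?r b) b)" for e
      \<comment> \<open>\<open>c\<close> is inserted because it need not be a value of
        \<open>\<mu>\<close>. Independence is applied to the components \<open>w e\<close> with
        \<open>v\<close> subtracted at the index \<open>c\<close>.\<close>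
      define S where "S = insert c (\<mu> ` B)"
      have vV: "v \<in> span B" using v spB by (simp add: gen_eig_def)
      have wG: "w e \<in> gen_eig V f e" for e
        unfolding w_def using \<mu> by (intro subspace_sum subspace_scale subspace_gen_eig f sV) auto
      have finS: "finite S" using finB by (simp add: S_def)
      have vsum: "v = (\<Sum>e\<in>S. w e)"
      proof -
        have "v = (\<Sum>b\<in>B. scale (?r b) b)" using representation_expand[OF finB B(2) vV] by simp
        also have "\<dots> = (\<Sum>e\<in>S. w e)"
          unfolding w_def by (intro sum.group[symmetric] finB finS) (auto simp: S_def)
        finally show ?thesis .
      qed
      have zero: "w e - (if e = c then v else 0) = 0" if "e \<in> S" for e
      proof (rule gen_eig_independent[OF f sV finS, where v = "\<lambda>e. w e - (if e = c then v else 0)"])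
        show "w e - (if e = c then v else 0) \<in> gen_eig V f e" for e
          using wG v by (simp add: subspace_diff subspace_gen_eig f sV)
        show "(\<Sum>e\<in>S. w e - (if e = c then v else 0)) = 0"
          using vsum finS by (simp add: sum_subtractf S_def)
      qed (use that in auto)
      have D_w: "D (w e) = scale (h e) (w e)" for e
        unfolding w_def
        by (subst endo_sum[OF D(1) sV])
           (auto intro!: sum.cong simp: subspace_scale[OF sV] scale_sum_right endoD(3)[OF D(1)] inV D(2) mult.commute)
      have "w c = v" using zero[of c] by (simp add: S_def)
      then show ?thesis using D_w[of c] by simp
    qed
    then show ?thesis using D by blast
  qed
  then show ?thesis using that finB B(2) spB \<mu> by blast
qed

section \<open>Nilpotent maps and their traces\<close>

lemma nilpotent_uniform:
  assumes V: "finite_dim scale V" and f: "endo V f" and nil: "gen_eig V f 0 = V"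
  obtains m where "\<And>v. v \<in> V \<Longrightarrow> (f ^^ m) v = 0"
proof -
  have sV: "subspace V" by (rule finite_dim_subspace[OF V])
  obtain B where B: "finite B" "span B = V" using V by (auto simp: finite_dim_def)
  have "\<exists>m. (f ^^ m) b = 0" if "b \<in> B" for b
    using that nil B span_base[of b B] by (auto simp: gen_eig_0)
  then obtain k where k: "\<And>b. b \<in> B \<Longrightarrow> (f ^^ k b) b = 0" by metis
  define m where "m = Max (k ` B)"
  have "(f ^^ m) b = 0" if "b \<in> B" for b
  proof (rule funpow_zero_mono[OF f sV k[OF that]])
    show "k b \<le> m" unfolding m_def using that B(1) by (intro Max_ge) auto
  qed
  then have "(f ^^ m) v = 0" if "v \<in> V" for v
    using endo_eqI[OF endo_funpow[OF f] _ sV B(2), of "\<lambda>v. 0" m v] that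
    by (simp add: endo_def subspace_0[OF sV])
  then show ?thesis by (rule that)
qed

text \<open>A nilpotent map on a nonzero space has a proper image, on which it is again nilpotent
  and which carries the whole trace.\<close>

lemma trace_nilpotent:
  assumes "finite_dim scale V" and "endo V f" and "gen_eig V f 0 = V"
  shows "trace V f = 0"
  using assms
proof (induction "dim V" arbitrary: V rule: less_induct)
  case less
  note V = less.prems(1) and f = less.prems(2)
  have sV: "subspace V" by (rule finite_dim_subspace[OF V])
  show ?case
  proof (cases "f ` V = V")
    case True
    then have "(f ^^ m) ` V = V" for m by (induction m) (simp, metis funpow.simps(2) image_comp)
    moreover obtain m where "\<And>v. v \<in> V \<Longrightarrow> (f ^^ m) v = 0" using nilpotent_uniform[OF less.prems] by blast
    ultimately have "V \<subseteq> {0}" by (metis image_subset_iff singletonI subsetI)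
    then have "V = span {}" using subspace_0[OF sV] by auto
    then show ?thesis using trace_eq[OF f, of "{}"] independent_empty by simp
  next
    case False
    note im = endo_image[OF f sV]
    have *: "trace V f = trace (f ` V) f" by (rule trace_restrict[OF V f im]) auto
    have e: "endo (f ` V) f" using im by (intro endo_restrict[OF f]) auto
    have "f ` V \<subseteq> gen_eig V f 0" using less.prems(3) im(2) by simp
    then have "gen_eig (f ` V) f 0 = f ` V" unfolding gen_eig_0 by blast
    then show ?thesis
      unfolding * using less.hyps[OF finite_dim_mono(2)[OF V im False] finite_dim_mono(1)[OF V im] e]
      by simp
  qed
qed

text \<open>\<open>N\<close> multiplies the space of \<open>c\<close> by \<open>c * cnj c\<close>.
  There \<open>R\<close>, the difference of \<open>f \<circ> D\<close> and \<open>N\<close>, is a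
  multiple of \<open>f - c\<close>, so it is nilpotent and has trace zero. The trace of
  \<open>f \<circ> D\<close> is therefore a sum of squared absolute values, which vanishes only if
  every eigenvalue is zero.\<close>

lemma cnj_calculus:
  assumes V: "finite_dim scale V" and f: "endo V f"
  obtains D where "endo V D" "\<And>c v. v \<in> gen_eig V f c \<Longrightarrow> D v = scale (cnj c) v"
    "trace V (\<lambda>v. f (D v)) = 0 \<Longrightarrow> gen_eig V f 0 = V"
proof -
  have sV: "subspace V" by (rule finite_dim_subspace[OF V])
  obtain B \<mu> where B: "finite B" "independent B" "span B = V"
    and \<mu>: "\<And>b. b \<in> B \<Longrightarrow> b \<in> gen_eig V f (\<mu> b)"
    and ex: "\<And>h. \<exists>D. endo V D \<and> (\<forall>c. \<forall>v\<in>gen_eig V f c. D v = scale (h c) v)"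
    using functional_calculus[OF V f] by metis
  obtain D where D: "endo V D" "\<And>c v. v \<in> gen_eig V f c \<Longrightarrow> D v = scale (cnj c) v"
    using ex[of cnj] by blast
  obtain N where N: "endo V N" "\<And>c v. v \<in> gen_eig V f c \<Longrightarrow> N v = scale (c * cnj c) v"
    using ex[of "\<lambda>c. c * cnj c"] by blast
  define R where "R v = f (D v) - N v" for v
  have fD: "endo V (\<lambda>v. f (D v))" by (rule endo_comp[OF f D(1)])
  have R: "endo V R" unfolding R_def by (rule endo_sub[OF sV fD N(1)])
  have R_eig: "R v = scale (cnj c) (f v - scale c v)" if "v \<in> gen_eig V f c" for c v
    using that D(2)[OF that] N(2)[OF that] endoD(3)[OF f, of v]
    by (simp add: R_def gen_eig_def scale_right_diff_distrib mult.commute)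
  have "gen_eig V f c \<subseteq> gen_eig V R 0" for c
  proof
    fix v assume "v \<in> gen_eig V f c"
    with f sV show "v \<in> gen_eig V R 0"
    proof (induction rule: gen_eig_induct)
      case zero
      show ?case by (rule subspace_0[OF subspace_gen_eig[OF R sV]])
    next
      case (step v)
      then have "R v \<in> gen_eig V R 0"
        using subspace_scale[OF subspace_gen_eig[OF R sV]] by (simp add: R_eig)
      then show ?case using step(1) gen_eig_step[of v V R 0] by (simp add: gen_eig_def)
    qed
  qed
  then have "gen_eig_sum V f \<subseteq> gen_eig V R 0"
    by (intro span_minimal subspace_gen_eig[OF R sV]) auto
  then have "gen_eig V R 0 = V"
    unfolding gen_eig_sum_eq[OF V f] by (auto simp only: gen_eig_def)
  then have "trace V R = 0" by (rule trace_nilpotent[OF V R])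
  then have tr: "trace V (\<lambda>v. f (D v)) = trace V N"
    using trace_diff[OF V fD N(1)] by (simp add: R_def[abs_def])
  have "trace V N = (\<Sum>b\<in>B. \<mu> b * cnj (\<mu> b))"
    unfolding trace_eq[OF N(1) B]
    by (intro sum.cong refl)
       (simp add: N(2)[OF \<mu>] representation_scale[OF B(2)] span_base representation_basis[OF B(2)])
  then have trN: "trace V (\<lambda>v. f (D v)) = of_real (\<Sum>b\<in>B. (cmod (\<mu> b))\<^sup>2)"
    unfolding tr by (simp only: complex_norm_square of_real_sum)
  have "gen_eig V f 0 = V" if "trace V (\<lambda>v. f (D v)) = 0"
  proof -
    have "(\<Sum>b\<in>B. (cmod (\<mu> b))\<^sup>2) = 0" using that unfolding trN by (simp only: of_real_eq_0_iff)
    then have "\<mu> b = 0" if "b \<in> B" for b using B(1) that by (simp add: sum_nonneg_eq_0_iff)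
    then have "B \<subseteq> gen_eig V f 0" using \<mu> by force
    then have "span B \<subseteq> gen_eig V f 0" by (intro span_minimal subspace_gen_eig[OF f sV]) auto
    then show ?thesis unfolding B(3) by (auto simp only: gen_eig_def)
  qed
  then show ?thesis using that D by blast
qed

lemma endo_add: "subspace V \<Longrightarrow> endo V f \<Longrightarrow> endo V g \<Longrightarrow> endo V (\<lambda>v. f v + g v)"
  using endo_lin[of V f g "-1"] by simp

section \<open>Dual bases of a nondegenerate symmetric form\<close>

text \<open>The map \<open>S\<close> records the pairings of a vector with the basis
  \<open>E\<close>. It is injective on \<open>q\<close> by nondegeneracy, hence onto by dimension,
  and the preimages of the basis vectors form the dual basis. The two expansion formulas are what
  makes a Casimir operator commute with the action.\<close>

lemma dual_basis:
  fixes \<beta> :: "'v \<Rightarrow> 'v \<Rightarrow> complex"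
  assumes q: "finite_dim scale q"
    and add: "\<And>x y z. \<beta> (x + y) z = \<beta> x z + \<beta> y z"
    and scl: "\<And>c x z. \<beta> (scale c x) z = c * \<beta> x z"
    and sym: "\<And>x y. \<beta> x y = \<beta> y x"
    and nondeg: "\<And>x. x \<in> q \<Longrightarrow> (\<And>y. y \<in> q \<Longrightarrow> \<beta> x y = 0) \<Longrightarrow> x = 0"
  obtains E e' where "finite E" "E \<subseteq> q" "span E = q" "\<And>e. e \<in> E \<Longrightarrow> e' e \<in> q"
    "\<And>e. e \<in> E \<Longrightarrow> \<beta> e (e' e) = 1"
    "\<And>y. y \<in> q \<Longrightarrow> (\<Sum>e\<in>E. scale (\<beta> y (e' e)) e) = y"
    "\<And>y. y \<in> q \<Longrightarrow> (\<Sum>e\<in>E. scale (\<beta> y e) (e' e)) = y"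
proof -
  have sq: "subspace q" by (rule finite_dim_subspace[OF q])
  obtain E where E: "finite E" "independent E" "span E = q" using finite_dim_basis q by blast
  have Eq: "E \<subseteq> q" using E span_superset by blast
  have add2: "\<beta> z (x + y) = \<beta> z x + \<beta> z y" and scl2: "\<beta> z (scale c x) = c * \<beta> z x" for c x y z
    using add scl sym by metis+
  have zero: "\<beta> 0 z = 0" "\<beta> z 0 = 0" for z using scl[of 0 0 z] scl2[of z 0 0] by simp_all
  have sum1: "\<beta> (\<Sum>a\<in>A. scale (k a) (g a)) z = (\<Sum>a\<in>A. k a * \<beta> (g a) z)" for A :: "'v set" and k g z
    by (induction A rule: infinite_finite_induct) (simp_all add: add scl zero)
  define S where "S y = (\<Sum>e\<in>E. scale (\<beta> e y) e)" for y
  have linS: "Vector_Spaces.linear scale scale S"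
    by unfold_locales
       (simp_all add: S_def add2 scl2 scale_left_distrib sum.distrib scale_sum_right)
  interpret S: Vector_Spaces.linear scale scale S by (rule linS)
  have beta_zero: "x = 0" if "x \<in> q" "\<And>e. e \<in> E \<Longrightarrow> \<beta> e x = 0" for x
  proof (rule nondeg[OF that(1)])
    fix y assume "y \<in> q"
    then have "\<beta> y x = \<beta> (\<Sum>e\<in>E. scale (representation E y e) e) x"
      using E by (simp add: representation_expand)
    also have "\<dots> = (\<Sum>e\<in>E. representation E y e * \<beta> e x)" by (rule sum1)
    finally have "\<beta> y x = (\<Sum>e\<in>E. representation E y e * \<beta> e x)" .
    then show "\<beta> x y = 0" using that(2) by (simp add: sym[of x y])
  qed
  have injS: "inj_on S q"
  proof (subst S.inj_on_iff_eq_0[OF sq], intro ballI impI)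
    fix x assume x: "x \<in> q" "S x = 0"
    then show "x = 0"
      using beta_zero[OF x(1)] independentD[OF E(2,1) order_refl, of "\<lambda>e. \<beta> e x"] by (simp add: S_def)
  qed
  have "independent (S ` E)" by (rule S.independent_injective_image[OF E(2)]) (simp add: E injS)
  moreover have "card (S ` E) = card E" using injS Eq by (intro card_image) (rule inj_on_subset)
  ultimately have "dim (span (S ` E)) = dim q"
    using dim_span_eq_card_independent E by metis
  moreover have "S y \<in> q" for y unfolding S_def using Eq by (intro subspace_sum subspace_scale sq) auto
  then have "span (S ` E) \<subseteq> q" by (intro span_minimal sq) auto
  ultimately have "span (S ` E) = q"
    using finite_dim_mono(2)[OF q subspace_span] by force
  then have "S ` q = q" using S.span_image[of E] E by simp
  then have "\<exists>y\<in>q. S y = e" if "e \<in> E" for e using that Eq by (metis (no_types, lifting) imageE subsetD)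
  then obtain e' where e': "\<And>e. e \<in> E \<Longrightarrow> e' e \<in> q" "\<And>e. e \<in> E \<Longrightarrow> S (e' e) = e" by metis
  have dual: "\<beta> d (e' e) = (if d = e then 1 else 0)" if "d \<in> E" "e \<in> E" for d e
  proof -
    have "representation E (S (e' e)) d = (\<Sum>x\<in>E. \<beta> x (e' e) * representation E x d)"
      unfolding S_def by (rule representation_lin_comb[OF E(2)]) (rule span_base)
    also have "\<dots> = (\<Sum>x\<in>E. if x = d then \<beta> d (e' e) else 0)"
      by (intro sum.cong) (auto simp: representation_basis[OF E(2)])
    finally have "representation E (S (e' e)) d = \<beta> d (e' e)" using E(1) that by simp
    then show ?thesis using e'(2)[OF that(2)] E that by (simp add: representation_basis)
  qed
  have exp1: "(\<Sum>e\<in>E. scale (\<beta> y (e' e)) e) = y" if "y \<in> q" for y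
  proof -
    have "\<beta> y (e' e) = representation E y e" if "e \<in> E" for e
    proof -
      have "\<beta> y (e' e) = \<beta> (\<Sum>d\<in>E. scale (representation E y d) d) (e' e)"
        using E \<open>y \<in> q\<close> by (simp add: representation_expand)
      also have "\<dots> = (\<Sum>d\<in>E. representation E y d * \<beta> d (e' e))" by (rule sum1)
      also have "\<dots> = (\<Sum>d\<in>E. if d = e then representation E y d else 0)"
        using that by (intro sum.cong) (auto simp: dual)
      finally show ?thesis using E that by simp
    qed
    then show ?thesis using E that by (simp add: representation_expand)
  qed
  have exp2: "(\<Sum>e\<in>E. scale (\<beta> y e) (e' e)) = y" if y: "y \<in> q" for y
  proof -
    have "y - (\<Sum>e\<in>E. scale (\<beta> y e) (e' e)) = 0"
    proof (rule beta_zero)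
      show "y - (\<Sum>e\<in>E. scale (\<beta> y e) (e' e)) \<in> q"
        using e'(1) y by (intro subspace_diff subspace_sum subspace_scale sq) auto
      fix d assume d: "d \<in> E"
      have "\<beta> (\<Sum>e\<in>E. scale (\<beta> y e) (e' e)) d = (\<Sum>e\<in>E. \<beta> y e * \<beta> (e' e) d)" by (rule sum1)
      also have "\<dots> = (\<Sum>e\<in>E. if e = d then \<beta> y e else 0)"
        using d dual[OF d] by (intro sum.cong) (auto simp: sym[of "e' _" d])
      also have "\<dots> = \<beta> y d" using E d by simp
      finally have "\<beta> (y - (\<Sum>e\<in>E. scale (\<beta> y e) (e' e)) + (\<Sum>e\<in>E. scale (\<beta> y e) (e' e))) d =
          \<beta> (\<Sum>e\<in>E. scale (\<beta> y e) (e' e)) d" by simp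
      then show "\<beta> d (y - (\<Sum>e\<in>E. scale (\<beta> y e) (e' e))) = 0" unfolding add by (simp add: sym[of d])
    qed
    then show ?thesis by simp
  qed
  show ?thesis using that[OF E(1) Eq E(3) e'(1) _ exp1 exp2] dual by simp
qed

end

section \<open>Lie modules\<close>

sublocale lie_algebra \<subseteq> complex_space scale
  by unfold_locales

sublocale lie_module \<subseteq> V: complex_space scaleV
  by unfold_locales

lemma (in lie_algebra) adjoint_lie_module: "lie_module scale bracket scale UNIV bracket"
proof unfold_locales
  fix x y v
  have "bracket v (bracket x y) = - bracket (bracket x y) v"
    "bracket y (bracket v x) = - bracket y (bracket x v)"
    using bracket_skew[of v "bracket x y"] bracket_skew[of v x] bracket_scale_right[of y "-1" "bracket x v"]
    by simp_all
  then show "bracket (bracket x y) v = bracket x (bracket y v) - bracket y (bracket x v)"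
    using jacobi[of x y v] by (simp add: algebra_simps add_eq_0_iff2)
qed (simp_all add: bracket_add_left bracket_add_right bracket_scale_left bracket_scale_right)

text \<open>A complementary ideal \<open>J\<close> of the derived ideal is central: a bracket with
  an element of \<open>J\<close> lies in both ideals.\<close>

lemma reductive_derived_center:
  assumes "reductive_lie_algebra scale bracket"
  obtains s z where "x = s + z" "s \<in> module.span scale {bracket y y' | y y'. True}" "\<And>y. bracket z y = 0"
proof -
  interpret lie_algebra scale bracket using assms by (simp add: reductive_lie_algebra_def)
  let ?D = "span {bracket y y' | y y'. True}"
  have "lie_ideal scale bracket ?D"
    unfolding lie_ideal_def by (auto intro: span_base)
  then obtain J where J: "lie_ideal scale bracket J" "?D \<inter> J = {0}" "\<And>x. \<exists>a\<in>?D. \<exists>b\<in>J. x = a + b"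
    using assms unfolding reductive_lie_algebra_def by blast
  obtain s z where sz: "s \<in> ?D" "z \<in> J" "x = s + z" using J(3) by blast
  have "bracket z y = 0" for y
  proof -
    have "bracket y z \<in> ?D \<inter> J" using J(1) sz(2) by (auto simp: lie_ideal_def intro: span_base)
    then show ?thesis using J(2) bracket_skew[of z y] by auto
  qed
  then show ?thesis using sz that by blast
qed

context lie_module
begin

definition submodule :: "'v set \<Rightarrow> bool" where
  "submodule U \<longleftrightarrow> V.subspace U \<and> U \<subseteq> M \<and> (\<forall>x. \<forall>v\<in>U. \<rho> x v \<in> U)"

lemma act_endo: "V.endo M (\<rho> x)"
  by (simp add: V.endo_def act_closed act_add_right act_scale_right)

lemma submodule_endo: "submodule U \<Longrightarrow> V.endo U (\<rho> x)"
  by (rule V.endo_restrict[OF act_endo]) (auto simp: submodule_def)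

lemma submodule_lie_module: "submodule U \<Longrightarrow> lie_module scale bracket scaleV U \<rho>"
  by unfold_locales
     (auto simp: submodule_def act_add_left act_scale_left act_add_right act_scale_right act_bracket subset_iff)

lemma act_zero_right: "\<rho> x 0 = 0"
  using V.endo_zero[OF act_endo subspace_carrier] .

lemma act_zero_left: "v \<in> M \<Longrightarrow> \<rho> 0 v = 0"
  using act_scale_left[of v 0 0] by simp

lemma act_lin_comb_left:
  assumes "v \<in> M"
  shows "\<rho> (\<Sum>a\<in>A. scale (c a) (x a)) v = (\<Sum>a\<in>A. scaleV (c a) (\<rho> (x a) v))"
  by (induction A rule: infinite_finite_induct)
     (simp_all add: assms act_zero_left act_add_left act_scale_left)

lemma act_span_mem:
  assumes "v \<in> M" "V.subspace U" "x \<in> span X" "\<And>x. x \<in> X \<Longrightarrow> \<rho> x v \<in> U"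
  shows "\<rho> x v \<in> U"
proof -
  have "span X \<subseteq> {x. \<rho> x v \<in> U}"
    using assms(1,2,4)
    by (intro span_minimal subspaceI)
       (auto simp: act_zero_left act_add_left act_scale_left V.subspace_0 V.subspace_add V.subspace_scale)
  then show ?thesis using assms(3) by blast
qed

lemma submodule_insert:
  assumes U: "submodule U" and v: "v \<in> M" "\<And>x. \<rho> x v \<in> U"
  shows "submodule (V.span (insert v U))"
proof -
  have sp: "V.span U = U" using U by (simp add: submodule_def)
  have *: "w \<in> V.span (insert v U) \<longleftrightarrow> (\<exists>k. w - scaleV k v \<in> U)" for w
    by (simp add: V.span_breakdown_eq sp)
  have "\<rho> x w \<in> V.span (insert v U)" if w: "w \<in> V.span (insert v U)" for x w
  proof -
    obtain k where k: "w - scaleV k v \<in> U" using w * by blast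
    then have kM: "w - scaleV k v \<in> M" using U by (auto simp: submodule_def)
    have "\<rho> x ((w - scaleV k v) + scaleV k v) = \<rho> x (w - scaleV k v) + scaleV k (\<rho> x v)"
      using kM v V.subspace_scale[OF subspace_carrier] by (subst act_add_right) (simp_all add: act_scale_right)
    then have "\<rho> x w \<in> U"
      using U k v by (simp add: submodule_def V.subspace_add V.subspace_scale)
    then show ?thesis by (simp add: V.span_base)
  qed
  moreover have "V.span (insert v U) \<subseteq> M"
    using U v by (intro V.span_minimal subspace_carrier) (auto simp: submodule_def)
  ultimately show ?thesis by (simp add: submodule_def)
qed

section \<open>Engel's theorem\<close>

text \<open>Since brackets of \<open>K\<close> with \<open>y\<close> stay in \<open>K\<close>, the
  vectors of \<open>P\<close> that \<open>K\<close> moves into \<open>Q\<close> are stable under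
  \<open>y\<close>. The iterates of \<open>u\<close> under \<open>y\<close> reach \<open>Q\<close>
  by nilpotency, and the last one outside \<open>Q\<close> is the required vector.\<close>

lemma engel_step:
  assumes P: "P \<subseteq> M" "\<And>v. v \<in> P \<Longrightarrow> \<rho> y v \<in> P" and Q: "V.subspace Q" "\<And>v. v \<in> Q \<Longrightarrow> \<rho> y v \<in> Q"
    and norm: "\<And>x. x \<in> K \<Longrightarrow> bracket x y \<in> K"
    and nil: "\<And>v. v \<in> P \<Longrightarrow> \<exists>m. (\<rho> y ^^ m) v \<in> Q"
    and u: "u \<in> P - Q" "\<And>x. x \<in> K \<Longrightarrow> \<rho> x u \<in> Q"
  shows "\<exists>v\<in>P - Q. \<rho> y v \<in> Q \<and> (\<forall>x\<in>K. \<rho> x v \<in> Q)"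
proof -
  have iter: "(\<rho> y ^^ j) u \<in> P \<and> (\<forall>x\<in>K. \<rho> x ((\<rho> y ^^ j) u) \<in> Q)" for j
  proof (induction j)
    case (Suc j)
    let ?w = "(\<rho> y ^^ j) u"
    have "\<rho> x (\<rho> y ?w) \<in> Q" if x: "x \<in> K" for x
    proof -
      have "?w \<in> M" using Suc P by blast
      then have "\<rho> x (\<rho> y ?w) = \<rho> (bracket x y) ?w + \<rho> y (\<rho> x ?w)" by (simp add: act_bracket)
      moreover have "\<rho> (bracket x y) ?w \<in> Q" using Suc norm[OF x] by blast
      moreover have "\<rho> y (\<rho> x ?w) \<in> Q" using Suc x Q by blast
      ultimately show ?thesis by (simp add: V.subspace_add Q)
    qed
    then show ?case using Suc P by simp
  qed (use u in auto)
  define m where "m = (LEAST m. (\<rho> y ^^ m) u \<in> Q)"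
  have "\<exists>m. (\<rho> y ^^ m) u \<in> Q" using nil u(1) by blast
  then have m: "(\<rho> y ^^ m) u \<in> Q" unfolding m_def by (rule LeastI_ex)
  then obtain n where n: "m = Suc n" using u by (cases m) auto
  then have "(\<rho> y ^^ n) u \<notin> Q" using not_less_Least[of n "\<lambda>m. (\<rho> y ^^ m) u \<in> Q"] by (simp add: m_def)
  moreover have "\<rho> y ((\<rho> y ^^ n) u) \<in> Q" using m n by simp
  ultimately show ?thesis using iter[of n] by blast
qed

text \<open>A power of \<open>ad y\<close> at \<open>z\<close> expands into terms
  \<open>y^i z y^j\<close> with \<open>i + j = 2 * N\<close>, and one exponent is at least
  \<open>N\<close>. The induction carries powers of \<open>y\<close> on both sides, because every
  bracket splits into a left and a right multiplication.\<close>

lemma ad_nilpotent: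
  assumes "\<And>v. v \<in> M \<Longrightarrow> (\<rho> y ^^ N) v = 0" "v \<in> M"
  shows "\<rho> ((bracket y ^^ (2 * N)) z) v = 0"
proof -
  have pow: "(\<rho> y ^^ i) v \<in> M" if "v \<in> M" for i v
    using V.endoD(1)[OF V.endo_funpow[OF act_endo] that] .
  have zero: "(\<rho> y ^^ i) v = 0" if "v \<in> M" "N \<le> i" for i v
    using V.funpow_zero_mono[OF act_endo subspace_carrier assms(1)[OF that(1)] that(2)] .
  have pow0: "(\<rho> y ^^ i) 0 = 0" for i
    using V.endo_zero[OF V.endo_funpow[OF act_endo] subspace_carrier] .
  have "(\<rho> y ^^ i) (\<rho> ((bracket y ^^ m) z) ((\<rho> y ^^ j) v)) = 0" if "v \<in> M" "2 * N \<le> i + j + m" for i j m v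
    using that(2)
  proof (induction m arbitrary: i j)
    case 0
    show ?case
    proof (cases "N \<le> j")
      case True
      then show ?thesis using zero[OF that(1)] by (simp add: act_zero_right pow0)
    next
      case False
      then show ?thesis using 0 pow[OF that(1)] by (intro zero) (auto simp: act_closed)
    qed
  next
    case (Suc m)
    let ?w = "(bracket y ^^ m) z"
    have "\<rho> ((bracket y ^^ Suc m) z) ((\<rho> y ^^ j) v) =
        \<rho> y (\<rho> ?w ((\<rho> y ^^ j) v)) - \<rho> ?w (\<rho> y ((\<rho> y ^^ j) v))"
      using pow[OF that(1)] by (simp add: act_bracket)
    then have "(\<rho> y ^^ i) (\<rho> ((bracket y ^^ Suc m) z) ((\<rho> y ^^ j) v)) =
        (\<rho> y ^^ i) (\<rho> y (\<rho> ?w ((\<rho> y ^^ j) v))) - (\<rho> y ^^ i) (\<rho> ?w (\<rho> y ((\<rho> y ^^ j) v)))"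
      using V.endo_diff[OF V.endo_funpow[OF act_endo] subspace_carrier] pow[OF that(1)]
      by (simp only: act_closed)
    also have "\<dots> = (\<rho> y ^^ Suc i) (\<rho> ?w ((\<rho> y ^^ j) v)) - (\<rho> y ^^ i) (\<rho> ?w ((\<rho> y ^^ Suc j) v))"
      by (simp only: funpow_Suc_right o_apply) (simp only: funpow_swap1)
    also have "\<dots> = 0" using Suc.IH[of "Suc i" j] Suc.IH[of i "Suc j"] Suc.prems by simp
    finally show ?case .
  qed
  from this[of v 0 0 "2 * N"] show ?thesis using assms(2) by simp
qed

text \<open>The relative form, for a pair \<open>Q \<subset> P\<close>, applies to subquotients
  without quotient modules. Nilpotency is assumed of the operators and not of the Lie algebra, so
  statements about the adjoint action are made modulo the kernel \<open>k\<close>.\<close>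

lemma engel:
  assumes fd: "finite_dim scale UNIV"
    and nil: "\<And>x. \<exists>N. \<forall>v\<in>M. (\<rho> x ^^ N) v = 0"
    and P: "submodule P" and Q: "submodule Q" "Q \<subset> P"
  shows "\<exists>v\<in>P - Q. \<forall>x. \<rho> x v \<in> Q"
proof -
  interpret ad: lie_module scale bracket scale UNIV bracket by (rule adjoint_lie_module)
  define k where "k = {x. \<forall>v\<in>M. \<rho> x v = 0}"
  have sk: "subspace k"
    unfolding k_def by (rule subspaceI) (auto simp: act_zero_left act_add_left act_scale_left)
  have k_ideal: "bracket x y \<in> k" if "x \<in> k" for x y
    using that by (auto simp: k_def act_bracket act_closed act_zero_right)
  have ad_nil: "\<exists>m. (bracket y ^^ m) z \<in> k" for y z
  proof -
    obtain N where "\<forall>v\<in>M. (\<rho> y ^^ N) v = 0" using nil by blast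
    then show ?thesis using ad_nilpotent[of N y] by (auto simp: k_def)
  qed
  \<comment> \<open>The conclusion is demanded on \<open>P\<close> over \<open>Q\<close> and also on
    every adjoint subquotient \<open>A\<close> over \<open>B\<close> above \<open>k\<close>. The
    second clause supplies an element with which a proper \<open>K\<close> can be enlarged; carrying
    both clauses through one maximality argument takes the place of an induction over Lie
    algebras.\<close>
  define good where "good K \<longleftrightarrow> subspace K \<and> k \<subseteq> K \<and> (\<forall>x\<in>K. \<forall>y\<in>K. bracket x y \<in> K) \<and>
    (\<forall>A B. subspace A \<and> subspace B \<and> k \<subseteq> B \<and> B \<subset> A \<and>
        (\<forall>x\<in>K. \<forall>y\<in>A. bracket x y \<in> A) \<and> (\<forall>x\<in>K. \<forall>y\<in>B. bracket x y \<in> B) \<longrightarrow>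
        (\<exists>y\<in>A - B. \<forall>x\<in>K. bracket x y \<in> B)) \<and>
    (\<exists>v\<in>P - Q. \<forall>x\<in>K. \<rho> x v \<in> Q)" for K
  have "good k"
    unfolding good_def
  proof (intro conjI allI impI ballI)
    show "bracket x y \<in> k" if "x \<in> k" for x y by (rule k_ideal[OF that])
  next
    fix A B assume "subspace A \<and> subspace B \<and> k \<subseteq> B \<and> B \<subset> A \<and>
        (\<forall>x\<in>k. \<forall>y\<in>A. bracket x y \<in> A) \<and> (\<forall>x\<in>k. \<forall>y\<in>B. bracket x y \<in> B)"
    then show "\<exists>y\<in>A - B. \<forall>x\<in>k. bracket x y \<in> B" using k_ideal by blast
  next
    obtain v where "v \<in> P - Q" using Q by blast
    moreover have "\<rho> x v \<in> Q" if "x \<in> k" for x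
      using that P Q calculation V.subspace_0[of Q] by (auto simp: k_def submodule_def)
    ultimately show "\<exists>v\<in>P - Q. \<forall>x\<in>k. \<rho> x v \<in> Q" by blast
  qed (use sk in auto)
  moreover have "dim K < Suc (dim UNIV)" if "good K" for K
    using finite_dim_mono(3)[OF fd, of K] that by (simp add: good_def)
  ultimately obtain K where K: "good K" "\<And>K'. good K' \<Longrightarrow> dim K' \<le> dim K"
    using ex_has_greatest_nat[of good k dim "Suc (dim UNIV)"] by blast
  have sK: "subspace K" "k \<subseteq> K" "\<And>x y. x \<in> K \<Longrightarrow> y \<in> K \<Longrightarrow> bracket x y \<in> K"
    using K(1) by (auto simp: good_def)
  have K_ad: "\<exists>y\<in>A - B. \<forall>x\<in>K. bracket x y \<in> B"
    if "subspace A" "subspace B" "k \<subseteq> B" "B \<subset> A" "\<And>x y. x \<in> K \<Longrightarrow> y \<in> A \<Longrightarrow> bracket x y \<in> A"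
      "\<And>x y. x \<in> K \<Longrightarrow> y \<in> B \<Longrightarrow> bracket x y \<in> B" for A B
    using K(1) that unfolding good_def by blast
  obtain v0 where v0: "v0 \<in> P - Q" "\<And>x. x \<in> K \<Longrightarrow> \<rho> x v0 \<in> Q" using K(1) by (auto simp: good_def)
  show ?thesis
  proof (cases "K = UNIV")
    case True
    then show ?thesis using v0 by blast
  next
    case False
    \<comment> \<open>As \<open>K\<close> contains \<open>k\<close>, it can serve as
      \<open>B\<close> under \<open>A = UNIV\<close>: some \<open>y\<close> outside \<open>K\<close>
      normalizes it.\<close>
    then obtain y where y: "y \<notin> K" "\<And>x. x \<in> K \<Longrightarrow> bracket x y \<in> K"
      using K_ad[of UNIV K] sK by (metis DiffE UNIV_I psubsetI subset_UNIV subspace_UNIV)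
    let ?K = "span (insert y K)"
    have inK: "K \<subseteq> ?K" "y \<in> ?K" by (auto intro: span_base)
    have "good ?K"
      unfolding good_def
    proof (intro conjI allI impI ballI)
      show "k \<subseteq> ?K" using sK inK by blast
    next
      fix x x' assume x: "x \<in> ?K" "x' \<in> ?K"
      have nK: "- bracket z y \<in> ?K" if "z \<in> K" for z
        using that y(2) inK by (intro span_neg) auto
      have "bracket u x' \<in> ?K" if u: "u \<in> insert y K" for u
      proof -
        have "bracket u z \<in> ?K" if "z \<in> insert y K" for z
          using u that y(2) sK(3) inK nK[of z] bracket_self[of y] bracket_skew[of y z] span_zero[of "insert y K"]
          by auto
        then have "insert y K \<subseteq> {z. bracket u z \<in> ?K}" by blast
        then have "?K \<subseteq> {z. bracket u z \<in> ?K}"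
          by (rule span_minimal) (auto intro!: subspaceI span_add span_scale simp: bracket_zero_right bracket_add_right bracket_scale_right span_zero)
        then show ?thesis using x by blast
      qed
      then show "bracket x x' \<in> ?K" using ad.act_span_mem[of x' ?K x "insert y K"] x by simp
    next
      fix A B assume AB: "subspace A \<and> subspace B \<and> k \<subseteq> B \<and> B \<subset> A \<and>
        (\<forall>x\<in>?K. \<forall>y\<in>A. bracket x y \<in> A) \<and> (\<forall>x\<in>?K. \<forall>y\<in>B. bracket x y \<in> B)"
      obtain z where z: "z \<in> A - B" "\<forall>x\<in>K. bracket x z \<in> B"
        using K_ad[of A B] AB inK by blast
      have "\<exists>v\<in>A - B. bracket y v \<in> B \<and> (\<forall>x\<in>K. bracket x v \<in> B)"
        by (rule ad.engel_step[where u = z and P = A and Q = B])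
           (use AB z y inK ad_nil in blast)+
      then obtain v where v: "v \<in> A - B" "bracket y v \<in> B" "\<forall>x\<in>K. bracket x v \<in> B" by blast
      have "bracket x v \<in> B" if "x \<in> ?K" for x
        by (rule ad.act_span_mem[OF _ _ that]) (use v AB in auto)
      then show "\<exists>v\<in>A - B. \<forall>x\<in>?K. bracket x v \<in> B" using v by blast
    next
      have "\<exists>v\<in>P - Q. \<rho> y v \<in> Q \<and> (\<forall>x\<in>K. \<rho> x v \<in> Q)"
      proof (rule engel_step[where u = v0])
        fix v assume v: "v \<in> P"
        then have "v \<in> M" using P by (auto simp: submodule_def)
        then obtain N where N: "(\<rho> y ^^ N) v = 0" using nil by blast
        show "\<exists>m. (\<rho> y ^^ m) v \<in> Q"
          using Q(1) V.subspace_0[of Q] by (intro exI[of _ N]) (simp add: N submodule_def)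
      qed (use P Q v0 y in \<open>auto simp: submodule_def\<close>)
      then obtain v where v: "v \<in> P - Q" "\<rho> y v \<in> Q" "\<forall>x\<in>K. \<rho> x v \<in> Q" by blast
      have "\<rho> x v \<in> Q" if "x \<in> ?K" for x
        by (rule act_span_mem[OF _ _ that]) (use v P Q in \<open>auto simp: submodule_def\<close>)
      then show "\<exists>v\<in>P - Q. \<forall>x\<in>?K. \<rho> x v \<in> Q" using v by blast
    qed auto
    moreover have "dim K < dim ?K"
      using finite_dim_mono(2)[OF finite_dim_mono(1)[OF fd, of ?K] sK(1) inK(1)] inK(2) y(1) by auto
    ultimately show ?thesis using K(2) by (metis leD)
  qed
qed

section \<open>Cartan's criterion\<close>

text \<open>Weights add, because \<open>(\<rho> x - (a + b)) (\<rho> y v)\<close> equals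
  \<open>\<rho> ((ad x - b) y) v + \<rho> y ((\<rho> x - a) v)\<close>. The first term is covered by
  the induction on \<open>y\<close>, the second by the inner induction on \<open>v\<close>.\<close>

lemma act_gen_eig:
  assumes y: "y \<in> gen_eig UNIV (bracket x) b" and v: "v \<in> V.gen_eig M (\<rho> x) a"
  shows "\<rho> y v \<in> V.gen_eig M (\<rho> x) (a + b)"
proof -
  interpret ad: lie_module scale bracket scale UNIV bracket by (rule adjoint_lie_module)
  let ?G = "V.gen_eig M (\<rho> x) (a + b)"
  have sG: "V.subspace ?G" by (rule V.subspace_gen_eig[OF act_endo subspace_carrier])
  have "\<forall>v\<in>V.gen_eig M (\<rho> x) a. \<rho> y v \<in> ?G"
    using ad.act_endo ad.subspace_carrier y
  proof (induction rule: gen_eig_induct)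
    case zero
    then show ?case using V.subspace_0[OF sG] by (auto simp: act_zero_left V.gen_eig_def)
  next
    case (step y)
    note IH = step
    show ?case
    proof
      fix v assume "v \<in> V.gen_eig M (\<rho> x) a"
      with act_endo subspace_carrier show "\<rho> y v \<in> ?G"
      proof (induction rule: V.gen_eig_induct)
        case zero
        show ?case by (simp add: act_zero_right V.subspace_0[OF sG])
      next
        case (step v)
        have vM: "v \<in> M" using step(1) by (simp add: V.gen_eig_def)
        have m: "\<rho> y v \<in> M" "\<rho> x v \<in> M" "scaleV a v \<in> M"
          using vM by (simp_all add: act_closed V.subspace_scale[OF subspace_carrier])
        have 1: "\<rho> (bracket x y - scale b y) v = \<rho> x (\<rho> y v) - \<rho> y (\<rho> x v) - scaleV b (\<rho> y v)"
          using act_add_left[OF vM, of "bracket x y - scale b y" "scale b y"]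
          by (simp add: act_bracket[OF vM] act_scale_left[OF vM])
        have 2: "\<rho> y (\<rho> x v - scaleV a v) = \<rho> y (\<rho> x v) - scaleV a (\<rho> y v)"
          using V.endo_diff[OF act_endo subspace_carrier m(2,3)] act_scale_right[OF vM] by simp
        have "\<rho> x (\<rho> y v) - scaleV (a + b) (\<rho> y v) =
            \<rho> (bracket x y - scale b y) v + \<rho> y (\<rho> x v - scaleV a v)"
          unfolding 1 2 by (simp add: V.scale_left_distrib)
        also have "\<dots> \<in> ?G" using step IH by (intro V.subspace_add[OF sG]) auto
        finally show ?case using V.gen_eig_step[OF m(1)] by blast
      qed
    qed
  qed
  then show ?thesis using v by blast
qed

text \<open>\<open>D\<close> and \<open>D'\<close> multiply the generalized eigenspaces of \<open>\<rho> x\<close> and \<open>ad x\<close> by the complex conjugate of the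
  eigenvalue. Conjugation is additive, so \<open>[D, \<rho> y] = \<rho> (D' y)\<close>. Hence the trace of \<open>\<rho> x \<circ> D\<close>, which is the sum of
  the \<open>|c|\<^sup>2\<close> over the eigenvalues \<open>c\<close>, vanishes with the trace form.\<close>

lemma cartan_nilpotent:
  assumes red: "reductive_lie_algebra scale bracket" and fdg: "finite_dim scale UNIV"
    and fd: "finite_dim scaleV M"
    and center: "\<And>z v. (\<And>y. bracket z y = 0) \<Longrightarrow> v \<in> M \<Longrightarrow> \<rho> z v = 0"
    and form: "\<And>x y. V.trace M (\<lambda>v. \<rho> x (\<rho> y v)) = 0"
  shows "V.gen_eig M (\<rho> x) 0 = M"
proof -
  let ?D = "{bracket y y' | y y'. True}"
  interpret ad: lie_module scale bracket scale UNIV bracket by (rule adjoint_lie_module)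
  obtain D where D: "V.endo M D" "\<And>c v. v \<in> V.gen_eig M (\<rho> x) c \<Longrightarrow> D v = scaleV (cnj c) v"
    "V.trace M (\<lambda>v. \<rho> x (D v)) = 0 \<Longrightarrow> V.gen_eig M (\<rho> x) 0 = M"
    using V.cnj_calculus[OF fd act_endo] by metis
  obtain D' where D': "endo UNIV D'" "\<And>c y. y \<in> gen_eig UNIV (bracket x) c \<Longrightarrow> D' y = scale (cnj c) y"
    using cnj_calculus[OF fdg ad.act_endo] by metis
  have comm: "D (\<rho> y v) - \<rho> y (D v) = \<rho> (D' y) v" if v: "v \<in> M" for y v
  proof -
    have A: "D (\<rho> y v) - \<rho> y (D v) = \<rho> (D' y) v" if y: "y \<in> gen_eig UNIV (bracket x) b" and v: "v \<in> M" for y b v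
    proof (rule V.endo_eqI[where f = "\<lambda>v. D (\<rho> y v) - \<rho> y (D v)", OF _ act_endo subspace_carrier V.gen_eig_sum_eq[OF fd act_endo[of x]] _ v])
      show "V.endo M (\<lambda>v. D (\<rho> y v) - \<rho> y (D v))"
        by (rule V.endo_sub[OF subspace_carrier V.endo_comp[OF D(1) act_endo] V.endo_comp[OF act_endo D(1)]])
      fix w assume "w \<in> (\<Union>c. V.gen_eig M (\<rho> x) c)"
      then obtain a where w: "w \<in> V.gen_eig M (\<rho> x) a" by blast
      then have wM: "w \<in> M" by (simp add: V.gen_eig_def)
      show "D (\<rho> y w) - \<rho> y (D w) = \<rho> (D' y) w"
        using wM D(2)[OF act_gen_eig[OF y w]] D(2)[OF w] D'(2)[OF y]
        by (simp add: act_scale_right act_scale_left V.scale_left_distrib)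
    qed
    have "subspace {y. D (\<rho> y v) - \<rho> y (D v) = \<rho> (D' y) v}"
      using v D'(1) V.endoD[OF D(1)] endo_zero[OF D'(1)] V.endo_zero[OF D(1) subspace_carrier]
      by (intro subspaceI)
         (auto simp: act_zero_left act_add_left act_scale_left endo_def act_closed
            V.scale_right_diff_distrib[symmetric] add_diff_add)
    then have "span (\<Union>b. gen_eig UNIV (bracket x) b) \<subseteq> {y. D (\<rho> y v) - \<rho> y (D v) = \<rho> (D' y) v}"
      using A v by (intro span_minimal) auto
    then show ?thesis unfolding gen_eig_sum_eq[OF fdg ad.act_endo] by blast
  qed
  \<comment> \<open>By cyclicity this trace is, up to sign, that of \<open>\<rho> y\<close> composed
    with the commutator of \<open>D\<close> and \<open>\<rho> z\<close>. By \<open>comm\<close> the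
    latter is \<open>\<rho> (D' z)\<close>, so a value of the trace form is left.\<close>
  have tr: "V.trace M (\<lambda>v. \<rho> (bracket y z) (D v)) = 0" for y z
  proof -
    have e: "V.endo M (\<lambda>v. \<rho> y (\<rho> z (D v)))" "V.endo M (\<lambda>v. \<rho> z (\<rho> y (D v)))"
      "V.endo M (\<lambda>v. \<rho> y (D (\<rho> z v)))" "V.endo M (\<lambda>v. \<rho> y (D v))" "V.endo M (\<lambda>v. \<rho> y (\<rho> (D' z) v))"
      by (rule V.endo_comp[OF act_endo V.endo_comp[OF act_endo D(1)]] V.endo_comp[OF act_endo V.endo_comp[OF D(1) act_endo]]
          V.endo_comp[OF act_endo D(1)] V.endo_comp[OF act_endo act_endo])+
    have "V.trace M (\<lambda>v. \<rho> (bracket y z) (D v)) = V.trace M (\<lambda>v. \<rho> y (\<rho> z (D v)) - \<rho> z (\<rho> y (D v)))"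
      by (rule V.trace_cong[OF fd V.endo_comp[OF act_endo D(1)] V.endo_sub[OF subspace_carrier e(1,2)]])
         (rule act_bracket[OF V.endoD(1)[OF D(1)]])
    also have "\<dots> = V.trace M (\<lambda>v. \<rho> y (\<rho> z (D v))) - V.trace M (\<lambda>v. \<rho> z (\<rho> y (D v)))"
      by (rule V.trace_diff[OF fd e(1,2)])
    also have "V.trace M (\<lambda>v. \<rho> z (\<rho> y (D v))) = V.trace M (\<lambda>v. \<rho> y (D (\<rho> z v)))"
      by (rule V.trace_comm[OF fd act_endo e(4)])
    also have "V.trace M (\<lambda>v. \<rho> y (D (\<rho> z v))) = V.trace M (\<lambda>v. \<rho> y (\<rho> z (D v))) + V.trace M (\<lambda>v. \<rho> y (\<rho> (D' z) v))"
      unfolding V.trace_add[OF fd e(1,5), symmetric]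
    proof (rule V.trace_cong[OF fd e(3)])
      show "V.endo M (\<lambda>v. \<rho> y (\<rho> z (D v)) + \<rho> y (\<rho> (D' z) v))"
        by (rule V.endo_add[OF subspace_carrier e(1,5)])
      fix v assume v: "v \<in> M"
      then show "\<rho> y (D (\<rho> z v)) = \<rho> y (\<rho> z (D v)) + \<rho> y (\<rho> (D' z) v)"
        using comm[OF v, of z] V.endoD(1)[OF D(1)]
        by (simp add: act_add_right[symmetric] act_closed algebra_simps)
    qed
    finally show ?thesis by (simp add: form)
  qed
  \<comment> \<open>\<open>tr\<close> handles brackets. Up to a central element, which acts by zero,
    \<open>x\<close> is a combination of brackets.\<close>
  obtain s z where sz: "x = s + z" "s \<in> span ?D" "\<And>y. bracket z y = 0"
    using reductive_derived_center[OF red] by metis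
  have eD: "V.endo M (\<lambda>v. \<rho> u (D v))" for u by (rule V.endo_comp[OF act_endo D(1)])
  have "subspace {u. V.trace M (\<lambda>v. \<rho> u (D v)) = 0}"
  proof (rule subspaceI; clarsimp)
    show "V.trace M (\<lambda>v. \<rho> 0 (D v)) = 0"
      using V.endoD(1)[OF D(1)] V.trace_cong[OF fd eD[of 0], of "\<lambda>v. 0"] V.trace_zero[OF fd]
      by (simp add: act_zero_left V.endo_def V.subspace_0[OF subspace_carrier])
  next
    fix u w assume "V.trace M (\<lambda>v. \<rho> u (D v)) = 0" "V.trace M (\<lambda>v. \<rho> w (D v)) = 0"
    moreover have "V.trace M (\<lambda>v. \<rho> (u + w) (D v) - \<rho> u (D v)) = V.trace M (\<lambda>v. \<rho> w (D v))"
      using V.endoD(1)[OF D(1)]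
      by (intro V.trace_cong fd V.endo_sub eD subspace_carrier) (simp add: act_add_left)
    ultimately show "V.trace M (\<lambda>v. \<rho> (u + w) (D v)) = 0"
      using V.trace_diff[OF fd eD[of "u + w"] eD[of u]] by simp
  next
    fix c u assume "V.trace M (\<lambda>v. \<rho> u (D v)) = 0"
    moreover have "V.trace M (\<lambda>v. \<rho> (scale c u) (D v) - scaleV c (\<rho> u (D v))) = V.trace M (\<lambda>v. 0)"
      using V.endoD(1)[OF D(1)]
      by (intro V.trace_cong fd V.endo_lin eD subspace_carrier)
         (simp_all add: act_scale_left V.endo_def V.subspace_0[OF subspace_carrier])
    ultimately show "V.trace M (\<lambda>v. \<rho> (scale c u) (D v)) = 0"
      using V.trace_lin[OF fd eD[of "scale c u"] eD[of u], of c] V.trace_zero[OF fd] by simp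
  qed
  then have "span ?D \<subseteq> {u. V.trace M (\<lambda>v. \<rho> u (D v)) = 0}"
    using tr by (intro span_minimal) auto
  then have "V.trace M (\<lambda>v. \<rho> s (D v)) = 0" using sz(2) by blast
  moreover have "V.trace M (\<lambda>v. \<rho> x (D v)) = V.trace M (\<lambda>v. \<rho> s (D v))"
    using V.endoD(1)[OF D(1)] center[OF sz(3)]
    by (intro V.trace_cong fd eD) (simp add: sz(1) act_add_left)
  ultimately show ?thesis using D(3) by simp
qed

section \<open>Lifting of invariants\<close>

text \<open>Take a submodule \<open>P\<close> of \<open>C\<close> of least dimension that receives
  the action on \<open>a\<close> and on \<open>C\<close>. If it were nonzero, Engel's theorem would
  give a smaller submodule \<open>P'\<close> into which the action moves \<open>P\<close>. A bracket
  acts in two steps, so it sends \<open>a\<close> and \<open>C\<close> into \<open>P'\<close>;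
  central elements act by zero. Hence \<open>P'\<close> also receives the whole action, against
  minimality.\<close>

lemma nilpotent_action_trivial:
  assumes red: "reductive_lie_algebra scale bracket" and fdg: "finite_dim scale UNIV"
    and center: "\<And>z v. (\<And>y. bracket z y = 0) \<Longrightarrow> v \<in> M \<Longrightarrow> \<rho> z v = 0"
    and C: "submodule C" and fdC: "finite_dim scaleV C"
    and nil: "\<And>x. V.gen_eig C (\<rho> x) 0 = C"
    and a: "a \<in> M" "\<And>x. \<rho> x a \<in> C"
  shows "\<rho> x a = 0"
proof -
  interpret C: lie_module scale bracket scaleV C \<rho> by (rule submodule_lie_module[OF C])
  have nilC: "\<exists>N. \<forall>v\<in>C. (\<rho> x ^^ N) v = 0" for x
    using V.nilpotent_uniform[OF fdC submodule_endo[OF C] nil] by metis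
  have CM: "C \<subseteq> M" using C by (simp add: submodule_def)
  define good where "good P \<longleftrightarrow> submodule P \<and> P \<subseteq> C \<and> (\<forall>b. b \<in> insert a C \<longrightarrow> (\<forall>x. \<rho> x b \<in> P))" for P
  have "good C" using C a by (auto simp: good_def submodule_def)
  then obtain P where P: "good P" "\<And>P'. good P' \<Longrightarrow> V.dim P \<le> V.dim P'"
    using ex_has_least_nat[of good C V.dim] by blast
  have Psub: "submodule P" "P \<subseteq> C" using P by (auto simp: good_def)
  have fdP: "finite_dim scaleV P"
    using V.finite_dim_mono(1)[OF fdC] Psub by (simp add: submodule_def)
  have "P = {0}"
  proof (rule ccontr)
    assume "P \<noteq> {0}"
    define small where "small P' \<longleftrightarrow> submodule P' \<and> P' \<subset> P" for P'
    have dim_less: "V.dim P' < V.dim P" if "small P'" for P'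
      using V.finite_dim_mono(2)[OF fdP] that by (auto simp: small_def submodule_def)
    have "0 \<in> P" using Psub V.subspace_0 by (auto simp: submodule_def)
    then have "small {0}"
      using \<open>P \<noteq> {0}\<close> V.subspace_0[OF subspace_carrier]
      by (auto simp: small_def submodule_def act_zero_right V.subspace_single_0)
    \<comment> \<open>Maximality makes one vector suffice: Engel's theorem gives a vector of
      \<open>P\<close> outside \<open>P'\<close> that is moved into \<open>P'\<close>, and together
      with \<open>P'\<close> it spans \<open>P\<close>.\<close>
    then obtain P' where P': "small P'" "\<And>P''. small P'' \<Longrightarrow> V.dim P'' \<le> V.dim P'"
      using ex_has_greatest_nat[of small "{0}" V.dim "V.dim P"] dim_less by blast
    have sP': "submodule P'" "P' \<subset> P" "V.subspace P'" using P'(1) by (auto simp: small_def submodule_def)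
    have "\<exists>v\<in>P - P'. \<forall>x. \<rho> x v \<in> P'"
      by (rule C.engel[OF fdg nilC])
         (use sP' Psub in \<open>auto simp: C.submodule_def submodule_def\<close>)
    then obtain v where v: "v \<in> P" "v \<notin> P'" "\<And>x. \<rho> x v \<in> P'" by blast
    have vM: "v \<in> M" using v Psub CM by blast
    let ?U = "V.span (insert v P')"
    have U: "submodule ?U" using submodule_insert[OF sP'(1) vM v(3)] .
    have "?U \<subseteq> P" using v sP' Psub by (intro V.span_minimal) (auto simp: submodule_def)
    moreover have "P' \<subset> ?U" using v by (auto intro: V.span_base)
    then have "V.dim P' < V.dim ?U"
      using V.finite_dim_mono[OF V.finite_dim_mono(1)[OF fdP V.subspace_span \<open>?U \<subseteq> P\<close>] sP'(3)] by auto
    ultimately have "?U = P" using P'(2)[of ?U] U by (auto simp: small_def)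
    have act_P: "\<rho> x w \<in> P'" if "w \<in> P" for x w
    proof -
      have "?U \<subseteq> {w \<in> M. \<rho> x w \<in> P'}"
      proof (rule V.span_minimal)
        show "insert v P' \<subseteq> {w \<in> M. \<rho> x w \<in> P'}" using v vM sP'(1) by (auto simp: submodule_def)
        show "V.subspace {w \<in> M. \<rho> x w \<in> P'}"
          using subspace_carrier sP'(3)
          by (auto simp: V.subspace_def act_zero_right act_add_right act_scale_right)
      qed
      then show ?thesis using that \<open>?U = P\<close> by blast
    qed
    have "\<rho> x b \<in> P'" if b: "b \<in> insert a C" for x b
    proof -
      have bM: "b \<in> M" using b a CM by blast
      have bP: "\<rho> x b \<in> P" for x using P(1) b by (auto simp: good_def)
      obtain s z where sz: "x = s + z" "s \<in> span {bracket y y' | y y'. True}" "\<And>y. bracket z y = 0"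
        using reductive_derived_center[OF red] by metis
      have "\<rho> s b \<in> P'"
        by (rule act_span_mem[OF bM sP'(3) sz(2)])
           (auto simp: act_bracket[OF bM] intro!: V.subspace_diff[OF sP'(3)] act_P[OF bP])
      then show ?thesis using center[OF sz(3) bM] by (simp add: sz(1) act_add_left[OF bM])
    qed
    then have "good P'" using sP' Psub by (auto simp: good_def)
    then show False using P(2) dim_less[OF P'(1)] by (meson leD)
  qed
  then show ?thesis using P(1) by (auto simp: good_def)
qed

section \<open>The Casimir operator of a trace form\<close>

text \<open>The radical \<open>r\<close> of the form is an ideal, and on a complementary ideal
  \<open>J\<close> the form is nondegenerate. \<open>\<Omega>\<close> is built from dual bases of
  \<open>J\<close>; it commutes with the whole Lie algebra because \<open>J\<close> is an ideal and
  the form is invariant. Its trace on \<open>C\<close> is the size of the basis, which is nonzero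
  since the form is. The third property lets \<open>\<Omega>\<close> move a vector that is invariant
  modulo \<open>C\<close> into \<open>C\<close>.\<close>

lemma casimir_exists:
  assumes red: "reductive_lie_algebra scale bracket" and fdg: "finite_dim scale UNIV"
    and C: "submodule C" and fdC: "finite_dim scaleV C"
    and nz: "V.trace C (\<lambda>v. \<rho> x0 (\<rho> y0 v)) \<noteq> 0"
  obtains \<Omega> where "V.endo M \<Omega>" "\<And>x v. v \<in> M \<Longrightarrow> \<Omega> (\<rho> x v) = \<rho> x (\<Omega> v)"
    "\<And>U v. submodule U \<Longrightarrow> v \<in> M \<Longrightarrow> (\<And>x. \<rho> x v \<in> U) \<Longrightarrow> \<Omega> v \<in> U" "V.trace C \<Omega> \<noteq> 0"
proof -
  define \<beta> where "\<beta> x y = V.trace C (\<lambda>v. \<rho> x (\<rho> y v))" for x y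
  have sC: "V.subspace C" and CM: "\<And>v. v \<in> C \<Longrightarrow> v \<in> M"
    using C by (auto simp: submodule_def)
  have e1: "V.endo C (\<rho> x)" for x by (rule submodule_endo[OF C])
  have e2: "V.endo C (\<lambda>v. \<rho> x (\<rho> y v))" for x y by (rule V.endo_comp[OF e1 e1])
  have e3: "V.endo C (\<lambda>v. \<rho> x (\<rho> y (\<rho> z v)))" for x y z by (rule V.endo_comp[OF e1 e2])
  have add: "\<beta> (x + y) z = \<beta> x z + \<beta> y z" for x y z
  proof -
    have "\<beta> (x + y) z = V.trace C (\<lambda>v. \<rho> x (\<rho> z v) + \<rho> y (\<rho> z v))"
      unfolding \<beta>_def
      by (rule V.trace_cong[OF fdC e2 V.endo_add[OF sC e2 e2]]) (simp add: act_add_left CM act_closed)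
    then show ?thesis unfolding \<beta>_def V.trace_add[OF fdC e2 e2] .
  qed
  have scl: "\<beta> (scale c x) z = c * \<beta> x z" for c x z
  proof -
    have "V.endo C (\<lambda>v. scaleV c (\<rho> x (\<rho> z v)))"
      using e2[of x z] V.subspace_scale[OF sC]
      by (auto simp: V.endo_def V.scale_right_distrib mult.commute)
    then have "\<beta> (scale c x) z = V.trace C (\<lambda>v. scaleV c (\<rho> x (\<rho> z v)))"
      unfolding \<beta>_def by (rule V.trace_cong[OF fdC e2]) (simp add: act_scale_left CM act_closed)
    then show ?thesis unfolding \<beta>_def V.trace_scale[OF fdC e2] .
  qed
  have sym: "\<beta> x y = \<beta> y x" for x y unfolding \<beta>_def by (rule V.trace_comm[OF fdC e1 e1])
  have bracket_trace: "V.trace C (\<lambda>v. \<rho> x (\<rho> y (\<rho> z v))) - V.trace C (\<lambda>v. \<rho> y (\<rho> x (\<rho> z v))) = \<beta> (bracket x y) z" for x y z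
    unfolding \<beta>_def V.trace_diff[OF fdC e3 e3, symmetric]
    by (rule V.trace_cong[OF fdC V.endo_sub[OF sC e3 e3] e2]) (simp add: act_bracket CM act_closed)
  \<comment> \<open>Invariance of a trace form is cyclicity of the trace.\<close>
  have inv: "\<beta> (bracket z x) y = - \<beta> x (bracket z y)" for x y z
  proof -
    have "V.trace C (\<lambda>v. \<rho> z (\<rho> x (\<rho> y v))) = V.trace C (\<lambda>v. \<rho> x (\<rho> y (\<rho> z v)))"
      by (rule V.trace_comm[OF fdC e1 e2])
    moreover have "V.trace C (\<lambda>v. \<rho> x (\<rho> z (\<rho> y v))) = V.trace C (\<lambda>v. \<rho> z (\<rho> y (\<rho> x v)))"
      by (rule V.trace_comm[OF fdC e1 e2])
    moreover have "V.trace C (\<lambda>v. \<rho> x (\<rho> y (\<rho> z v))) = V.trace C (\<lambda>v. \<rho> y (\<rho> z (\<rho> x v)))"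
      by (rule V.trace_comm[OF fdC e1 e2])
    ultimately show ?thesis
      using bracket_trace[of z x y] bracket_trace[of z y x] sym[of x "bracket z y"] by (metis minus_diff_eq)
  qed
  define r where "r = {x. \<forall>y. \<beta> x y = 0}"
  have "lie_ideal scale bracket r"
    unfolding lie_ideal_def r_def
    using scl[of 0 0] by (auto intro!: subspaceI simp: add scl inv)
  then obtain J where J: "lie_ideal scale bracket J" "r \<inter> J = {0}" "\<And>x. \<exists>a\<in>r. \<exists>b\<in>J. x = a + b"
    using red unfolding reductive_lie_algebra_def by blast
  have sJ: "subspace J" "\<And>x y. y \<in> J \<Longrightarrow> bracket x y \<in> J" using J(1) by (auto simp: lie_ideal_def)
  have nondeg: "x = 0" if "x \<in> J" "\<And>y. y \<in> J \<Longrightarrow> \<beta> x y = 0" for x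
  proof -
    have "\<beta> x y = 0" for y
    proof -
      obtain a b where ab: "a \<in> r" "b \<in> J" "y = a + b" using J(3) by blast
      have "\<beta> y x = \<beta> a x + \<beta> b x" unfolding ab(3) by (rule add)
      then show ?thesis using ab that(2)[of b] by (simp add: r_def sym[of x])
    qed
    then have "x \<in> r \<inter> J" using that by (simp add: r_def)
    then show ?thesis using J(2) by simp
  qed
  obtain E e' where E: "finite E" "E \<subseteq> J" "span E = J" and e': "\<And>e. e \<in> E \<Longrightarrow> e' e \<in> J"
    and dual: "\<And>e. e \<in> E \<Longrightarrow> \<beta> e (e' e) = 1"
    and exp1: "\<And>y. y \<in> J \<Longrightarrow> (\<Sum>e\<in>E. scale (\<beta> y (e' e)) e) = y"
    and exp2: "\<And>y. y \<in> J \<Longrightarrow> (\<Sum>e\<in>E. scale (\<beta> y e) (e' e)) = y"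
    by (rule dual_basis[of J \<beta>, OF finite_dim_mono(1)[OF fdg sJ(1) subset_UNIV] add scl sym nondeg])
       (assumption, blast, rule that, assumption+)
  define \<Omega> where "\<Omega> v = (\<Sum>e\<in>E. \<rho> e (\<rho> (e' e) v))" for v
  have endo: "V.endo M \<Omega>"
    unfolding \<Omega>_def[abs_def] by (intro V.endo_sum_fun subspace_carrier V.endo_comp[OF act_endo act_endo])
  have comm: "\<Omega> (\<rho> x v) = \<rho> x (\<Omega> v)" if v: "v \<in> M" for x v
  proof -
    define w where "w e = \<rho> (e' e) v" for e
    have w: "w e \<in> M" for e unfolding w_def by (rule act_closed[OF v])
    have A: "\<rho> (bracket x e) (w e) = (\<Sum>d\<in>E. scaleV (\<beta> (bracket x e) (e' d)) (\<rho> d (w e)))"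
      if "e \<in> E" for e
      unfolding act_lin_comb_left[OF w, symmetric] using exp1[OF sJ(2)] that E(2) by auto
    have B: "\<rho> e (\<rho> (bracket x (e' e)) v) = (\<Sum>d\<in>E. scaleV (\<beta> (bracket x (e' e)) d) (\<rho> e (w d)))"
      if "e \<in> E" for e
    proof -
      have "\<rho> (bracket x (e' e)) v = (\<Sum>d\<in>E. scaleV (\<beta> (bracket x (e' e)) d) (w d))"
        unfolding w_def act_lin_comb_left[OF v, symmetric] using exp2[OF sJ(2)[OF e'[OF that]]] by simp
      then show ?thesis
        using w V.subspace_scale[OF subspace_carrier]
        by (simp add: V.endo_sum[OF act_endo subspace_carrier] act_scale_right)
    qed
    have "\<rho> x (\<Omega> v) = (\<Sum>e\<in>E. \<rho> x (\<rho> e (w e)))"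
      unfolding \<Omega>_def w_def
      by (rule V.endo_sum[OF act_endo subspace_carrier]) (simp add: act_closed v)
    also have "\<dots> = (\<Sum>e\<in>E. \<rho> (bracket x e) (w e) + \<rho> e (\<rho> (bracket x (e' e)) v) + \<rho> e (\<rho> (e' e) (\<rho> x v)))"
    proof (rule sum.cong[OF refl])
      fix e
      have "\<rho> x (w e) = \<rho> (bracket x (e' e)) v + \<rho> (e' e) (\<rho> x v)"
        unfolding w_def by (simp add: act_bracket[OF v])
      then have "\<rho> e (\<rho> x (w e)) = \<rho> e (\<rho> (bracket x (e' e)) v) + \<rho> e (\<rho> (e' e) (\<rho> x v))"
        using v by (simp add: act_add_right act_closed)
      then show "\<rho> x (\<rho> e (w e)) =
          \<rho> (bracket x e) (w e) + \<rho> e (\<rho> (bracket x (e' e)) v) + \<rho> e (\<rho> (e' e) (\<rho> x v))"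
        using act_bracket[OF w[of e], of x e] by (simp add: algebra_simps)
    qed
    also have "\<dots> = (\<Sum>e\<in>E. \<rho> (bracket x e) (w e)) + (\<Sum>e\<in>E. \<rho> e (\<rho> (bracket x (e' e)) v)) + \<Omega> (\<rho> x v)"
      by (simp add: sum.distrib \<Omega>_def)
    \<comment> \<open>After the summation indices are exchanged, invariance of the form turns the
      coefficients into the negatives of those in \<open>A\<close>, so the two bracket sums
      cancel.\<close>
    also have "(\<Sum>e\<in>E. \<rho> e (\<rho> (bracket x (e' e)) v)) =
        (\<Sum>e\<in>E. \<Sum>d\<in>E. scaleV (\<beta> (bracket x (e' d)) e) (\<rho> d (w e)))"
      by (subst sum.swap) (simp add: B)
    also have "\<dots> = (\<Sum>e\<in>E. \<Sum>d\<in>E. - scaleV (\<beta> (bracket x e) (e' d)) (\<rho> d (w e)))"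
      by (intro sum.cong refl) (simp add: inv[of x _ "e' _"] sym[of "bracket x (e' _)"])
    also have "\<dots> = - (\<Sum>e\<in>E. \<rho> (bracket x e) (w e))"
      by (simp add: A sum_negf)
    finally show ?thesis by simp
  qed
  have closed: "\<Omega> v \<in> U" if "submodule U" "v \<in> M" "\<And>x. \<rho> x v \<in> U" for U v
    unfolding \<Omega>_def using that by (intro V.subspace_sum) (auto simp: submodule_def)
  have "V.trace C \<Omega> = (\<Sum>e\<in>E. \<beta> e (e' e))"
    unfolding \<Omega>_def[abs_def] \<beta>_def by (rule V.trace_sum[OF fdC E(1) e2])
  also have "\<dots> = of_nat (card E)" using dual by simp
  finally have tr: "V.trace C \<Omega> = of_nat (card E)" .
  have "E \<noteq> {}"
  proof
    assume "E = {}"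
    then have "J = {0}" using E(3) by simp
    then have "x0 \<in> r" using J(3)[of x0] by auto
    then show False using nz by (simp add: r_def \<beta>_def)
  qed
  then have "V.trace C \<Omega> \<noteq> 0" using tr E(1) by simp
  then show ?thesis using that endo comm closed by blast
qed

text \<open>This is the part of Weyl's theorem that is needed: it makes invariants lift along a surjection
  with kernel \<open>C\<close>. The Casimir operator of the trace form of \<open>C\<close> splits off the part of \<open>C\<close> on which it is
  invertible; if that part is zero, its trace vanishes, and so does the whole form.\<close>

theorem invariant_lift:
  assumes red: "reductive_lie_algebra scale bracket" and fdg: "finite_dim scale UNIV"
    and center: "\<And>z v. (\<And>y. bracket z y = 0) \<Longrightarrow> v \<in> M \<Longrightarrow> \<rho> z v = 0"
    and "submodule C" and "finite_dim scaleV C" and "a \<in> M" and "\<And>x. \<rho> x a \<in> C"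
  shows "\<exists>c\<in>C. \<forall>x. \<rho> x (a - c) = 0"
  using assms(4-7)
proof (induction "V.dim C" arbitrary: C a rule: less_induct)
  case less
  note C = less.prems(1) and fdC = less.prems(2) and a = less.prems(3,4)
  have CM: "\<And>v. v \<in> C \<Longrightarrow> v \<in> M" and sC: "V.subspace C" using C by (auto simp: submodule_def)
  interpret C: lie_module scale bracket scaleV C \<rho> by (rule submodule_lie_module[OF C])
  show ?case
  proof (cases "\<forall>x y. V.trace C (\<lambda>v. \<rho> x (\<rho> y v)) = 0")
    case True
    have nil: "V.gen_eig C (\<rho> x) 0 = C" for x
      by (rule C.cartan_nilpotent[OF red fdg fdC]) (use True center CM in auto)
    have "\<rho> x a = 0" for x
      by (rule nilpotent_action_trivial[OF red fdg center C fdC nil a])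
    then show ?thesis using V.subspace_0[OF sC] by (intro bexI[of _ 0]) auto
  next
    case False
    then obtain x0 y0 where "V.trace C (\<lambda>v. \<rho> x0 (\<rho> y0 v)) \<noteq> 0" by blast
    then obtain \<Omega> where \<Omega>: "V.endo M \<Omega>" "\<And>x v. v \<in> M \<Longrightarrow> \<Omega> (\<rho> x v) = \<rho> x (\<Omega> v)"
      "\<And>U v. submodule U \<Longrightarrow> v \<in> M \<Longrightarrow> (\<And>x. \<rho> x v \<in> U) \<Longrightarrow> \<Omega> v \<in> U" "V.trace C \<Omega> \<noteq> 0"
      using casimir_exists[OF red fdg C fdC] by metis
    have \<Omega>C: "V.endo C \<Omega>"
      by (rule V.endo_restrict[OF \<Omega>(1)]) (use CM C in \<open>auto intro!: \<Omega>(3)[OF C] simp: submodule_def\<close>)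
    let ?C0 = "V.gen_eig C \<Omega> 0"
    have "\<Omega> a \<in> C" by (rule \<Omega>(3)[OF C a])
    \<comment> \<open>In the Fitting decomposition of \<open>C\<close> under
      \<open>\<Omega>\<close>, the vector \<open>w\<close> accounts for the part of
      \<open>\<Omega> a\<close> on which \<open>\<Omega>\<close> is invertible.\<close>
    then obtain w where w: "w \<in> C" "\<Omega> a - \<Omega> w \<in> ?C0"
      using V.gen_eig_sum_solve[OF \<Omega>C sC, of "\<Omega> a" 0] unfolding V.gen_eig_sum_eq[OF fdC \<Omega>C] by auto
    have aw: "a - w \<in> M" using a(1) CM[OF w(1)] V.subspace_diff[OF subspace_carrier] by blast
    have s0: "V.subspace ?C0" by (rule V.subspace_gen_eig[OF \<Omega>C sC])
    have stable0: "\<rho> x v \<in> ?C0" if "v \<in> ?C0" for x v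
      by (rule V.gen_eig_commuting[OF \<Omega>C sC C.act_endo _ that]) (simp add: \<Omega>(2) CM)
    have C0: "submodule ?C0" "?C0 \<subseteq> C"
      using s0 stable0 CM by (auto simp: submodule_def V.gen_eig_def)
    \<comment> \<open>\<open>\<Omega>\<close> sends this vector to
      \<open>\<rho> x (\<Omega> (a - w))\<close>, which lies in \<open>?C0\<close>; a vector of
      \<open>C\<close> whose image lies in \<open>?C0\<close> lies there itself.\<close>
    have "\<rho> x (a - w) \<in> ?C0" for x
    proof (rule V.gen_eig_step)
      show "\<rho> x (a - w) \<in> C"
        using V.endo_diff[OF act_endo subspace_carrier a(1) CM[OF w(1)]] a(2) C.act_closed[OF w(1)]
        by (simp add: V.subspace_diff[OF sC])
      have "\<rho> x (\<Omega> (a - w)) \<in> ?C0"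
        using V.endo_diff[OF \<Omega>(1) subspace_carrier a(1) CM[OF w(1)]] w(2) by (intro stable0) simp
      then show "\<Omega> (\<rho> x (a - w)) - scaleV 0 (\<rho> x (a - w)) \<in> ?C0" by (simp add: \<Omega>(2)[OF aw])
    qed
    moreover have "?C0 \<noteq> C" using V.trace_nilpotent[OF fdC \<Omega>C] \<Omega>(4) by blast
    ultimately obtain c where c: "c \<in> ?C0" "\<forall>x. \<rho> x (a - w - c) = 0"
      using less.hyps[of ?C0 "a - w"] V.finite_dim_mono[OF fdC s0 C0(2)] C0(1) aw by blast
    then show ?thesis
      using w C0(2) V.subspace_add[OF sC] by (intro bexI[of _ "w + c"]) (auto simp: diff_diff_eq)
  qed
qed

end

section \<open>The density theorem for irreducible algebras of operators\<close>

context complex_space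
begin

text \<open>If the operators that vanish on \<open>S - {e}\<close> also vanish at \<open>e\<close>, then for \<open>f \<in> S - {e}\<close> the assignment
  \<open>r f \<mapsto> r e\<close>, with \<open>r\<close> vanishing on \<open>S - {e, f}\<close>, is a well-defined map that commutes with \<open>R\<close>. By Schur it
  is a scalar \<open>c\<close>, and the smaller independent set in which \<open>e - c f\<close> replaces \<open>e\<close> and \<open>f\<close> contradicts
  the induction hypothesis.\<close>

lemma density:
  assumes V: "finite_dim scale V"
    and R_endo: "\<And>r. r \<in> R \<Longrightarrow> endo V r" and R_id: "(\<lambda>v. v) \<in> R"
    and R_comp: "\<And>r s. r \<in> R \<Longrightarrow> s \<in> R \<Longrightarrow> (\<lambda>v. r (s v)) \<in> R"
    and R_lin: "\<And>r s c. r \<in> R \<Longrightarrow> s \<in> R \<Longrightarrow> (\<lambda>v. r v - scale c (s v)) \<in> R"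
    and irr: "\<And>N. subspace N \<Longrightarrow> N \<subseteq> V \<Longrightarrow> (\<And>r v. r \<in> R \<Longrightarrow> v \<in> N \<Longrightarrow> r v \<in> N) \<Longrightarrow> N = {0} \<or> N = V"
    and "finite S" "S \<subseteq> V" "independent S" "e \<in> S" "w \<in> V"
  shows "\<exists>r\<in>R. r e = w \<and> (\<forall>e'\<in>S - {e}. r e' = 0)"
  using assms(7-11)
proof (induction "card S" arbitrary: S e w rule: less_induct)
  case less
  note S = less.prems(1-4) and w = less.prems(5)
  have sV: "subspace V" by (rule finite_dim_subspace[OF V])
  have R_zero: "(\<lambda>v. 0) \<in> R" using R_lin[OF R_id R_id, of 1] by simp
  have R_add: "(\<lambda>v. r v + s v) \<in> R" if "r \<in> R" "s \<in> R" for r s using R_lin[OF that, of "-1"] by simp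
  have R_scale: "(\<lambda>v. scale c (r v)) \<in> R" if "r \<in> R" for r c using R_lin[OF R_zero that, of "-c"] by simp
  have R_in: "r v \<in> V" if "r \<in> R" "v \<in> V" for r v using endoD(1)[OF R_endo[OF that(1)] that(2)] .
  have R0: "r 0 = 0" if "r \<in> R" for r using endo_zero[OF R_endo[OF that] sV] .
  define Ann where "Ann X = {r \<in> R. \<forall>x\<in>X. r x = 0}" for X
  define S1 where "S1 = S - {e}"
  have eV: "e \<in> V" using S by blast
  have e_ni: "e \<notin> span S1" using S(3,4) by (auto simp: dependent_def S1_def)
  define N where "N = (\<lambda>r. r e) ` Ann S1"
  \<comment> \<open>The values at \<open>e\<close> of the operators that vanish on the other vectors
    form an \<open>R\<close>-stable subspace. If it is everything, the claim holds at once; the work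
    is to exclude zero.\<close>
  have "N = {0} \<or> N = V"
  proof (rule irr)
    show "subspace N"
    proof (rule subspaceI)
      show "0 \<in> N" using R_zero by (auto simp: N_def Ann_def intro: image_eqI[where x = "\<lambda>v. 0"])
    next
      fix x y assume "x \<in> N" "y \<in> N"
      then obtain r s where "r \<in> Ann S1" "s \<in> Ann S1" "x = r e" "y = s e" by (auto simp: N_def)
      then show "x + y \<in> N"
        using R_add[of r s] by (auto simp: N_def Ann_def intro: image_eqI[where x = "\<lambda>v. r v + s v"])
    next
      fix c x assume "x \<in> N"
      then obtain r where "r \<in> Ann S1" "x = r e" by (auto simp: N_def)
      then show "scale c x \<in> N"
        using R_scale[of r c] by (auto simp: N_def Ann_def intro: image_eqI[where x = "\<lambda>v. scale c (r v)"])
    qed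
    show "N \<subseteq> V" using R_in eV by (auto simp: N_def Ann_def)
    fix t v assume t: "t \<in> R" and "v \<in> N"
    then obtain r where "r \<in> Ann S1" "v = r e" by (auto simp: N_def)
    then show "t v \<in> N"
      using R_comp[OF t, of r] R0[OF t]
      by (auto simp: N_def Ann_def intro: image_eqI[where x = "\<lambda>v. t (r v)"])
  qed
  then show ?case
  proof
    assume "N = V"
    then show ?case using w by (auto simp: N_def Ann_def S1_def)
  next
    assume "N = {0}"
    then have kill: "r e = 0" if "r \<in> Ann S1" for r using that by (auto simp: N_def)
    have "e \<noteq> 0" using e_ni span_zero by auto
    have "S1 \<noteq> {}"
    proof
      assume "S1 = {}"
      then have "(\<lambda>v. v) \<in> Ann S1" using R_id by (simp add: Ann_def)
      then show False using kill \<open>e \<noteq> 0\<close> by fastforce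
    qed
    then obtain f where f: "f \<in> S1" by blast
    define S2 where "S2 = S1 - {f}"
    have S1: "finite S1" "S1 \<subseteq> V" "independent S1" "card S1 < card S"
      using S independent_mono[OF S(3), of "S - {e}"] card_Diff1_less[OF S(1,4)] unfolding S1_def by auto
    have fV: "f \<in> V" using f S1 by blast
    have "\<forall>v\<in>V. \<exists>r. r \<in> Ann S2 \<and> r f = v"
      using less.hyps[OF S1(4) S1(1-3) f] by (auto simp: Ann_def S2_def)
    then obtain q where q: "\<And>v. v \<in> V \<Longrightarrow> q v \<in> Ann S2" "\<And>v. v \<in> V \<Longrightarrow> q v f = v" by metis
    define h where "h v = q v e" for v
    have Ann_lin: "(\<lambda>v. r v - scale c (s v)) \<in> Ann S2" if "r \<in> Ann S2" "s \<in> Ann S2" for r s c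
      using that R_lin by (auto simp: Ann_def)
    have h: "h (r f) = r e" if r: "r \<in> Ann S2" for r
    proof -
      have rf: "r f \<in> V" using r R_in fV by (auto simp: Ann_def)
      let ?t = "\<lambda>v. r v - scale 1 (q (r f) v)"
      have "?t \<in> Ann S2" by (rule Ann_lin[OF r q(1)[OF rf]])
      moreover have "?t f = 0" using q(2)[OF rf] by simp
      ultimately have "?t \<in> Ann S1" by (auto simp: Ann_def S2_def)
      from kill[OF this] show ?thesis by (simp add: h_def)
    qed
    have qR: "q v \<in> R" if "v \<in> V" for v using q(1)[OF that] by (simp add: Ann_def)
    have h_lin: "h (v - scale c u) = h v - scale c (h u)" if "v \<in> V" "u \<in> V" for v u c
      using h[OF Ann_lin[OF q(1)[OF that(1)] q(1)[OF that(2)], of c]] q(2) that by (simp add: h_def)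
    have h_endo: "endo V h"
      unfolding endo_def
    proof (intro conjI ballI allI)
      fix v assume v: "v \<in> V"
      show "h v \<in> V" using R_in[OF qR[OF v] eV] by (simp add: h_def)
      have h0: "h 0 = 0" using h_lin[OF v v, of 1] by simp
      show "h (scale c v) = scale c (h v)" for c
        using h_lin[OF subspace_0[OF sV] v, of "-c"] h0 by simp
      fix u assume "u \<in> V"
      then show "h (v + u) = h v + h u" using h_lin[OF v, of u "-1"] by simp
    qed
    have "V \<noteq> {0}" using eV \<open>e \<noteq> 0\<close> by blast
    then obtain c u where u: "u \<in> V" "u \<noteq> 0" "h u = scale c u"
      using eigenvector_exists[OF V _ h_endo] by metis
    define K where "K = {v \<in> V. h v = scale c v}"
    have "K = {0} \<or> K = V"
    proof (rule irr)
      show "subspace K"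
        using sV endoD[OF h_endo] endo_zero[OF h_endo sV]
        by (auto simp: K_def subspace_def scale_right_distrib mult.commute)
      show "K \<subseteq> V" by (auto simp: K_def)
      fix t v assume t: "t \<in> R" and "v \<in> K"
      then have v: "v \<in> V" "h v = scale c v" by (auto simp: K_def)
      have "(\<lambda>x. t (q v x)) \<in> Ann S2"
        using q(1)[OF v(1)] R_comp[OF t] R0[OF t] by (auto simp: Ann_def)
      from h[OF this] have "h (t v) = t (h v)" by (simp add: q(2)[OF v(1)]) (simp add: h_def)
      then show "t v \<in> K" using v R_in[OF t v(1)] endoD(3)[OF R_endo[OF t] v(1)] by (simp add: K_def)
    qed
    then have "K = V" using u by (auto simp: K_def)
    then have scal: "r e = scale c (r f)" if "r \<in> Ann S2" for r
    proof -
      have "r f \<in> K" using that R_in fV \<open>K = V\<close> by (simp add: Ann_def)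
      then show ?thesis using h[OF that] by (simp add: K_def)
    qed
    let ?g = "e - scale c f"
    have g_ni: "?g \<notin> span S2"
    proof
      assume "?g \<in> span S2"
      then have "?g \<in> span S1" using span_mono[of S2 S1] by (auto simp: S2_def)
      then have "?g + scale c f \<in> span S1" by (rule span_add[OF _ span_scale[OF span_base[OF f]]])
      then show False using e_ni by simp
    qed
    have gV: "?g \<in> V" using eV fV by (intro subspace_diff subspace_scale sV)
    have T: "finite (insert ?g S2)" "insert ?g S2 \<subseteq> V" "independent (insert ?g S2)"
      using S1 gV independent_insertI[OF g_ni independent_mono[OF S1(3), of S2]] by (auto simp: S2_def)
    have "card (insert ?g S2) \<le> Suc (card S2)" by (rule card_insert_le_m1) auto
    also have "Suc (card S2) = card S1" unfolding S2_def by (rule card_Suc_Diff1[OF S1(1) f])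
    finally have "card (insert ?g S2) < card S" using S1(4) by simp
    from less.hyps[OF this T insertI1 gV] obtain r where
      r: "r \<in> R" "r ?g = ?g" "\<forall>x\<in>insert ?g S2 - {?g}. r x = 0" by blast
    have "?g \<notin> S2" using g_ni span_base by blast
    then have "r \<in> Ann S2" using r by (auto simp: Ann_def)
    then have "r e = scale c (r f)" by (rule scal)
    moreover have "r ?g = r e - scale c (r f)"
      using endo_diff[OF R_endo[OF r(1)] sV eV subspace_scale[OF sV fV]] endoD(3)[OF R_endo[OF r(1)] fV]
      by simp
    ultimately have "?g = 0" using r(2) by simp
    then show ?case using g_ni span_zero by metis
  qed
qed

end

section \<open>The adjoint action on the free algebra\<close>

definition free_scale :: "complex \<Rightarrow> 'a free_algebra \<Rightarrow> 'a free_algebra" where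
  "free_scale c f = free_const c * f"

definition word :: "'a list \<Rightarrow> 'a free_algebra" where
  "word w = Poly_Mapping.single (Word w) 1"

lemma single_eq_scale_word: "Poly_Mapping.single w c = free_scale c (word (letters w))"
  by (simp add: free_scale_def free_const_def word_def mult_single)

lemma free_const_mult: "free_const (c * d) = free_const c * free_const d"
  by (simp add: free_const_def mult_single)

lemma free_const_add: "free_const (c + d) = free_const c + free_const d"
  by (simp add: free_const_def single_add)

lemma free_const_one: "free_const 1 = 1"
  by (simp add: free_const_def)

lemma free_const_commute: "free_const c * f = f * free_const c"
  by (induction f rule: free_algebra_induct)
     (simp_all add: distrib_left distrib_right free_const_def mult_single mult.commute)

lemma free_vector_space: "vector_space free_scale"
  by unfold_locales
     (simp_all add: free_scale_def distrib_left distrib_right free_const_mult free_const_add free_const_one mult.assoc)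

interpretation F: complex_space free_scale
  by (intro complex_space.intro free_vector_space)

lemma free_scale_mult:
  shows "free_scale c f * g = free_scale c (f * g)" and "f * free_scale c g = free_scale c (f * g)"
  by (simp_all add: free_scale_def mult.assoc) (metis free_const_commute mult.assoc)

lemma word_Nil: "word [] = 1"
  by (simp add: word_def zero_free_monoid_def[symmetric])

lemma word_append: "word (u @ w) = word u * word w"
  by (simp add: word_def mult_single plus_free_monoid_def)

lemma free_gen_word: "free_gen x = word [x]"
  by (simp add: free_gen_def word_def)

lemma word_Cons: "word (x # w) = free_gen x * word w"
  using word_append[of "[x]" w] by (simp add: free_gen_word)

lemma free_algebra_word_induct [case_names add scale word]:
  assumes "\<And>f g. P f \<Longrightarrow> P g \<Longrightarrow> P (f + g)" and "\<And>c f. P f \<Longrightarrow> P (free_scale c f)" and "\<And>w. P (word w)"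
  shows "P f"
  by (induction f rule: free_algebra_induct) (simp_all add: assms single_eq_scale_word)

context lie_module
begin

lemma free_act_scale: "free_act scaleV \<rho> (free_scale c f) v = scaleV c (free_act scaleV \<rho> f v)"
proof (induction f rule: free_algebra_induct)
  case (add f g)
  then show ?case by (simp only: F.scale_right_distrib free_act_add V.scale_right_distrib)
qed (simp add: free_scale_def free_const_def mult_single free_act_single)

lemma free_act_scale_right: "v \<in> M \<Longrightarrow> free_act scaleV \<rho> f (scaleV c v) = scaleV c (free_act scaleV \<rho> f v)"
  using free_act_linear(2)[of v v] by simp

lemma free_act_zero_right: "free_act scaleV \<rho> f 0 = 0"
  using free_act_scale_right[OF V.subspace_0[OF subspace_carrier], of f 0] by simp

lemma free_act_word: "free_act scaleV \<rho> (word w) v = foldr \<rho> w v"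
  by (simp add: word_def free_act_single)

lemma free_act_gen: "free_act scaleV \<rho> (free_gen x) v = \<rho> x v"
  by (simp add: free_gen_word free_act_word)

end

lemma free_ring_simps [simp]:
  "carrier free_ring = UNIV" "mult free_ring = (*)" "one free_ring = 1" "zero free_ring = 0" "add free_ring = (+)"
  by (simp_all add: free_ring_def)

lemma uea_ideal_ideal: "ideal (uea_ideal scale bracket) free_ring"
proof -
  interpret R: ring "free_ring :: 'b free_algebra ring" by (rule free_ring_ring)
  show ?thesis unfolding uea_ideal_def by (rule R.genideal_ideal) simp
qed

lemma uea_ideal_relations: "uea_relations scale bracket \<subseteq> uea_ideal scale bracket"
proof -
  interpret R: ring "free_ring :: 'b free_algebra ring" by (rule free_ring_ring)
  show ?thesis unfolding uea_ideal_def by (rule R.genideal_self) simp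
qed

lemma uea_ideal_closed:
  shows uea_ideal_zero: "0 \<in> uea_ideal scale bracket"
    and uea_ideal_add: "f \<in> uea_ideal scale bracket \<Longrightarrow> g \<in> uea_ideal scale bracket \<Longrightarrow> f + g \<in> uea_ideal scale bracket"
    and uea_ideal_left: "f \<in> uea_ideal scale bracket \<Longrightarrow> h * f \<in> uea_ideal scale bracket"
    and uea_ideal_right: "f \<in> uea_ideal scale bracket \<Longrightarrow> f * h \<in> uea_ideal scale bracket"
proof -
  interpret I: ideal "uea_ideal scale bracket" free_ring by (rule uea_ideal_ideal)
  show "0 \<in> uea_ideal scale bracket" using additive_subgroup.zero_closed[OF I.additive_subgroup_axioms] by simp
  show "f \<in> uea_ideal scale bracket \<Longrightarrow> g \<in> uea_ideal scale bracket \<Longrightarrow> f + g \<in> uea_ideal scale bracket"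
    using additive_subgroup.a_closed[OF I.additive_subgroup_axioms] by simp
  show "f \<in> uea_ideal scale bracket \<Longrightarrow> h * f \<in> uea_ideal scale bracket" using I.I_l_closed by simp
  show "f \<in> uea_ideal scale bracket \<Longrightarrow> f * h \<in> uea_ideal scale bracket" using I.I_r_closed by simp
qed

lemma uea_ideal_subspace: "F.subspace (uea_ideal scale bracket)"
  by (auto intro!: F.subspaceI simp: uea_ideal_zero uea_ideal_add free_scale_def uea_ideal_left)

text \<open>\<open>p\<close> are the evaluation points, \<open>P\<close> the corresponding Lagrange polynomials and \<open>Bg\<close> is a basis
  of the Lie algebra. The words in the letters \<open>b \<otimes> P\<^sub>i\<close> span a model of the tensor powers of the
  adjoint module on which the Lie algebra acts by derivations.\<close>

locale lagrange_letters = lie_algebra scale bracket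
  for scale :: "complex \<Rightarrow> 'g::ab_group_add \<Rightarrow> 'g" and bracket +
  fixes Bg :: "'g set" and d :: nat and p :: "nat \<Rightarrow> complex" and P :: "nat \<Rightarrow> complex poly"
  assumes Bg: "finite Bg" "independent Bg" "span Bg = UNIV"
    and P: "i < d \<Longrightarrow> j < d \<Longrightarrow> poly (P i) (p j) = (if i = j then 1 else 0)"
begin

abbreviation "letter i b \<equiv> current_elem scale b (P i)"

text \<open>The normal form of the generator \<open>Y \<otimes> P i\<close> in finitely many
  letters. By \<open>expand_letter_cong\<close> both have the same class in the enveloping
  algebra.\<close>

definition expand_letter :: "nat \<Rightarrow> 'g \<Rightarrow> 'g poly free_algebra" where
  "expand_letter i Y = (\<Sum>b\<in>Bg. free_scale (representation Bg Y b) (free_gen (letter i b)))"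

text \<open>The commutator \<open>[x, b \<otimes> P\<^sub>i] = [x, b] \<otimes> P\<^sub>i\<close>, re-expanded in the letters. The coefficient of \<open>P\<^sub>i\<close> is
  recovered by evaluation at \<open>p\<^sub>i\<close>; polynomials outside the span of the letters are projected onto it.\<close>

definition letter_deriv :: "'g \<Rightarrow> 'g poly \<Rightarrow> 'g poly free_algebra" where
  "letter_deriv x X = (\<Sum>i<d. expand_letter i (bracket x (current_eval scale X (p i))))"

fun word_deriv :: "'g \<Rightarrow> 'g poly list \<Rightarrow> 'g poly free_algebra" where
  "word_deriv x [] = 0"
| "word_deriv x (X # w) = letter_deriv x X * word w + free_gen X * word_deriv x w"

definition deriv :: "'g \<Rightarrow> 'g poly free_algebra \<Rightarrow> 'g poly free_algebra" where
  "deriv x f = (\<Sum>w\<in>Poly_Mapping.keys f. free_scale (Poly_Mapping.lookup f w) (word_deriv x (letters w)))"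

lemma expand_letter_add: "expand_letter i (X + Y) = expand_letter i X + expand_letter i Y"
  using Bg by (simp add: expand_letter_def representation_add F.scale_left_distrib sum.distrib)

lemma expand_letter_scale: "expand_letter i (scale c X) = free_scale c (expand_letter i X)"
  using Bg by (simp add: expand_letter_def representation_scale F.scale_sum_right)

lemma expand_letter_zero: "expand_letter i 0 = 0"
  using expand_letter_scale[of i 0 0] by simp

lemma expand_letter_diff: "expand_letter i (X - Y) = expand_letter i X - expand_letter i Y"
  using expand_letter_add[of i "X - Y" Y] by simp

lemma expand_letter_sum: "expand_letter i (\<Sum>a\<in>A. scale (c a) (g a)) = (\<Sum>a\<in>A. free_scale (c a) (expand_letter i (g a)))"
  by (induction A rule: infinite_finite_induct)
     (simp_all add: expand_letter_zero expand_letter_add expand_letter_scale)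

lemma letter_deriv_letter:
  assumes "i < d"
  shows "letter_deriv x (letter i b) = expand_letter i (bracket x b)"
proof -
  have "letter_deriv x (letter i b) = (\<Sum>j<d. if j = i then expand_letter i (bracket x b) else 0)"
    unfolding letter_deriv_def using assms
    by (intro sum.cong) (auto simp: current_eval_elem P bracket_zero_right expand_letter_zero)
  then show ?thesis using assms by simp
qed

lemma letter_deriv_add: "letter_deriv (x + y) X = letter_deriv x X + letter_deriv y X"
  by (simp add: letter_deriv_def bracket_add_left expand_letter_add sum.distrib)

lemma letter_deriv_scale: "letter_deriv (scale c x) X = free_scale c (letter_deriv x X)"
  by (simp add: letter_deriv_def bracket_scale_left expand_letter_scale F.scale_sum_right)

lemma word_deriv_add: "word_deriv (x + y) w = word_deriv x w + word_deriv y w"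
  by (induction w) (simp_all add: letter_deriv_add algebra_simps)

lemma word_deriv_scale: "word_deriv (scale c x) w = free_scale c (word_deriv x w)"
  by (induction w) (simp_all add: letter_deriv_scale free_scale_mult F.scale_right_distrib)

lemma deriv_superset:
  assumes "finite A" "Poly_Mapping.keys f \<subseteq> A"
  shows "deriv x f = (\<Sum>w\<in>A. free_scale (Poly_Mapping.lookup f w) (word_deriv x (letters w)))"
  unfolding deriv_def using assms
  by (intro sum.mono_neutral_left) (auto simp: in_keys_iff)

lemma deriv_add: "deriv x (f + g) = deriv x f + deriv x g"
proof -
  let ?A = "Poly_Mapping.keys f \<union> Poly_Mapping.keys g"
  have "finite ?A" "Poly_Mapping.keys (f + g) \<subseteq> ?A" by (simp_all add: keys_add)
  then show ?thesis
    by (simp add: deriv_superset[of ?A] lookup_add F.scale_left_distrib sum.distrib)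
qed

lemma deriv_single: "deriv x (Poly_Mapping.single w c) = free_scale c (word_deriv x (letters w))"
  by (simp add: deriv_superset[of "{w}"])

lemma deriv_word: "deriv x (word w) = word_deriv x w"
  by (simp add: word_def deriv_single)

lemma deriv_scale: "deriv x (free_scale c f) = free_scale c (deriv x f)"
  by (induction f rule: free_algebra_induct)
     (simp_all add: F.scale_right_distrib deriv_add deriv_single single_eq_scale_word[symmetric],
      simp add: free_scale_def free_const_def mult_single deriv_single mult.assoc[symmetric])

lemma deriv_zero: "deriv x 0 = 0"
  by (simp add: deriv_def)

lemma deriv_sum: "deriv x (sum f A) = (\<Sum>a\<in>A. deriv x (f a))"
  by (induction A rule: infinite_finite_induct) (simp_all add: deriv_zero deriv_add)

lemma deriv_gen: "deriv x (free_gen X) = letter_deriv x X"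
  by (simp add: free_gen_word deriv_word word_Nil)

lemma deriv_mult: "deriv x (f * g) = deriv x f * g + f * deriv x g"
proof (induction f rule: free_algebra_word_induct)
  case (word u)
  show ?case
  proof (induction g rule: free_algebra_word_induct)
    case (word w)
    have "word_deriv x (u @ w) = word_deriv x u * word w + word u * word_deriv x w"
      by (induction u) (simp_all add: word_Nil word_Cons word_append algebra_simps)
    then show ?case by (simp add: word_append[symmetric] deriv_word)
  qed (simp_all add: algebra_simps deriv_add deriv_scale free_scale_mult F.scale_right_distrib)
qed (simp_all add: algebra_simps deriv_add deriv_scale free_scale_mult F.scale_right_distrib)

lemma deriv_expand_letter:
  assumes "i < d"
  shows "deriv x (expand_letter i Y) = expand_letter i (bracket x Y)"
proof -
  interpret ad: lie_module scale bracket scale UNIV bracket by (rule adjoint_lie_module)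
  have Y: "(\<Sum>b\<in>Bg. scale (representation Bg Y b) b) = Y" using Bg by (simp add: representation_expand)
  have "deriv x (expand_letter i Y) = (\<Sum>b\<in>Bg. free_scale (representation Bg Y b) (expand_letter i (bracket x b)))"
    by (simp add: expand_letter_def[of i Y] deriv_sum deriv_scale deriv_gen letter_deriv_letter assms)
  also have "\<dots> = expand_letter i (\<Sum>b\<in>Bg. scale (representation Bg Y b) (bracket x b))"
    by (rule expand_letter_sum[symmetric])
  also have "(\<Sum>b\<in>Bg. scale (representation Bg Y b) (bracket x b)) = bracket x Y"
    using endo_sum[OF ad.act_endo ad.subspace_carrier, of Bg "\<lambda>b. scale (representation Bg Y b) b" x]
    by (simp add: Y bracket_scale_right)
  finally show ?thesis .
qed

lemma deriv_letter_deriv: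
  "deriv x (letter_deriv y X) = (\<Sum>i<d. expand_letter i (bracket x (bracket y (current_eval scale X (p i)))))"
  by (simp add: letter_deriv_def deriv_sum deriv_expand_letter)

lemma letter_deriv_bracket:
  "letter_deriv (bracket x y) X = deriv x (letter_deriv y X) - deriv y (letter_deriv x X)"
proof -
  interpret ad: lie_module scale bracket scale UNIV bracket by (rule adjoint_lie_module)
  show ?thesis
    by (simp add: deriv_letter_deriv letter_deriv_def[of "bracket x y"] ad.act_bracket expand_letter_diff sum_subtractf)
qed

text \<open>Brackets are taken inside the Lie algebra before the result is expanded in letters, so
  the Jacobi identity holds exactly and not only modulo the ideal. This makes
  \<open>invariant_lift\<close> applicable to the free algebra.\<close>

lemma deriv_lie_module: "lie_module scale bracket free_scale UNIV deriv"
proof unfold_locales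
  fix x y f
  show "deriv (x + y) f = deriv x f + deriv y f"
    by (induction f rule: free_algebra_word_induct)
       (simp_all add: deriv_add deriv_scale F.scale_right_distrib deriv_word word_deriv_add)
  show "deriv (scale c x) f = free_scale c (deriv x f)" for c
    by (induction f rule: free_algebra_word_induct)
       (simp_all add: deriv_add deriv_scale F.scale_right_distrib deriv_word word_deriv_scale mult.commute)
  show "deriv (bracket x y) f = deriv x (deriv y f) - deriv y (deriv x f)"
  proof (induction f rule: free_algebra_word_induct)
    case (word w)
    show ?case
    proof (induction w)
      case Nil
      show ?case by (simp add: deriv_word deriv_zero)
    next
      case (Cons X w)
      show ?case
        unfolding word_Cons deriv_mult deriv_gen deriv_add letter_deriv_bracket Cons.IH
        by (simp add: algebra_simps)
    qed
  qed (simp_all add: deriv_add deriv_scale F.scale_right_diff_distrib)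
qed (simp_all add: deriv_add deriv_scale)

section \<open>Words of bounded length\<close>

definition letter_set :: "'g poly set" where
  "letter_set = (\<Union>i<d. letter i ` Bg)"

text \<open>The bound makes the space finite dimensional. It is stable under \<open>deriv\<close>,
  which replaces a letter by a combination of letters and so keeps the length.\<close>

definition words :: "nat \<Rightarrow> 'g poly free_algebra set" where
  "words n = F.span (word ` {w. set w \<subseteq> letter_set \<and> length w \<le> n})"

lemma finite_dim_words: "finite_dim free_scale (words n)"
  using finite_lists_length_le[of letter_set n] Bg(1)
  unfolding finite_dim_def words_def letter_set_def by blast

lemma words_mono: "m \<le> n \<Longrightarrow> words m \<subseteq> words n"
  unfolding words_def by (intro F.span_mono) auto

lemma words_word: "set w \<subseteq> letter_set \<Longrightarrow> length w \<le> n \<Longrightarrow> word w \<in> words n"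
  unfolding words_def by (intro F.span_base) auto

lemma subspace_words: "F.subspace (words n)"
  by (simp add: words_def)

lemma words_mult: "f \<in> words m \<Longrightarrow> g \<in> words n \<Longrightarrow> f * g \<in> words (m + n)"
proof -
  assume f: "f \<in> words m" and g: "g \<in> words n"
  have "word u * g \<in> words (m + n)" if u: "set u \<subseteq> letter_set" "length u \<le> m" for u
  proof -
    have uw: "word u * word w \<in> words (m + n)" if "set w \<subseteq> letter_set" "length w \<le> n" for w
      using words_word[of "u @ w" "m + n"] that u by (simp add: word_append)
    have "words n \<subseteq> {g. word u * g \<in> words (m + n)}"
      unfolding words_def[of n]
      using uw subspace_words[of "m + n"]
      by (intro F.span_minimal F.subspaceI)
         (auto simp: distrib_left free_scale_mult F.subspace_0 F.subspace_add F.subspace_scale)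
    then show ?thesis using g by blast
  qed
  then have "words m \<subseteq> {f. f * g \<in> words (m + n)}"
    unfolding words_def[of m]
    using subspace_words[of "m + n"]
    by (intro F.span_minimal F.subspaceI)
       (auto simp: distrib_right free_scale_mult F.subspace_0 F.subspace_add F.subspace_scale)
  then show ?thesis using f by blast
qed

lemma letter_mem: "i < d \<Longrightarrow> b \<in> Bg \<Longrightarrow> letter i b \<in> letter_set"
  by (auto simp: letter_set_def)

lemma expand_letter_words: "i < d \<Longrightarrow> expand_letter i Y \<in> words 1"
  unfolding expand_letter_def
  by (intro F.subspace_sum F.subspace_scale subspace_words)
     (auto simp: free_gen_word letter_mem intro!: words_word)

lemma letter_deriv_words: "letter_deriv x X \<in> words 1"
  unfolding letter_deriv_def by (intro F.subspace_sum subspace_words) (simp add: expand_letter_words del: One_nat_def)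

lemma deriv_words: "f \<in> words n \<Longrightarrow> deriv x f \<in> words n"
proof -
  have "set w \<subseteq> letter_set \<Longrightarrow> word_deriv x w \<in> words (length w)" for w
  proof (induction w)
    case (Cons X w)
    have "letter_deriv x X * word w \<in> words (1 + length w)"
      using Cons.prems by (intro words_mult letter_deriv_words words_word) auto
    moreover have "free_gen X * word_deriv x w \<in> words (1 + length w)"
      using Cons by (intro words_mult) (auto simp: free_gen_word intro!: words_word)
    ultimately show ?case using F.subspace_add[OF subspace_words] by simp
  qed (simp add: F.subspace_0[OF subspace_words])
  then have "set w \<subseteq> letter_set \<Longrightarrow> length w \<le> n \<Longrightarrow> word_deriv x w \<in> words n" for w
    using words_mono by blast
  then have "F.span (word ` {w. set w \<subseteq> letter_set \<and> length w \<le> n}) \<subseteq> {f. deriv x f \<in> words n}"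
    using subspace_words[of n]
    by (intro F.span_minimal F.subspaceI)
       (auto simp: deriv_word deriv_zero deriv_add deriv_scale F.subspace_0 F.subspace_add F.subspace_scale)
  then show "f \<in> words n \<Longrightarrow> deriv x f \<in> words n" unfolding words_def[of n, symmetric] by blast
qed

section \<open>Comparison with the universal enveloping algebra\<close>

abbreviation "uI \<equiv> uea_ideal (current_scale scale) (current_bracket bracket)"

lemma current_elem_lin_comb:
  "current_elem scale (\<Sum>a\<in>A. scale (c a) (g a)) Q = (\<Sum>a\<in>A. current_scale scale (c a) (current_elem scale (g a) Q))"
  by (rule poly_eqI)
     (simp add: coeff_current_elem coeff_sum coeff_current_scale scale_sum_right mult.commute)

lemma gen_sum_cong:
  "free_gen (\<Sum>a\<in>A. current_scale scale (c a) (X a)) - (\<Sum>a\<in>A. free_scale (c a) (free_gen (X a))) \<in> uI"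
proof -
  have add: "free_gen (X + Y) - free_gen X - free_gen Y \<in> uI" for X Y
    using uea_ideal_relations by (rule subsetD) (auto simp: uea_relations_def)
  have scl: "free_gen (current_scale scale c X) - free_scale c (free_gen X) \<in> uI" for c X
    unfolding free_scale_def using uea_ideal_relations by (rule subsetD) (auto simp: uea_relations_def)
  have sub: "F.subspace uI" by (rule uea_ideal_subspace)
  have zero: "free_gen 0 \<in> uI"
    using F.subspace_scale[OF sub add[of 0 0], of "-1"] by simp
  show ?thesis
  proof (induction A rule: infinite_finite_induct)
    case (insert a A)
    let ?Y = "\<Sum>a\<in>A. current_scale scale (c a) (X a)"
    have "(free_gen (current_scale scale (c a) (X a) + ?Y) - free_gen (current_scale scale (c a) (X a)) - free_gen ?Y)
       + (free_gen (current_scale scale (c a) (X a)) - free_scale (c a) (free_gen (X a)))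
       + (free_gen ?Y - (\<Sum>a\<in>A. free_scale (c a) (free_gen (X a)))) \<in> uI"
      by (intro uea_ideal_add add scl insert.IH)
    then show ?case using insert.hyps by (simp add: algebra_simps)
  qed (simp_all add: zero)
qed

lemma expand_letter_cong: "free_gen (letter i Y) - expand_letter i Y \<in> uI"
proof -
  have Y: "(\<Sum>b\<in>Bg. scale (representation Bg Y b) b) = Y" using Bg by (simp add: representation_expand)
  have "letter i Y = (\<Sum>b\<in>Bg. current_scale scale (representation Bg Y b) (letter i b))"
    by (subst current_elem_lin_comb[symmetric]) (simp only: Y)
  then show ?thesis using gen_sum_cong[of "representation Bg Y" "letter i" Bg] by (simp add: expand_letter_def)
qed

text \<open>Commutator and derivation both obey the Leibniz rule, so the comparison reduces to one
  letter, where \<open>[x, b \<otimes> P i] = [x, b] \<otimes> P i\<close>. Words in other elements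
  of the current algebra are excluded because \<open>letter_deriv\<close> projects those.\<close>

lemma deriv_cong_commutator:
  assumes "f \<in> words n"
  shows "free_gen (current_elem scale x 1) * f - f * free_gen (current_elem scale x 1) - deriv x f \<in> uI"
proof -
  let ?g = "free_gen (current_elem scale x 1)"
  have sub: "F.subspace uI" by (rule uea_ideal_subspace)
  let ?S = "{h. ?g * h - h * ?g - deriv x h \<in> uI}"
  have letter: "?g * free_gen X - free_gen X * ?g - letter_deriv x X \<in> uI" if X: "X \<in> letter_set" for X
  proof -
    obtain i b where ib: "i < d" "X = letter i b" using X by (auto simp: letter_set_def)
    have "?g * free_gen X - free_gen X * ?g - free_gen (current_bracket bracket (current_elem scale x 1) X) \<in> uI"
      using uea_ideal_relations by (rule subsetD) (auto simp: uea_relations_def)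
    moreover have "current_bracket bracket (current_elem scale x 1) X = letter i (bracket x b)"
      by (simp add: ib current_bracket_elem)
    ultimately have "(?g * free_gen X - free_gen X * ?g - free_gen (letter i (bracket x b))) +
        (free_gen (letter i (bracket x b)) - expand_letter i (bracket x b)) \<in> uI"
      by (intro uea_ideal_add expand_letter_cong) simp
    then show ?thesis by (simp add: ib letter_deriv_letter)
  qed
  have word: "?g * word w - word w * ?g - deriv x (word w) \<in> uI" if "set w \<subseteq> letter_set" for w
    using that
  proof (induction w)
    case Nil
    show ?case by (simp add: word_Nil uea_ideal_zero deriv_word[of x "[]", unfolded word_Nil])
  next
    case (Cons X w)
    have "(?g * free_gen X - free_gen X * ?g - letter_deriv x X) * word w +
        free_gen X * (?g * word w - word w * ?g - deriv x (word w)) \<in> uI"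
      using Cons by (intro uea_ideal_add uea_ideal_left uea_ideal_right letter) auto
    moreover have "(?g * free_gen X - free_gen X * ?g - letter_deriv x X) * word w +
        free_gen X * (?g * word w - word w * ?g - deriv x (word w)) =
        ?g * word (X # w) - word (X # w) * ?g - deriv x (word (X # w))"
      by (simp add: word_Cons deriv_mult deriv_gen algebra_simps)
    ultimately show ?case by simp
  qed
  have "words n \<subseteq> ?S"
    unfolding words_def
  proof (intro F.span_minimal F.subspaceI)
    fix f h assume "f \<in> ?S" "h \<in> ?S"
    then have "(?g * f - f * ?g - deriv x f) + (?g * h - h * ?g - deriv x h) \<in> uI"
      by (intro uea_ideal_add) auto
    then show "f + h \<in> ?S" by (simp add: deriv_add algebra_simps)
  next
    fix c f assume "f \<in> ?S"
    then have "free_scale c (?g * f - f * ?g - deriv x f) \<in> uI" by (intro F.subspace_scale[OF sub]) auto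
    then show "free_scale c f \<in> ?S"
      by (simp add: deriv_scale free_scale_mult F.scale_right_diff_distrib)
  qed (use word in \<open>auto simp: uea_ideal_zero deriv_zero\<close>)
  then show ?thesis using assms by blast
qed

text \<open>This supplies the hypothesis on central elements in
  \<open>invariant_lift\<close>.\<close>

lemma deriv_center:
  assumes "\<And>y. bracket z y = 0"
  shows "deriv z f = 0"
proof -
  have "letter_deriv z X = 0" for X by (simp add: letter_deriv_def assms expand_letter_zero)
  then have "word_deriv z w = 0" for w by (induction w) simp_all
  then show ?thesis by (simp add: deriv_def)
qed

lemma deriv_invariant_uea:
  assumes "f \<in> words n" and inv: "\<And>x. deriv x f = 0"
  shows "uI +>\<^bsub>free_ring\<^esub> f \<in> current_uea_invariants scale bracket"
proof -
  interpret I: ideal uI free_ring by (rule uea_ideal_ideal)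
  have eq: "uI +>\<^bsub>free_ring\<^esub> (f * free_gen (current_elem scale x 1)) = uI +>\<^bsub>free_ring\<^esub> (free_gen (current_elem scale x 1) * f)" for x
  proof -
    have "free_gen (current_elem scale x 1) * f - f * free_gen (current_elem scale x 1) \<in> uI"
      using deriv_cong_commutator[OF assms(1), of x] inv by simp
    then have "free_gen (current_elem scale x 1) * f \<in> uI +>\<^bsub>free_ring\<^esub> (f * free_gen (current_elem scale x 1))"
      by (auto simp: a_r_coset_def' intro!: bexI[of _ "free_gen (current_elem scale x 1) * f - f * free_gen (current_elem scale x 1)"])
    then show ?thesis by (intro I.a_repr_independence I.a_subgroup) simp_all
  qed
  show ?thesis
    unfolding current_uea_invariants_def Let_def
    by (auto simp: uea_def uea_gen_def FactRing_def A_RCOSETS_def' I.rcoset_mult_add eq)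
qed

end

lemma coset_contains_representative: "f \<in> uea_ideal scale bracket +>\<^bsub>free_ring\<^esub> f"
  by (auto simp: a_r_coset_def' intro!: bexI[of _ 0] uea_ideal_zero)

section \<open>Isotypic components\<close>

lemma lie_module_isomorphic_trans:
  assumes "lie_module_isomorphic s1 M1 r1 s2 M2 r2" "lie_module_isomorphic s2 M2 r2 s3 M3 r3"
  shows "lie_module_isomorphic s1 M1 r1 s3 M3 r3"
proof -
  obtain f where f: "bij_betw f M1 M2" "\<forall>v\<in>M1. \<forall>w\<in>M1. f (v + w) = f v + f w"
    "\<forall>c. \<forall>v\<in>M1. f (s1 c v) = s2 c (f v)" "\<forall>x. \<forall>v\<in>M1. f (r1 x v) = r2 x (f v)"
    using assms(1) unfolding lie_module_isomorphic_def by blast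
  obtain g where g: "bij_betw g M2 M3" "\<forall>v\<in>M2. \<forall>w\<in>M2. g (v + w) = g v + g w"
    "\<forall>c. \<forall>v\<in>M2. g (s2 c v) = s3 c (g v)" "\<forall>x. \<forall>v\<in>M2. g (r2 x v) = r3 x (g v)"
    using assms(2) unfolding lie_module_isomorphic_def by blast
  have mem: "f v \<in> M2" if "v \<in> M1" for v using f(1) that by (rule bij_betwE[rule_format])
  show ?thesis
    unfolding lie_module_isomorphic_def
  proof (intro exI[of _ "g \<circ> f"] conjI)
    show "bij_betw (g \<circ> f) M1 M3" using f(1) g(1) by (rule bij_betw_trans)
  qed (use f g mem in auto)
qed

lemma lie_module_isomorphic_sym:
  assumes iso: "lie_module_isomorphic s1 M1 r1 s2 M2 r2"
    and add: "\<And>v w. v \<in> M1 \<Longrightarrow> w \<in> M1 \<Longrightarrow> v + w \<in> M1" and scl: "\<And>c v. v \<in> M1 \<Longrightarrow> s1 c v \<in> M1"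
    and act: "\<And>x v. v \<in> M1 \<Longrightarrow> r1 x v \<in> M1"
  shows "lie_module_isomorphic s2 M2 r2 s1 M1 r1"
proof -
  obtain f where f: "bij_betw f M1 M2" "\<forall>v\<in>M1. \<forall>w\<in>M1. f (v + w) = f v + f w"
    "\<forall>c. \<forall>v\<in>M1. f (s1 c v) = s2 c (f v)" "\<forall>x. \<forall>v\<in>M1. f (r1 x v) = r2 x (f v)"
    using iso unfolding lie_module_isomorphic_def by blast
  define g where "g = inv_into M1 f"
  have g: "bij_betw g M2 M1" unfolding g_def by (rule bij_betw_inv_into[OF f(1)])
  have gM: "g v \<in> M1" if "v \<in> M2" for v using g that by (rule bij_betwE[rule_format])
  have fg: "f (g v) = v" if "v \<in> M2" for v unfolding g_def by (rule bij_betw_inv_into_right[OF f(1) that])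
  have gf: "g (f v) = v" if "v \<in> M1" for v unfolding g_def by (rule bij_betw_inv_into_left[OF f(1) that])
  show ?thesis
    unfolding lie_module_isomorphic_def
  proof (intro exI[of _ g] conjI g ballI allI)
    fix v assume v: "v \<in> M2"
    show "g (v + w) = g v + g w" if w: "w \<in> M2" for w
      using gf[OF add[OF gM[OF v] gM[OF w]]] f(2) gM v w by (simp add: fg)
    show "g (s2 c v) = s1 c (g v)" for c
      using gf[OF scl[OF gM[OF v]], of c] f(3) gM v by (simp add: fg)
    show "g (r2 x v) = r1 x (g v)" for x
      using gf[OF act[OF gM[OF v]], of x] f(4) gM v by (simp add: fg)
  qed
qed

context lie_module
begin

text \<open>The source is a submodule and the target all of \<open>M\<close>, which covers both
  projections and operators of \<open>M\<close> restricted to a submodule.\<close>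

definition equivariant :: "'v set \<Rightarrow> ('v \<Rightarrow> 'v) \<Rightarrow> bool" where
  "equivariant N f \<longleftrightarrow> (\<forall>v\<in>N. f v \<in> M) \<and> (\<forall>v\<in>N. \<forall>w\<in>N. f (v + w) = f v + f w) \<and>
     (\<forall>c. \<forall>v\<in>N. f (scaleV c v) = scaleV c (f v)) \<and> (\<forall>x. \<forall>v\<in>N. f (\<rho> x v) = \<rho> x (f v))"

lemma submoduleD:
  assumes "submodule N"
  shows "0 \<in> N" "v \<in> N \<Longrightarrow> w \<in> N \<Longrightarrow> v + w \<in> N" "v \<in> N \<Longrightarrow> w \<in> N \<Longrightarrow> v - w \<in> N"
    "v \<in> N \<Longrightarrow> scaleV c v \<in> N" "v \<in> N \<Longrightarrow> \<rho> x v \<in> N" "v \<in> N \<Longrightarrow> v \<in> M" "V.subspace N"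
  using assms
  by (auto simp: submodule_def V.subspace_0 V.subspace_add V.subspace_diff V.subspace_scale)

lemma submoduleI:
  assumes "0 \<in> N" "\<And>v w. v \<in> N \<Longrightarrow> w \<in> N \<Longrightarrow> v + w \<in> N" "\<And>c v. v \<in> N \<Longrightarrow> scaleV c v \<in> N"
    "\<And>x v. v \<in> N \<Longrightarrow> \<rho> x v \<in> N" "\<And>v. v \<in> N \<Longrightarrow> v \<in> M"
  shows "submodule N"
  using assms by (auto simp: submodule_def intro!: V.subspaceI)

lemma equivariant_zero: "equivariant N f \<Longrightarrow> submodule N \<Longrightarrow> f 0 = 0"
  using submoduleD(1)[of N] V.scale_zero_left unfolding equivariant_def by metis

lemma equivariant_diff:
  assumes f: "equivariant N f" and N: "submodule N" and v: "v \<in> N" "w \<in> N"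
  shows "f (v - w) = f v - f w"
proof -
  have "f ((v - w) + w) = f (v - w) + f w"
    using f v submoduleD(3)[OF N v] unfolding equivariant_def by blast
  then show ?thesis by simp
qed

lemma equivariant_image: 
  assumes f: "equivariant N f" and N: "submodule N"
  shows "submodule (f ` N)"
proof (rule submoduleI)
  show "0 \<in> f ` N" using equivariant_zero[OF f N] submoduleD(1)[OF N] by (metis imageI)
next
  fix v w assume "v \<in> f ` N" "w \<in> f ` N"
  then obtain a b where ab: "a \<in> N" "b \<in> N" "v = f a" "w = f b" by blast
  then have "v + w = f (a + b)" using f by (simp add: equivariant_def)
  then show "v + w \<in> f ` N" using submoduleD(2)[OF N ab(1,2)] by (rule image_eqI)
next
  fix c v assume "v \<in> f ` N"
  then obtain a where a: "a \<in> N" "v = f a" by blast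
  then have "scaleV c v = f (scaleV c a)" using f by (simp add: equivariant_def)
  then show "scaleV c v \<in> f ` N" using submoduleD(4)[OF N a(1)] by (rule image_eqI)
next
  fix x v assume "v \<in> f ` N"
  then obtain a where a: "a \<in> N" "v = f a" by blast
  then have "\<rho> x v = f (\<rho> x a)" using f by (simp add: equivariant_def)
  then show "\<rho> x v \<in> f ` N" using submoduleD(5)[OF N a(1)] by (rule image_eqI)
qed (use f in \<open>auto simp: equivariant_def\<close>)

lemma equivariant_kernel:
  assumes f: "equivariant N f" and N: "submodule N"
  shows "submodule {v \<in> N. f v = 0}"
  by (rule submoduleI)
     (use f submoduleD[OF N] equivariant_zero[OF f N] act_zero_right in \<open>auto simp: equivariant_def\<close>)

lemma submodule_invariant:
  "submodule N \<Longrightarrow> invariant_subspace scaleV (range \<rho>) N"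
  by (auto simp: submodule_def invariant_subspace_def)

lemma submodule_iff: "submodule N \<longleftrightarrow> N \<subseteq> M \<and> invariant_subspace scaleV (range \<rho>) N"
  by (auto simp: submodule_def invariant_subspace_def)

lemma equivariant_iso:
  assumes f: "equivariant N f" and N: "submodule N" and ker: "\<And>v. v \<in> N \<Longrightarrow> f v = 0 \<Longrightarrow> v = 0"
  shows "lie_module_isomorphic scaleV N \<rho> scaleV (f ` N) \<rho>"
proof -
  have "inj_on f N"
  proof (rule inj_onI)
    fix v w assume "v \<in> N" "w \<in> N" "f v = f w"
    then show "v = w" using ker[of "v - w"] equivariant_diff[OF f N] submoduleD(3)[OF N] by auto
  qed
  then show ?thesis
    using f unfolding lie_module_isomorphic_def equivariant_def
    by (intro exI[of _ f] conjI) (auto simp: bij_betw_def)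
qed

text \<open>The half of Schur's lemma that concerns the source: the kernel is zero or
  everything.\<close>

lemma equivariant_simple:
  assumes f: "equivariant N f" and N: "submodule N" and irr: "irreducible_under scaleV (range \<rho>) N"
  shows "(\<forall>v\<in>N. f v = 0) \<or> lie_module_isomorphic scaleV N \<rho> scaleV (f ` N) \<rho>"
proof -
  have "{v \<in> N. f v = 0} = {0} \<or> {v \<in> N. f v = 0} = N"
    using irr submodule_invariant[OF equivariant_kernel[OF f N]] unfolding irreducible_under_def by blast
  then show ?thesis using equivariant_iso[OF f N] by blast
qed

end

lemma irreducible_iso:
  assumes N: "lie_module scale bracket scaleV N \<rho>" and S: "lie_module scale bracket scaleS S \<sigma>"
    and iso: "lie_module_isomorphic scaleV N \<rho> scaleS S \<sigma>"
    and irr: "irreducible_under scaleS (range \<sigma>) S"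
  shows "irreducible_under scaleV (range \<rho>) N"
proof -
  interpret N: lie_module scale bracket scaleV N \<rho> by (rule N)
  interpret S: lie_module scale bracket scaleS S \<sigma> by (rule S)
  obtain f where f: "bij_betw f N S" "\<forall>v\<in>N. \<forall>w\<in>N. f (v + w) = f v + f w"
    "\<forall>c. \<forall>v\<in>N. f (scaleV c v) = scaleS c (f v)" "\<forall>x. \<forall>v\<in>N. f (\<rho> x v) = \<sigma> x (f v)"
    using iso unfolding lie_module_isomorphic_def by blast
  have N0: "0 \<in> N" using N.V.subspace_0[OF N.subspace_carrier] .
  have f0: "f 0 = 0" using f(3) N0 N.V.scale_zero_left S.V.scale_zero_left by metis
  have inj: "inj_on f N" and img: "f ` N = S" using f(1) by (auto simp: bij_betw_def)
  show ?thesis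
    unfolding irreducible_under_def
  proof (intro conjI allI impI)
    show "invariant_subspace scaleV (range \<rho>) N"
      by (auto simp: invariant_subspace_def N.subspace_carrier N.act_closed)
    show "N \<noteq> {0}" using irr img f0 by (auto simp: irreducible_under_def)
    fix K assume K: "invariant_subspace scaleV (range \<rho>) K \<and> K \<subseteq> N"
    then have sK: "N.V.subspace K" and stK: "\<And>x v. v \<in> K \<Longrightarrow> \<rho> x v \<in> K" and KN: "\<And>v. v \<in> K \<Longrightarrow> v \<in> N"
      by (auto simp: invariant_subspace_def)
    have "S.submodule (f ` K)"
    proof (rule S.submoduleI)
      show "0 \<in> f ` K" using f0 N.V.subspace_0[OF sK] by (metis imageI)
    next
      fix v w assume "v \<in> f ` K" "w \<in> f ` K"
      then obtain a b where ab: "a \<in> K" "b \<in> K" "v = f a" "w = f b" by blast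
      then have "v + w = f (a + b)" using f(2) KN by simp
      then show "v + w \<in> f ` K" using N.V.subspace_add[OF sK ab(1,2)] by (rule image_eqI)
    next
      fix c v assume "v \<in> f ` K"
      then obtain a where a: "a \<in> K" "v = f a" by blast
      then have "scaleS c v = f (scaleV c a)" using f(3) KN by simp
      then show "scaleS c v \<in> f ` K" using N.V.subspace_scale[OF sK a(1)] by (rule image_eqI)
    next
      fix x v assume "v \<in> f ` K"
      then obtain a where a: "a \<in> K" "v = f a" by blast
      then have "\<sigma> x v = f (\<rho> x a)" using f(4) KN by simp
      then show "\<sigma> x v \<in> f ` K" using stK[OF a(1)] by (rule image_eqI)
    next
      fix v assume "v \<in> f ` K" then show "v \<in> S" using img KN by blast
    qed
    then have "f ` K = {0} \<or> f ` K = S"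
      using irr unfolding irreducible_under_def S.submodule_iff by blast
    then show "K = {0} \<or> K = N"
    proof
      assume "f ` K = S"
      then have "f ` K = f ` N" using img by simp
      then show ?thesis using inj_on_image_eq_iff[OF inj, of K N] K by blast
    next
      assume *: "f ` K = {0}"
      have "v = 0" if "v \<in> K" for v
      proof -
        have "f v = f 0" using * that f0 by auto
        then show ?thesis using inj KN[OF that] N0 by (auto dest: inj_onD)
      qed
      then show ?thesis using N.V.subspace_0[OF sK] by blast
    qed
  qed
qed

context lie_module
begin

text \<open>Let \<open>P\<close> be the sum of all members other than \<open>S\<close>. If
  \<open>N\<close> meets \<open>P\<close> only in zero, then \<open>S\<close> does too, for
  otherwise \<open>S\<close> would lie in \<open>P\<close> and add nothing to the sum. The part
  \<open>L\<close> of \<open>N\<close> in \<open>S + P\<close> then projects along \<open>P\<close>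
  into \<open>S\<close>, injectively because \<open>N\<close> avoids \<open>P\<close>, and onto
  because \<open>S\<close> is simple.\<close>

lemma isotypic_contains_simple:
  assumes fin: "finite \<F>"
    and simple: "\<And>S. S \<in> \<F> \<Longrightarrow> submodule S \<and> irreducible_under scaleV (range \<rho>) S"
    and N: "submodule N" and meet: "N \<inter> V.span (\<Union>\<F>) \<noteq> {0}"
  shows "\<exists>S\<in>\<F>. \<exists>L. L \<subseteq> N \<and> submodule L \<and> lie_module_isomorphic scaleV L \<rho> scaleV S \<rho>"
  using fin simple meet
proof (induction \<F> rule: finite_induct)
  case empty
  then show ?case using submoduleD(1)[OF N] by auto
next
  case (insert S \<F>)
  define P where "P = V.span (\<Union>\<F>)"
  let ?Q = "V.span (\<Union>(insert S \<F>))"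
  have S: "submodule S" "irreducible_under scaleV (range \<rho>) S" using insert.prems(1) by auto
  have sP: "V.subspace P" by (simp add: P_def)
  have PM: "P \<subseteq> M"
    unfolding P_def using insert.prems(1) by (intro V.span_minimal subspace_carrier) (auto simp: submodule_def)
  have P_act: "\<rho> x v \<in> P" if "v \<in> P" for x v
  proof -
    have "V.subspace {v \<in> M. \<rho> x v \<in> P}"
      using sP subspace_carrier
      by (auto simp: V.subspace_def act_zero_right act_add_right act_scale_right)
    moreover have "\<Union>\<F> \<subseteq> {v \<in> M. \<rho> x v \<in> P}"
      unfolding P_def using insert.prems(1) by (auto simp: submodule_def intro!: V.span_base)
    ultimately have "P \<subseteq> {v \<in> M. \<rho> x v \<in> P}" unfolding P_def by (intro V.span_minimal) auto
    then show ?thesis using that by blast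
  qed
  have P: "submodule P" using sP PM P_act by (auto simp: submodule_def)
  have sum: "?Q = {s + p | s p. s \<in> S \<and> p \<in> P}"
    unfolding P_def Union_insert V.span_Un by (simp add: V.span_eq_iff[THEN iffD2, OF submoduleD(7)[OF S(1)]])
  show ?case
  proof (cases "N \<inter> P = {0}")
    case False
    then show ?thesis using insert.IH insert.prems(1) unfolding P_def by blast
  next
    case True
    have "submodule (S \<inter> P)"
      using S(1) P by (auto simp: submodule_def V.subspace_inter)
    then have SP: "S \<inter> P = {0} \<or> S \<inter> P = S"
      using S(2) unfolding irreducible_under_def by (meson Int_lower1 submodule_invariant)
    have "S \<inter> P = {0}"
    proof (rule ccontr)
      assume "S \<inter> P \<noteq> {0}"
      then have "?Q \<subseteq> P"
        unfolding sum using SP V.subspace_add[OF sP] by blast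
      then have "N \<inter> ?Q \<subseteq> {0}" using True by blast
      moreover have "0 \<in> N \<inter> ?Q" using submoduleD(1)[OF N] V.span_zero by blast
      ultimately show False using insert.prems(2) by blast
    qed
    define L where "L = N \<inter> {s + p | s p. s \<in> S \<and> p \<in> P}"
    define f where "f v = (THE s. s \<in> S \<and> v - s \<in> P)" for v
    have uniq: "s = s'" if "s \<in> S" "v - s \<in> P" "s' \<in> S" "v - s' \<in> P" for s s' v
    proof -
      have "(v - s') - (v - s) \<in> P" by (rule V.subspace_diff[OF sP that(4,2)])
      then have "s - s' \<in> S \<inter> P" using submoduleD(3)[OF S(1) that(1,3)] by simp
      then show ?thesis using \<open>S \<inter> P = {0}\<close> by simp
    qed
    have f_eq: "f v = s" if "s \<in> S" "v - s \<in> P" for s v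
      unfolding f_def using that uniq by (intro the_equality) auto
    have f: "f v \<in> S" "v - f v \<in> P" if "v \<in> L" for v
    proof -
      obtain s p where "s \<in> S" "p \<in> P" "v = s + p" using \<open>v \<in> L\<close> unfolding L_def by blast
      then have "s \<in> S" "v - s \<in> P" by auto
      then show "f v \<in> S" "v - f v \<in> P" using f_eq[of s v] by auto
    qed
    have L: "submodule L"
      unfolding L_def sum[symmetric]
    proof (rule submoduleI)
      fix x v assume v: "v \<in> N \<inter> ?Q"
      then obtain s p where sp: "s \<in> S" "p \<in> P" "v = s + p" unfolding sum by blast
      then have "\<rho> x v = \<rho> x s + \<rho> x p" using submoduleD(6)[OF S(1)] submoduleD(6)[OF P] by (simp add: act_add_right)
      then have "\<rho> x v \<in> ?Q"
        unfolding sum using submoduleD(5)[OF S(1) sp(1)] P_act[OF sp(2)] by blast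
      then show "\<rho> x v \<in> N \<inter> ?Q" using v submoduleD(5)[OF N] by blast
    qed (use submoduleD[OF N] in \<open>auto intro: V.span_zero V.span_add V.span_scale\<close>)
    have e: "equivariant L f"
      unfolding equivariant_def
    proof (intro conjI ballI allI)
      fix v assume v: "v \<in> L"
      show "f v \<in> M" using f(1)[OF v] submoduleD(6)[OF S(1)] by blast
      show "f (v + w) = f v + f w" if w: "w \<in> L" for w
        using f[OF v] f[OF w] V.subspace_add[OF sP f(2)[OF v] f(2)[OF w]]
        by (intro f_eq submoduleD(2)[OF S(1)]) (simp_all add: add_diff_add)
      show "f (scaleV c v) = scaleV c (f v)" for c
        using f[OF v] V.subspace_scale[OF sP f(2)[OF v], of c]
        by (intro f_eq submoduleD(4)[OF S(1)]) (simp_all add: V.scale_right_diff_distrib)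
      show "f (\<rho> x v) = \<rho> x (f v)" for x
      proof (intro f_eq submoduleD(5)[OF S(1)] f(1)[OF v])
        have "\<rho> x (v - f v) \<in> P" by (rule P_act[OF f(2)[OF v]])
        then show "\<rho> x v - \<rho> x (f v) \<in> P"
          using V.endo_diff[OF act_endo subspace_carrier submoduleD(6)[OF L v] submoduleD(6)[OF S(1) f(1)[OF v]]]
          by simp
      qed
    qed
    have ker: "v = 0" if "v \<in> L" "f v = 0" for v
      using f(2)[OF that(1)] that True by (auto simp: L_def)
    have iso: "lie_module_isomorphic scaleV L \<rho> scaleV (f ` L) \<rho>"
      by (rule equivariant_iso[OF e L ker])
    have "f ` L = {0} \<or> f ` L = S"
      using S(2) equivariant_image[OF e L] f(1) unfolding irreducible_under_def submodule_iff by blast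
    moreover have "f ` L \<noteq> {0}"
    proof
      assume "f ` L = {0}"
      then have "L \<subseteq> {0}" using ker by blast
      then have "L = {0}" using submoduleD(1)[OF L] by blast
      then show False using insert.prems(2) unfolding L_def sum by blast
    qed
    ultimately have "f ` L = S" by blast
    then show ?thesis using iso L by (auto simp: L_def)
  qed
qed

end

section \<open>Evaluation modules\<close>

locale evaluation_setup =
  evaluation_data scale bracket d scaleV V \<rho> p + lagrange_letters scale bracket Bg d p P
  for scale :: "complex \<Rightarrow> 'g::ab_group_add \<Rightarrow> 'g" and bracket and d
    and scaleV :: "complex \<Rightarrow> 'v::ab_group_add \<Rightarrow> 'v" and V and \<rho> and p and Bg and P +
  assumes d_pos: "d \<ge> 1"
    and irreducible: "i < d \<Longrightarrow> irreducible_under scaleV (range (\<rho> i)) (V i)"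
    and finite_dimensional: "i < d \<Longrightarrow> finite_dim scaleV (V i)"
begin

sublocale VV: complex_space scaleV
proof -
  \<comment> \<open>The vector space laws of \<open>scaleV\<close> are read off from factor 0, which
    exists because \<open>d \<ge> 1\<close>.\<close>
  interpret I: lie_module scale bracket scaleV "V 0" "\<rho> 0" by (rule modules) (use d_pos in simp)
  show "complex_space scaleV" by (rule I.V.complex_space_axioms)
qed

abbreviation "T \<equiv> tensor_space scaleV d V"

sublocale T: lie_module "current_scale scale" "current_bracket bracket" tensor_scale T ev
  by (rule evaluation_lie_module)

abbreviation "act \<equiv> free_act tensor_scale ev"
abbreviation "tuples \<equiv> Pi\<^sub>E {..<d} V"

lemma pure_in: "v \<in> tuples \<Longrightarrow> pure v \<in> T"
  unfolding tensor_space_def by (rule T.V.span_base) auto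

lemma pure_add: "v \<in> tuples \<Longrightarrow> i < d \<Longrightarrow> x \<in> V i \<Longrightarrow> y \<in> V i \<Longrightarrow>
    pure (v(i := x + y)) = pure (v(i := x)) + pure (v(i := y))"
  by (rule multilinear_onD(1)[OF multilinear_on_pure_tensor])

lemma pure_scale: "v \<in> tuples \<Longrightarrow> i < d \<Longrightarrow> x \<in> V i \<Longrightarrow>
    pure (v(i := scaleV c x)) = tensor_scale c (pure (v(i := x)))"
  by (rule multilinear_onD(2)[OF multilinear_on_pure_tensor])

lemma subspace_V: "i < d \<Longrightarrow> VV.subspace (V i)"
  using finite_dimensional VV.finite_dim_subspace by blast

section \<open>Operators on a single tensor factor\<close>

text \<open>The algebra to which \<open>density\<close> is applied: the operators that polynomials
  in the letters induce on factor \<open>i\<close> while leaving the other factors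
  untouched.\<close>

definition slot_ops :: "nat \<Rightarrow> ('v \<Rightarrow> 'v) set" where
  "slot_ops i = {r. VV.endo (V i) r \<and>
     (\<exists>n. \<exists>f\<in>words n. \<forall>v\<in>tuples. act f (pure v) = pure (v(i := r (v i))))}"

lemma slot_opsE:
  assumes "r \<in> slot_ops i"
  obtains n f where "f \<in> words n" "\<And>v. v \<in> tuples \<Longrightarrow> act f (pure v) = pure (v(i := r (v i)))"
  using assms unfolding slot_ops_def by blast

lemma slot_opsI:
  assumes "VV.endo (V i) r" "f \<in> words n" "\<And>v. v \<in> tuples \<Longrightarrow> act f (pure v) = pure (v(i := r (v i)))"
  shows "r \<in> slot_ops i"
  using assms unfolding slot_ops_def by blast

lemma slot_ops_id: "i < d \<Longrightarrow> (\<lambda>v. v) \<in> slot_ops i"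
  by (rule slot_opsI[where f = "word []" and n = 0])
     (auto simp: VV.endo_def T.free_act_word intro!: words_word)

lemma slot_ops_comp:
  assumes i: "i < d" and r: "r \<in> slot_ops i" and s: "s \<in> slot_ops i"
  shows "(\<lambda>v. r (s v)) \<in> slot_ops i"
proof -
  obtain m f where f: "f \<in> words m" "\<And>v. v \<in> tuples \<Longrightarrow> act f (pure v) = pure (v(i := r (v i)))"
    using slot_opsE[OF r] by blast
  obtain n g where g: "g \<in> words n" "\<And>v. v \<in> tuples \<Longrightarrow> act g (pure v) = pure (v(i := s (v i)))"
    using slot_opsE[OF s] by blast
  have e: "VV.endo (V i) r" "VV.endo (V i) s" using r s by (auto simp: slot_ops_def)
  show ?thesis
  proof (rule slot_opsI[OF VV.endo_comp[OF e] words_mult[OF f(1) g(1)]])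
    fix v assume v: "v \<in> tuples"
    have "s (v i) \<in> V i" using VV.endoD(1)[OF e(2)] v i by auto
    then have "v(i := s (v i)) \<in> tuples" by (rule PiE_lessThan_upd[OF v i])
    then show "act (f * g) (pure v) = pure (v(i := r (s (v i))))"
      by (simp add: T.free_act_mult[OF pure_in[OF v]] g(2)[OF v] f(2))
  qed
qed

lemma slot_ops_lin:
  assumes i: "i < d" and r: "r \<in> slot_ops i" and s: "s \<in> slot_ops i"
  shows "(\<lambda>v. r v - scaleV c (s v)) \<in> slot_ops i"
proof -
  obtain m f where f: "f \<in> words m" "\<And>v. v \<in> tuples \<Longrightarrow> act f (pure v) = pure (v(i := r (v i)))"
    using slot_opsE[OF r] by blast
  obtain n g where g: "g \<in> words n" "\<And>v. v \<in> tuples \<Longrightarrow> act g (pure v) = pure (v(i := s (v i)))"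
    using slot_opsE[OF s] by blast
  have e: "VV.endo (V i) r" "VV.endo (V i) s" using r s by (auto simp: slot_ops_def)
  have fg: "f \<in> words (max m n)" "g \<in> words (max m n)"
    using f(1) g(1) words_mono[of m "max m n"] words_mono[of n "max m n"] by auto
  show ?thesis
  proof (rule slot_opsI[OF VV.endo_lin[OF subspace_V[OF i] e]])
    show "f - free_scale c g \<in> words (max m n)"
      by (rule F.subspace_diff[OF subspace_words fg(1) F.subspace_scale[OF subspace_words fg(2)]])
    fix v assume v: "v \<in> tuples"
    have V2: "r (v i) \<in> V i" "s (v i) \<in> V i"
      using VV.endoD(1)[OF e(1)] VV.endoD(1)[OF e(2)] v i by auto
    note V = V2 VV.subspace_scale[OF subspace_V[OF i] V2(2), of "-c"]
    have "pure (v(i := r (v i) - scaleV c (s (v i)))) = pure (v(i := r (v i) + scaleV (-c) (s (v i))))" by simp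
    also have "\<dots> = pure (v(i := r (v i))) + tensor_scale (-c) (pure (v(i := s (v i))))"
      by (simp only: pure_add[OF v i V(1,3)] pure_scale[OF v i V(2)])
    finally show "act (f - free_scale c g) (pure v) = pure (v(i := r (v i) - scaleV c (s (v i))))"
      by (simp add: T.free_act_diff T.free_act_scale f(2)[OF v] g(2)[OF v])
  qed
qed

lemma slot_ops_rho:
  assumes i: "i < d" and b: "b \<in> Bg"
  shows "\<rho> i b \<in> slot_ops i"
proof -
  interpret I: lie_module scale bracket scaleV "V i" "\<rho> i" by (rule modules[OF i])
  show ?thesis
  proof (rule slot_opsI[OF I.act_endo])
    show "free_gen (letter i b) \<in> words 1"
      using letter_mem[OF i b] by (auto simp: free_gen_word intro!: words_word)
    fix v assume v: "v \<in> tuples"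
    have "act (free_gen (letter i b)) (pure v) =
        (\<Sum>j<d. if j = i then pure (v(i := \<rho> i b (v i))) else 0)"
      unfolding T.free_act_gen evaluation_act_pure_tensor[OF v]
      by (intro sum.cong refl) (auto simp: P i)
    then show "act (free_gen (letter i b)) (pure v) = pure (v(i := \<rho> i b (v i)))" using i by simp
  qed
qed

text \<open>The letters only give the action of a basis of the Lie algebra; linearity of the action
  in the Lie algebra element extends stability to all of it.\<close>

lemma slot_ops_irreducible:
  assumes i: "i < d" and N: "VV.subspace N" "N \<subseteq> V i" "\<And>r v. r \<in> slot_ops i \<Longrightarrow> v \<in> N \<Longrightarrow> r v \<in> N"
  shows "N = {0} \<or> N = V i"
proof -
  interpret I: lie_module scale bracket scaleV "V i" "\<rho> i" by (rule modules[OF i])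
  have "\<rho> i x v \<in> N" if "v \<in> N" for x v
  proof (rule I.act_span_mem[of v N x Bg])
    show "x \<in> span Bg" using Bg by simp
  qed (use that N slot_ops_rho[OF i] in auto)
  then have "invariant_subspace scaleV (range (\<rho> i)) N" using N by (auto simp: invariant_subspace_def)
  then show ?thesis using irreducible[OF i] N(2) unfolding irreducible_under_def by blast
qed

section \<open>Matrix units on the tensor product\<close>

definition E :: "nat \<Rightarrow> 'v set" where
  "E i = (SOME B. finite B \<and> VV.independent B \<and> VV.span B = V i)"

lemma E:
  assumes "i < d"
  shows "finite (E i)" "VV.independent (E i)" "VV.span (E i) = V i" "E i \<subseteq> V i"
proof -
  have "\<exists>B. finite B \<and> VV.independent B \<and> VV.span B = V i"
    using VV.finite_dim_basis[OF finite_dimensional[OF assms]] by metis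
  from someI_ex[OF this] show "finite (E i)" "VV.independent (E i)" "VV.span (E i) = V i"
    unfolding E_def by auto
  then show "E i \<subseteq> V i" using VV.span_superset by metis
qed

abbreviation "rep i v b \<equiv> VV.representation (E i) v b"
abbreviation "multi \<equiv> Pi\<^sub>E {..<d} E"

lemma multi_tuples: "k \<in> multi \<Longrightarrow> k \<in> tuples"
  using E(4) by (auto simp: PiE_iff)

lemma finite_multi: "finite multi"
  by (rule finite_PiE) (simp_all add: E)

text \<open>Density yields an operator that sends the basis vector \<open>k\<close> to
  \<open>w\<close> and the other basis vectors to zero. On a general vector it reads off the
  coordinate at \<open>k\<close> and multiplies \<open>w\<close> by it.\<close>

lemma slot_unit:
  assumes i: "i < d" and k: "k \<in> E i" and w: "w \<in> V i"
  obtains n f where "f \<in> words n"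
    "\<And>v. v \<in> tuples \<Longrightarrow> act f (pure v) = tensor_scale (rep i (v i) k) (pure (v(i := w)))"
proof -
  have ex: "\<exists>r\<in>slot_ops i. r k = w \<and> (\<forall>e\<in>E i - {k}. r e = 0)"
  proof (rule VV.density[OF finite_dimensional[OF i]])
    show "VV.endo (V i) r" if "r \<in> slot_ops i" for r using that by (simp add: slot_ops_def)
    show "(\<lambda>v. v) \<in> slot_ops i" by (rule slot_ops_id[OF i])
    show "(\<lambda>v. r (s v)) \<in> slot_ops i" if "r \<in> slot_ops i" "s \<in> slot_ops i" for r s
      by (rule slot_ops_comp[OF i that])
    show "(\<lambda>v. r v - scaleV c (s v)) \<in> slot_ops i" if "r \<in> slot_ops i" "s \<in> slot_ops i" for r s c
      by (rule slot_ops_lin[OF i that])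
    show "N = {0} \<or> N = V i"
      if "VV.subspace N" "N \<subseteq> V i" "\<And>r v. r \<in> slot_ops i \<Longrightarrow> v \<in> N \<Longrightarrow> r v \<in> N" for N
      by (rule slot_ops_irreducible[OF i that(1,2)]) (rule that(3))
  qed (rule E(1)[OF i] E(4)[OF i] E(2)[OF i] k w)+
  obtain r where r: "r \<in> slot_ops i" "r k = w" "\<forall>e\<in>E i - {k}. r e = 0"
    using ex by blast
  obtain n f where f: "f \<in> words n" "\<And>v. v \<in> tuples \<Longrightarrow> act f (pure v) = pure (v(i := r (v i)))"
    using slot_opsE[OF r(1)] by blast
  have e: "VV.endo (V i) r" using r by (auto simp: slot_ops_def)
  have r_eq: "r u = scaleV (rep i u k) w" if u: "u \<in> V i" for u
  proof -
    have inV: "e \<in> V i" if "e \<in> E i" for e using that E(4)[OF i] by blast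
    have "r u = r (\<Sum>e\<in>E i. scaleV (rep i u e) e)"
      using u E[OF i] by (simp add: VV.representation_expand)
    also have "\<dots> = (\<Sum>e\<in>E i. scaleV (rep i u e) (r e))"
      by (subst VV.endo_sum[OF e subspace_V[OF i]])
         (auto intro!: sum.cong simp: VV.subspace_scale[OF subspace_V[OF i]] inV VV.endoD(3)[OF e])
    also have "\<dots> = (\<Sum>e\<in>E i. if e = k then scaleV (rep i u k) w else 0)"
      using r by (intro sum.cong) auto
    finally show ?thesis using E(1)[OF i] k by simp
  qed
  have "act f (pure v) = tensor_scale (rep i (v i) k) (pure (v(i := w)))" if v: "v \<in> tuples" for v
    using v i by (simp add: f(2) r_eq pure_scale[OF v i w] PiE_mem)
  then show ?thesis using that f(1) by blast
qed

text \<open>Rank one operators on the single factors multiply to a rank one operator on the tensor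
  product. Factors below \<open>j\<close> have been treated: they hold the entries of
  \<open>l\<close>, and their former entries survive in the scalar.\<close>

lemma matrix_unit_partial:
  assumes k: "k \<in> multi" and l: "l \<in> tuples"
  shows "j \<le> d \<Longrightarrow> \<exists>n. \<exists>f\<in>words n. \<forall>v\<in>tuples. act f (pure v) =
    tensor_scale (\<Prod>i<j. rep i (v i) (k i)) (pure (\<lambda>i. if i < j then l i else v i))"
proof (induction j)
  case 0
  show ?case
    by (intro exI[of _ 0] bexI[of _ "word []"]) (auto simp: T.free_act_word intro!: words_word)
next
  case (Suc j)
  then have j: "j < d" by simp
  obtain m f where f: "f \<in> words m" "\<And>v. v \<in> tuples \<Longrightarrow> act f (pure v) =
      tensor_scale (\<Prod>i<j. rep i (v i) (k i)) (pure (\<lambda>i. if i < j then l i else v i))"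
    using Suc by auto
  have kj: "k j \<in> E j" and lj: "l j \<in> V j" using k l j by auto
  obtain n g where g: "g \<in> words n"
    "\<And>v. v \<in> tuples \<Longrightarrow> act g (pure v) = tensor_scale (rep j (v j) (k j)) (pure (v(j := l j)))"
    using slot_unit[OF j kj lj] by blast
  have "act (g * f) (pure v) =
      tensor_scale (\<Prod>i<Suc j. rep i (v i) (k i)) (pure (\<lambda>i. if i < Suc j then l i else v i))"
    if v: "v \<in> tuples" for v
  proof -
    let ?u = "\<lambda>i. if i < j then l i else v i"
    have u: "?u \<in> tuples" using v l j by (auto simp: PiE_iff extensional_def)
    have upd: "?u(j := l j) = (\<lambda>i. if i < Suc j then l i else v i)" by (auto simp: fun_eq_iff less_Suc_eq)
    have "act (g * f) (pure v) = tensor_scale (\<Prod>i<j. rep i (v i) (k i)) (act g (pure ?u))"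
      by (simp only: T.free_act_mult[OF pure_in[OF v]] f(2)[OF v] T.free_act_linear(2)[OF pure_in[OF u] pure_in[OF u]])
    also have "act g (pure ?u) = tensor_scale (rep j (v j) (k j)) (pure (?u(j := l j)))"
      using g(2)[OF u] by simp
    finally show ?thesis unfolding upd by (simp add: mult.commute)
  qed
  then show ?case using words_mult[OF g(1) f(1)] by blast
qed

text \<open>Tensors are functionals on multilinear forms, so a coordinate is the value at one
  particular form, the product of the coordinates of the factors.\<close>

definition coord :: "(nat \<Rightarrow> 'v) \<Rightarrow> (((nat \<Rightarrow> 'v) \<Rightarrow> complex) \<Rightarrow> complex) \<Rightarrow> complex" where
  "coord k t = t (\<lambda>v. \<Prod>i<d. rep i (v i) (k i))"

lemma coord_add: "coord k (s + t) = coord k s + coord k t"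
  by (simp add: coord_def)

lemma coord_scale: "coord k (tensor_scale c t) = c * coord k t"
  by (simp add: coord_def tensor_scale_def)

lemma coord_form: "form (\<lambda>v. \<Prod>i<d. rep i (v i) (k i))"
  unfolding multilinear_on_def
proof (intro ballI allI impI conjI)
  fix v j assume v: "v \<in> tuples" and j: "j < d"
  have split: "(\<Prod>i<d. rep i ((v(j := x)) i) (k i)) = rep j x (k j) * (\<Prod>i\<in>{..<d} - {j}. rep i (v i) (k i))" for x
    using j by (subst prod.remove[of _ j]) (auto intro!: prod.cong)
  show "(\<Prod>i<d. rep i ((v(j := x + y)) i) (k i)) = (\<Prod>i<d. rep i ((v(j := x)) i) (k i)) + (\<Prod>i<d. rep i ((v(j := y)) i) (k i))"
    if "x \<in> V j" "y \<in> V j" for x y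
    unfolding split using that E[OF j] by (simp add: VV.representation_add distrib_right)
  show "(\<Prod>i<d. rep i ((v(j := scaleV c x)) i) (k i)) = c * (\<Prod>i<d. rep i ((v(j := x)) i) (k i))"
    if "x \<in> V j" for c x
    unfolding split using that E[OF j] by (simp add: VV.representation_scale mult.assoc)
qed

lemma coord_pure: "coord k (pure v) = (\<Prod>i<d. rep i (v i) (k i))"
  unfolding coord_def pure_tensor_def using coord_form[of k] by simp

lemma coord_pure_multi:
  assumes "k \<in> multi" "l \<in> multi"
  shows "coord k (pure l) = (if k = l then 1 else 0)"
proof -
  have r: "rep i (l i) (k i) = (if k i = l i then 1 else 0)" if "i < d" for i
    using assms that E[OF that] VV.representation_basis[of "E i" "l i"] by (auto simp: PiE_iff)
  have c: "coord k (pure l) = (\<Prod>i<d. if k i = l i then 1 else 0)"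
    unfolding coord_pure by (rule prod.cong) (simp_all add: r)
  show ?thesis
  proof (cases "k = l")
    case False
    then obtain i where i: "i < d" "k i \<noteq> l i" using PiE_ext[OF assms] by auto
    then have "(\<Prod>i<d. if k i = l i then 1 else 0) = (0::complex)" by (intro prod_zero bexI[of _ i]) auto
    then show ?thesis using False c by simp
  next
    case True
    then show ?thesis using c by simp
  qed
qed

lemma pure_span_multi:
  assumes "v \<in> tuples"
  shows "pure v \<in> T.V.span (pure ` multi)"
proof -
  \<comment> \<open>The factors from \<open>j\<close> on already hold basis vectors. At
    \<open>j = d\<close> this condition is empty, and at \<open>j = 0\<close> the whole tuple
    consists of basis vectors.\<close>
  have "j \<le> d \<Longrightarrow> v \<in> tuples \<Longrightarrow> (\<forall>i. j \<le> i \<and> i < d \<longrightarrow> v i \<in> E i) \<Longrightarrow> pure v \<in> T.V.span (pure ` multi)" for j v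
  proof (induction j arbitrary: v)
    case 0
    then have "v \<in> multi" by (auto simp: PiE_iff)
    then show ?case by (intro T.V.span_base) auto
  next
    case (Suc j)
    then have j: "j < d" by simp
    let ?X = "{x \<in> V j. pure (v(j := x)) \<in> T.V.span (pure ` multi)}"
    have "VV.span (E j) \<subseteq> ?X"
    proof (rule VV.span_minimal)
      show "E j \<subseteq> ?X"
      proof
        fix x assume x: "x \<in> E j"
        then have "x \<in> V j" using E(4)[OF j] by blast
        moreover have "pure (v(j := x)) \<in> T.V.span (pure ` multi)"
          using Suc.prems x j PiE_lessThan_upd[OF Suc.prems(2) j \<open>x \<in> V j\<close>] by (intro Suc.IH) auto
        ultimately show "x \<in> ?X" by blast
      qed
      have "0 \<in> V j" using subspace_V[OF j] VV.subspace_0 by blast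
      then have "pure (v(j := 0)) = 0" using pure_scale[OF Suc.prems(2) j, of 0 0] by simp
      then show "VV.subspace ?X"
        using subspace_V[OF j]
        by (auto simp: VV.subspace_def pure_add[OF Suc.prems(2) j] pure_scale[OF Suc.prems(2) j]
            T.V.span_zero T.V.span_add T.V.span_scale)
    qed
    then have "pure (v(j := v j)) \<in> T.V.span (pure ` multi)"
      using Suc.prems(2) j E(3)[OF j] by (auto simp: PiE_iff)
    then show ?case by simp
  qed
  from this[OF order_refl assms] show ?thesis by (metis leD)
qed

lemma T_eq: "T = T.V.span (pure ` multi)"
proof
  show "T \<subseteq> T.V.span (pure ` multi)"
    unfolding tensor_space_def using pure_span_multi by (intro T.V.span_minimal) auto
  show "T.V.span (pure ` multi) \<subseteq> T"
    using pure_in multi_tuples by (intro T.V.span_minimal T.subspace_carrier) auto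
qed

lemma coord_expand: "t \<in> T \<Longrightarrow> (\<Sum>k\<in>multi. tensor_scale (coord k t) (pure k)) = t"
proof -
  have "T.V.span (pure ` multi) \<subseteq> {t. (\<Sum>k\<in>multi. tensor_scale (coord k t) (pure k)) = t}"
  proof (rule T.V.span_minimal)
    show "pure ` multi \<subseteq> {t. (\<Sum>k\<in>multi. tensor_scale (coord k t) (pure k)) = t}"
    proof clarify
      fix l assume l: "l \<in> multi"
      have "(\<Sum>k\<in>multi. tensor_scale (coord k (pure l)) (pure k)) = (\<Sum>k\<in>multi. if k = l then pure l else 0)"
        using l by (intro sum.cong) (auto simp: coord_pure_multi)
      then show "(\<Sum>k\<in>multi. tensor_scale (coord k (pure l)) (pure k)) = pure l"
        using l finite_multi by simp
    qed
    have "coord k 0 = 0" for k by (simp add: coord_def)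
    then show "T.V.subspace {t. (\<Sum>k\<in>multi. tensor_scale (coord k t) (pure k)) = t}"
      by (intro T.V.subspaceI)
         (simp_all add: coord_add coord_scale T.V.scale_left_distrib sum.distrib T.V.scale_sum_right[symmetric]
            T.V.scale_scale[symmetric] del: T.V.scale_scale)
  qed
  moreover assume "t \<in> T"
  then have "t \<in> T.V.span (pure ` multi)" unfolding T_eq .
  ultimately show "(\<Sum>k\<in>multi. tensor_scale (coord k t) (pure k)) = t" by blast
qed

section \<open>Linear maps as actions of polynomials\<close>

definition realizable where
  "realizable r \<longleftrightarrow> (\<exists>n. \<exists>f\<in>words n. \<forall>t\<in>T. act f t = r t)"

lemma realizable_zero: "realizable (\<lambda>t. 0)"
  unfolding realizable_def
  by (intro exI[of _ 0] bexI[of _ 0]) (simp_all add: T.free_act_zero F.subspace_0[OF subspace_words])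

lemma realizable_scale: "realizable r \<Longrightarrow> realizable (\<lambda>t. tensor_scale c (r t))"
  unfolding realizable_def using F.subspace_scale[OF subspace_words, of _ _ c] by (metis T.free_act_scale)

lemma realizable_add:
  assumes "realizable r" "realizable s"
  shows "realizable (\<lambda>t. r t + s t)"
proof -
  obtain m f where f: "f \<in> words m" "\<forall>t\<in>T. act f t = r t" using assms(1) unfolding realizable_def by blast
  obtain n g where g: "g \<in> words n" "\<forall>t\<in>T. act g t = s t" using assms(2) unfolding realizable_def by blast
  have "f \<in> words (max m n)" "g \<in> words (max m n)"
    using f(1) g(1) words_mono[of m "max m n"] words_mono[of n "max m n"] by auto
  then have "f + g \<in> words (max m n)" by (rule F.subspace_add[OF subspace_words])
  then show ?thesis unfolding realizable_def using f(2) g(2) by (intro exI bexI) (auto simp: T.free_act_add)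
qed

lemma realizable_sum: "finite A \<Longrightarrow> (\<And>a. a \<in> A \<Longrightarrow> realizable (r a)) \<Longrightarrow> realizable (\<lambda>t. \<Sum>a\<in>A. r a t)"
  by (induction A rule: finite_induct) (simp_all add: realizable_zero realizable_add)

lemma realizable_unit:
  assumes k: "k \<in> multi" and l: "l \<in> multi"
  shows "realizable (\<lambda>t. tensor_scale (coord k t) (pure l))"
proof -
  obtain n f where f: "f \<in> words n" "\<And>v. v \<in> tuples \<Longrightarrow> act f (pure v) =
      tensor_scale (\<Prod>i<d. rep i (v i) (k i)) (pure (\<lambda>i. if i < d then l i else v i))"
    using matrix_unit_partial[OF k multi_tuples[OF l] order_refl] by auto
  have "act f (pure v) = tensor_scale (coord k (pure v)) (pure l)" if v: "v \<in> tuples" for v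
  proof -
    have "(\<lambda>i. if i < d then l i else v i) = l"
      using v l by (auto simp: fun_eq_iff PiE_iff extensional_def)
    then show ?thesis using f(2)[OF v] by (simp add: coord_pure)
  qed
  moreover have "T.V.subspace {t \<in> T. act f t = tensor_scale (coord k t) (pure l)}"
    using T.subspace_carrier T.free_act_linear(2)[of 0 0 f 0] T.V.subspace_0[OF T.subspace_carrier]
    by (auto simp: T.V.subspace_def T.free_act_linear coord_add coord_scale T.V.scale_left_distrib
        coord_def[of _ 0])
  ultimately have "T \<subseteq> {t \<in> T. act f t = tensor_scale (coord k t) (pure l)}"
    unfolding tensor_space_def[of scaleV d V] by (intro T.V.span_minimal) (auto simp: pure_in[unfolded tensor_space_def])
  then show ?thesis unfolding realizable_def using f(1) by blast
qed

lemma realizable_rank_one: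
  assumes k: "k \<in> multi" and w: "w \<in> T"
  shows "realizable (\<lambda>t. tensor_scale (coord k t) w)"
proof -
  let ?R = "{w. realizable (\<lambda>t. tensor_scale (coord k t) w)}"
  have "T.V.span (pure ` multi) \<subseteq> ?R"
  proof (intro T.V.span_minimal T.V.subspaceI)
    fix c w assume "w \<in> ?R"
    then show "tensor_scale c w \<in> ?R"
      using realizable_scale[of "\<lambda>t. tensor_scale (coord k t) w" c] by (simp add: mult.commute)
  next
    fix w u assume "w \<in> ?R"
      "u \<in> ?R"
    then show "w + u \<in> ?R"
      using realizable_add[of "\<lambda>t. tensor_scale (coord k t) w" "\<lambda>t. tensor_scale (coord k t) u"]
      by (simp add: T.V.scale_right_distrib)
  next
    show "pure ` multi \<subseteq> ?R"
      using realizable_unit[OF k] by blast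
    show "0 \<in> ?R" using realizable_zero by simp
  qed
  moreover have "w \<in> T.V.span (pure ` multi)" using w unfolding T_eq .
  ultimately show ?thesis by blast
qed

text \<open>\<open>\<phi>\<close> is extended linearly with range spanned by values of
  \<open>\<phi>\<close>, so that the extension \<open>\<psi>\<close> stays in \<open>T\<close>.
  Applying \<open>\<psi>\<close> to the coordinate expansion of a tensor writes it as a sum of rank
  one operators, and these are realizable.\<close>

lemma realize_linear:
  assumes N: "T.V.subspace N" "N \<subseteq> T"
    and \<phi>: "\<And>v. v \<in> N \<Longrightarrow> \<phi> v \<in> T" "\<And>v w. v \<in> N \<Longrightarrow> w \<in> N \<Longrightarrow> \<phi> (v + w) = \<phi> v + \<phi> w"
      "\<And>c v. v \<in> N \<Longrightarrow> \<phi> (tensor_scale c v) = tensor_scale c (\<phi> v)"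
  obtains n f where "f \<in> words n" "\<And>t. t \<in> N \<Longrightarrow> act f t = \<phi> t"
proof -
  interpret TT: vector_space_pair "tensor_scale :: _ \<Rightarrow> (((nat \<Rightarrow> 'v) \<Rightarrow> complex) \<Rightarrow> complex) \<Rightarrow> _"
      "tensor_scale :: _ \<Rightarrow> (((nat \<Rightarrow> 'v) \<Rightarrow> complex) \<Rightarrow> complex) \<Rightarrow> _"
    by (intro vector_space_pair.intro T.V.vector_space_axioms)
  obtain B where B: "B \<subseteq> N" "T.V.independent B" "N \<subseteq> T.V.span B"
    using T.V.maximal_independent_subset by blast
  obtain \<psi> where \<psi>: "Vector_Spaces.linear tensor_scale tensor_scale \<psi>" "\<And>b. b \<in> B \<Longrightarrow> \<psi> b = \<phi> b"
      "range \<psi> = T.V.span (\<phi> ` B)"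
    using TT.linear_independent_extend_subspace[OF B(2), of \<phi>] by blast
  interpret \<psi>: Vector_Spaces.linear tensor_scale tensor_scale \<psi> by (rule \<psi>(1))
  have "T.V.span (\<phi> ` B) \<subseteq> T" using \<phi>(1) B(1) by (intro T.V.span_minimal T.subspace_carrier) auto
  then have \<psi>T: "\<psi> t \<in> T" for t using \<psi>(3) by blast
  have "\<phi> 0 = 0" using \<phi>(3)[of 0 0] T.V.subspace_0[OF N(1)] by simp
  then have "T.V.subspace {t \<in> N. \<psi> t = \<phi> t}"
    using N(1) \<phi> by (auto simp: T.V.subspace_def \<psi>.add \<psi>.scale)
  then have "T.V.span B \<subseteq> {t \<in> N. \<psi> t = \<phi> t}"
    using B(1) \<psi>(2) by (intro T.V.span_minimal) auto
  then have \<psi>\<phi>: "\<psi> t = \<phi> t" if "t \<in> N" for t using that B(3) by blast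
  have "realizable (\<lambda>t. \<Sum>k\<in>multi. tensor_scale (coord k t) (\<psi> (pure k)))"
    by (rule realizable_sum[OF finite_multi realizable_rank_one]) (simp_all add: \<psi>T)
  then obtain n f where f: "f \<in> words n"
    "\<forall>t\<in>T. act f t = (\<Sum>k\<in>multi. tensor_scale (coord k t) (\<psi> (pure k)))"
    unfolding realizable_def by blast
  have "act f t = \<phi> t" if t: "t \<in> N" for t
  proof -
    have tT: "t \<in> T" using t N(2) by blast
    have "act f t = \<psi> (\<Sum>k\<in>multi. tensor_scale (coord k t) (pure k))"
      using f(2) tT by (simp add: \<psi>.sum \<psi>.scale)
    then show ?thesis by (simp only: coord_expand[OF tT] \<psi>\<phi>[OF t])
  qed
  then show ?thesis using that f(1) by blast
qed

section \<open>Equivariant maps as actions of invariants\<close>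

abbreviation "ev0 x \<equiv> ev (current_elem scale x 1)"

text \<open>The ideal acts by zero, so the congruence for \<open>deriv\<close> becomes an identity
  of operators. It says that \<open>deriv x f\<close> measures how far the action of
  \<open>f\<close> is from commuting with \<open>x\<close>.\<close>

lemma act_deriv:
  assumes "f \<in> words n" "v \<in> T"
  shows "act (deriv x f) v = ev0 x (act f v) - act f (ev0 x v)"
proof -
  let ?g = "free_gen (current_elem scale x 1)"
  have "act (?g * f - f * ?g - deriv x f) v = 0"
    by (rule T.free_act_uea_ideal[OF deriv_cong_commutator[OF assms(1)] assms(2)])
  then show ?thesis
    by (simp add: T.free_act_diff T.free_act_mult[OF assms(2)] T.free_act_gen)
qed

text \<open>For a linear realization \<open>f\<close> of \<open>\<phi>\<close>, equivariance means
  that \<open>deriv x f\<close> kills \<open>N\<close>, so \<open>f\<close> is invariant modulo the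
  annihilator \<open>C\<close> of \<open>N\<close>. Lifting corrects \<open>f\<close> by an element
  of \<open>C\<close>, which leaves the action on \<open>N\<close> unchanged.\<close>

theorem realize_equivariant:
  assumes red: "reductive_lie_algebra scale bracket" and fdg: "finite_dim scale UNIV"
    and N: "T.V.subspace N" "N \<subseteq> T" "\<And>x v. v \<in> N \<Longrightarrow> ev0 x v \<in> N"
    and \<phi>: "\<And>v. v \<in> N \<Longrightarrow> \<phi> v \<in> T" "\<And>v w. v \<in> N \<Longrightarrow> w \<in> N \<Longrightarrow> \<phi> (v + w) = \<phi> v + \<phi> w"
      "\<And>c v. v \<in> N \<Longrightarrow> \<phi> (tensor_scale c v) = tensor_scale c (\<phi> v)"
      "\<And>x v. v \<in> N \<Longrightarrow> \<phi> (ev0 x v) = ev0 x (\<phi> v)"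
  shows "\<exists>u\<in>current_uea_invariants scale bracket. \<forall>v\<in>N. uea_act tensor_scale ev u v = \<phi> v"
proof -
  interpret D: lie_module scale bracket free_scale UNIV deriv by (rule deriv_lie_module)
  obtain n f where f: "f \<in> words n" "\<And>t. t \<in> N \<Longrightarrow> act f t = \<phi> t"
    using realize_linear[of N \<phi>, OF N(1,2) \<phi>(1-3)] by blast
  define C where "C = {g \<in> words n. \<forall>v\<in>N. act g v = 0}"
  have ev00: "ev0 x 0 = 0" for x by (rule T.act_zero_right)
  have NT: "v \<in> T" if "v \<in> N" for v using N(2) that by blast
  have sC: "F.subspace C"
    unfolding C_def using subspace_words[of n]
    by (auto simp: F.subspace_def T.free_act_zero T.free_act_add T.free_act_scale)
  have C: "D.submodule C"
    using sC NT N(3) unfolding D.submodule_def C_def by (auto simp: deriv_words act_deriv ev00)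
  have fdC: "finite_dim free_scale C"
    by (rule F.finite_dim_mono(1)[OF finite_dim_words sC]) (auto simp: C_def)
  have "deriv x f \<in> C" for x
    using f NT N(3) \<phi>(4) by (simp add: C_def deriv_words act_deriv)
  then obtain c where c: "c \<in> C" "\<And>x. deriv x (f - c) = 0"
    using D.invariant_lift[OF red fdg _ C fdC, of f] deriv_center by auto
  have fc: "f - c \<in> words n" using f(1) c(1) F.subspace_diff[OF subspace_words] by (simp add: C_def)
  let ?u = "uI +>\<^bsub>free_ring\<^esub> (f - c)"
  have u: "?u \<in> current_uea_invariants scale bracket" by (rule deriv_invariant_uea[OF fc c(2)])
  then have "?u \<in> carrier (uea (current_scale scale) (current_bracket bracket))"
    by (simp add: current_uea_invariants_def Let_def)
  then have "uea_act tensor_scale ev ?u v = \<phi> v" if "v \<in> N" for v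
    using T.uea_act_eq[OF _ coset_contains_representative NT[OF that]] f(2) c(1) that
    by (simp add: T.free_act_diff C_def)
  then show ?thesis using u by blast
qed

text \<open>A representative commutes with the Lie algebra only up to an element of the ideal, and
  that element acts by zero.\<close>

lemma invariant_represented:
  assumes u: "u \<in> current_uea_invariants scale bracket"
  obtains f where "\<And>v. v \<in> T \<Longrightarrow> uea_act tensor_scale ev u v = act f v"
    "\<And>x v. v \<in> T \<Longrightarrow> act f (ev0 x v) = ev0 x (act f v)"
proof -
  interpret I: ideal uI free_ring by (rule uea_ideal_ideal)
  have uc: "u \<in> carrier (uea (current_scale scale) (current_bracket bracket))"
    using u by (simp add: current_uea_invariants_def Let_def)
  then obtain f where f: "u = uI +>\<^bsub>free_ring\<^esub> f"
    by (auto simp: uea_def FactRing_def A_RCOSETS_def')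
  have act: "uea_act tensor_scale ev u v = act f v" if "v \<in> T" for v
    using T.uea_act_eq[OF uc _ that] coset_contains_representative unfolding f by blast
  have comm: "act f (ev0 x v) = ev0 x (act f v)" if v: "v \<in> T" for x v
  proof -
    let ?g = "free_gen (current_elem scale x 1)"
    have "uI +>\<^bsub>free_ring\<^esub> (f * ?g) = uI +>\<^bsub>free_ring\<^esub> (?g * f)"
      using u unfolding f
      by (auto simp: current_uea_invariants_def Let_def uea_def uea_gen_def FactRing_def I.rcoset_mult_add)
    then have "f * ?g \<in> uI +>\<^bsub>free_ring\<^esub> (?g * f)"
      using coset_contains_representative by metis
    then obtain h where h: "h \<in> uI" "f * ?g = h + ?g * f" by (auto simp: a_r_coset_def')
    have "act (f * ?g) v = act (?g * f) v"
      unfolding h(2) by (simp add: T.free_act_add T.free_act_uea_ideal[OF h(1) v])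
    then show ?thesis by (simp add: T.free_act_mult[OF v] T.free_act_gen)
  qed
  show ?thesis using that act comm by blast
qed

lemma ev0_lie_module: "lie_module scale bracket tensor_scale T ev0"
proof unfold_locales
  have add: "current_elem scale (x + y) 1 = current_elem scale x 1 + current_elem scale y 1" for x y
    by (rule poly_eqI) (simp add: coeff_current_elem scale_right_distrib)
  have scl: "current_elem scale (scale c x) 1 = current_scale scale c (current_elem scale x 1)" for c x
    by (rule poly_eqI) (simp add: coeff_current_elem coeff_current_scale mult.commute)
  have br: "current_elem scale (bracket x y) 1 = current_bracket bracket (current_elem scale x 1) (current_elem scale y 1)" for x y
    by (simp add: current_bracket_elem)
  fix v w x y c assume "v \<in> T"
  then show "ev0 x v \<in> T" "ev0 (x + y) v = ev0 x v + ev0 y v" "ev0 (scale c x) v = tensor_scale c (ev0 x v)"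
    "w \<in> T \<Longrightarrow> ev0 x (v + w) = ev0 x v + ev0 x w" "ev0 x (tensor_scale c v) = tensor_scale c (ev0 x v)"
    "ev0 (bracket x y) v = ev0 x (ev0 y v) - ev0 y (ev0 x v)"
    by (simp_all add: T.act_closed add T.act_add_left scl T.act_scale_left T.act_add_right T.act_scale_right br T.act_bracket)
qed (rule T.subspace_carrier)

end

section \<open>Lagrange interpolation at the evaluation points\<close>

lemma lagrange_polynomials:
  fixes p :: "nat \<Rightarrow> complex"
  assumes "inj_on p {..<d}"
  obtains P where "\<And>i j. i < d \<Longrightarrow> j < d \<Longrightarrow> poly (P i) (p j) = (if i = j then 1 else 0)"
proof -
  define P where "P i = (\<Prod>k\<in>{..<d} - {i}. smult (inverse (p i - p k)) [:- p k, 1:])" for i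
  have eval: "poly (P i) (p j) = (\<Prod>k\<in>{..<d} - {i}. inverse (p i - p k) * (p j - p k))" for i j
    by (simp add: P_def poly_prod algebra_simps)
  have "poly (P i) (p j) = (if i = j then 1 else 0)" if ij: "i < d" "j < d" for i j
  proof (cases "i = j")
    case True
    have "inverse (p i - p k) * (p j - p k) = 1" if "k \<in> {..<d} - {i}" for k
    proof -
      have "p j - p k \<noteq> 0" using that ij assms True by (auto simp: inj_on_def)
      then show ?thesis unfolding True by (rule left_inverse)
    qed
    then show ?thesis using True unfolding eval by (simp add: prod.neutral)
  next
    case False
    have "(\<Prod>k\<in>{..<d} - {i}. inverse (p i - p k) * (p j - p k)) = 0"
      by (rule prod_zero) (use ij False in auto)
    then show ?thesis using False unfolding eval by simp
  qed
  then show ?thesis using that by blast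
qed

section \<open>Irreducibility of the isotypic components\<close>

context evaluation_setup
begin

theorem isotypic_component_irreducible:
  assumes red: "reductive_lie_algebra scale bracket" and fdg: "finite_dim scale UNIV"
    and M: "irreducible_lie_module scale bracket scaleM M \<sigma>"
    and W: "W = isotypic_component tensor_scale T ev0 scaleM M \<sigma>" and W_nz: "W \<noteq> {0}"
  shows "irreducible_under tensor_scale
    (range ev0 \<union> uea_act tensor_scale ev ` current_uea_invariants scale bracket) W"
proof -
  let ?I = "current_uea_invariants scale bracket"
  interpret G: lie_module scale bracket tensor_scale T ev0 by (rule ev0_lie_module)
  have Mmod: "lie_module scale bracket scaleM M \<sigma>" and Mirr: "irreducible_under scaleM (range \<sigma>) M"
    using M by (auto simp: irreducible_lie_module_def)
  define \<N> where "\<N> = {N. G.submodule N \<and> lie_module_isomorphic tensor_scale N ev0 scaleM M \<sigma>}"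
  have W_eq: "W = T.V.span (\<Union>\<N>)"
    unfolding W isotypic_component_def \<N>_def G.submodule_iff by (rule arg_cong[where f = T.V.span]) blast
  have sub: "G.submodule N" if "N \<in> \<N>" for N using that by (simp add: \<N>_def)
  have isoM: "lie_module_isomorphic tensor_scale N ev0 scaleM M \<sigma>" if "N \<in> \<N>" for N
    using that by (simp add: \<N>_def)
  have simple: "irreducible_under tensor_scale (range ev0) N" if "N \<in> \<N>" for N
    by (rule irreducible_iso[OF G.submodule_lie_module[OF sub[OF that]] Mmod isoM[OF that] Mirr])
  \<comment> \<open>Generic in the type of the target: it is used for submodules of the tensor
    product and for \<open>M\<close>.\<close>
  have iso_sym: "lie_module_isomorphic s' N' r' tensor_scale N ev0"
    if "G.submodule N" "lie_module_isomorphic tensor_scale N ev0 s' N' r'"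
    for N and s' :: "complex \<Rightarrow> 'w::ab_group_add \<Rightarrow> 'w" and N' and r' :: "'g \<Rightarrow> 'w \<Rightarrow> 'w"
    by (rule lie_module_isomorphic_sym[OF that(2)]) (use G.submoduleD[OF that(1)] in auto)
  have sW: "T.V.subspace W" by (simp add: W_eq)
  have WT: "W \<subseteq> T"
    unfolding W_eq using sub by (intro T.V.span_minimal T.subspace_carrier) (auto simp: G.submodule_def)
  have W_sub: "N \<subseteq> W" if "N \<in> \<N>" for N
    unfolding W_eq using that T.V.span_superset by blast
  have ev0_W: "ev0 x v \<in> W" if "v \<in> W" for x v
  proof -
    have "T.V.span (\<Union>\<N>) \<subseteq> {v \<in> T. ev0 x v \<in> W}"
    proof (rule T.V.span_minimal)
      show "\<Union>\<N> \<subseteq> {v \<in> T. ev0 x v \<in> W}"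
        using G.submoduleD(5,6)[OF sub] W_sub by blast
      show "T.V.subspace {v \<in> T. ev0 x v \<in> W}"
        using T.subspace_carrier sW
        by (auto simp: T.V.subspace_def G.act_zero_right G.act_add_right G.act_scale_right)
    qed
    then show ?thesis using that W_eq by blast
  qed
  \<comment> \<open>By Schur's lemma an invariant sends each simple submodule of the given type to
    zero or to another one of the same type.\<close>
  have uea_W: "uea_act tensor_scale ev u v \<in> W" if u: "u \<in> ?I" and v: "v \<in> W" for u v
  proof -
    obtain f where f: "\<And>v. v \<in> T \<Longrightarrow> uea_act tensor_scale ev u v = act f v"
      "\<And>x v. v \<in> T \<Longrightarrow> act f (ev0 x v) = ev0 x (act f v)"
      using invariant_represented[OF u] by blast
    have N_W: "act f v \<in> W" if N: "N \<in> \<N>" and v: "v \<in> N" for N v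
    proof -
      have e: "G.equivariant N (act f)"
        using G.submoduleD(6)[OF sub[OF N]] f(2)
        by (simp add: G.equivariant_def T.free_act_closed T.free_act_linear(1) T.free_act_scale_right)
      consider "\<forall>v\<in>N. act f v = 0" | "lie_module_isomorphic tensor_scale N ev0 tensor_scale (act f ` N) ev0"
        using G.equivariant_simple[OF e sub[OF N] simple[OF N]] by blast
      then show ?thesis
      proof cases
        case 1
        then show ?thesis using v T.V.subspace_0[OF sW] by simp
      next
        case 2
        have "lie_module_isomorphic tensor_scale (act f ` N) ev0 scaleM M \<sigma>"
          by (rule lie_module_isomorphic_trans[OF iso_sym[OF sub[OF N] 2] isoM[OF N]])
        then have "act f ` N \<in> \<N>" using G.equivariant_image[OF e sub[OF N]] by (simp add: \<N>_def)
        then show ?thesis using W_sub v by blast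
      qed
    qed
    have "T.V.span (\<Union>\<N>) \<subseteq> {v \<in> T. act f v \<in> W}"
    proof (rule T.V.span_minimal)
      show "\<Union>\<N> \<subseteq> {v \<in> T. act f v \<in> W}" using N_W W_sub WT by blast
      show "T.V.subspace {v \<in> T. act f v \<in> W}"
        using T.subspace_carrier sW
        by (auto simp: T.V.subspace_def T.free_act_linear(1) T.free_act_scale_right T.free_act_zero_right)
    qed
    then show ?thesis using v f(1) WT W_eq by auto
  qed
  have minimal: "N = W" if N: "invariant_subspace tensor_scale
      (range ev0 \<union> uea_act tensor_scale ev ` ?I) N" "N \<subseteq> W" "N \<noteq> {0}" for N
  proof
    have sN: "G.submodule N" using N WT by (auto simp: G.submodule_def invariant_subspace_def)
    have N_act: "uea_act tensor_scale ev u v \<in> N" if "u \<in> ?I" "v \<in> N" for u v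
      using N(1) that by (simp add: invariant_subspace_def)
    obtain v where v: "v \<in> N" "v \<noteq> 0" using N(3) G.submoduleD(1)[OF sN] by blast
    \<comment> \<open>A single vector \<open>v\<close> involves only finitely many of the simple
      submodules, and \<open>isotypic_contains_simple\<close> can be applied to these.\<close>
    have "v \<in> T.V.span (\<Union>\<N>)" using v N(2) W_eq by blast
    then obtain t r where t: "finite t" "t \<subseteq> \<Union>\<N>" "v = (\<Sum>a\<in>t. tensor_scale (r a) a)"
      unfolding T.V.span_explicit by blast
    have "\<forall>a\<in>t. \<exists>S. S \<in> \<N> \<and> a \<in> S" using t(2) by blast
    then obtain S where S: "\<And>a. a \<in> t \<Longrightarrow> S a \<in> \<N>" "\<And>a. a \<in> t \<Longrightarrow> a \<in> S a" by metis
    have "v \<in> T.V.span (\<Union>(S ` t))"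
      unfolding t(3) using S(2) by (intro T.V.span_sum T.V.span_scale T.V.span_base) auto
    then have "N \<inter> T.V.span (\<Union>(S ` t)) \<noteq> {0}" using v by blast
    then obtain a L where L: "a \<in> t" "L \<subseteq> N" "G.submodule L" "lie_module_isomorphic tensor_scale L ev0 tensor_scale (S a) ev0"
      using G.isotypic_contains_simple[of "S ` t" N] t(1) S(1) sub simple sN by blast
    have "K \<subseteq> N" if K: "K \<in> \<N>" for K
    proof -
      have "lie_module_isomorphic tensor_scale L ev0 tensor_scale K ev0"
        by (rule lie_module_isomorphic_trans[OF L(4) lie_module_isomorphic_trans[OF isoM[OF S(1)[OF L(1)]] iso_sym[OF sub[OF K] isoM[OF K]]]])
      then obtain \<phi> where \<phi>: "bij_betw \<phi> L K" "\<forall>v\<in>L. \<forall>w\<in>L. \<phi> (v + w) = \<phi> v + \<phi> w"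
        "\<forall>c. \<forall>v\<in>L. \<phi> (tensor_scale c v) = tensor_scale c (\<phi> v)" "\<forall>x. \<forall>v\<in>L. \<phi> (ev0 x v) = ev0 x (\<phi> v)"
        unfolding lie_module_isomorphic_def by blast
      have img: "\<phi> ` L = K" using \<phi>(1) by (simp add: bij_betw_def)
      have LT: "L \<subseteq> T" using G.submoduleD(6)[OF L(3)] by blast
      have \<phi>T: "\<phi> v \<in> T" if "v \<in> L" for v using img that G.submoduleD(6)[OF sub[OF K]] by blast
      \<comment> \<open>The invariant obtained here carries \<open>L\<close> onto \<open>K\<close>,
        while stability of \<open>N\<close> keeps the image of \<open>L\<close> inside
        \<open>N\<close>.\<close>
      have "\<exists>u\<in>?I. \<forall>v\<in>L. uea_act tensor_scale ev u v = \<phi> v"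
        using G.submoduleD(5)[OF L(3)] \<phi>(2-4)
        by (intro realize_equivariant[OF red fdg G.submoduleD(7)[OF L(3)] LT] \<phi>T) auto
      then obtain u where u: "u \<in> ?I" "\<forall>v\<in>L. uea_act tensor_scale ev u v = \<phi> v"
        by blast
      show ?thesis
      proof
        fix w assume "w \<in> K"
        then obtain v where v: "v \<in> L" "w = \<phi> v" using img by blast
        then have "w = uea_act tensor_scale ev u v" using u(2) by simp
        then show "w \<in> N" using N_act[OF u(1)] v(1) L(2) by auto
      qed
    qed
    then show "W \<subseteq> N" unfolding W_eq using G.submoduleD(7)[OF sN] by (intro T.V.span_minimal) auto
  qed (rule N(2))
  show ?thesis
    unfolding irreducible_under_def
  proof (intro conjI allI impI W_nz)
    show "invariant_subspace tensor_scale
        (range ev0 \<union> uea_act tensor_scale ev ` ?I) W"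
      using sW ev0_W uea_W by (auto simp: invariant_subspace_def)
  qed (use minimal in blast)
qed

end

theorem theorem1:
  fixes scale :: "complex \<Rightarrow> 'g::ab_group_add \<Rightarrow> 'g"
    and bracket :: "'g \<Rightarrow> 'g \<Rightarrow> 'g"
    and d :: nat
    and scaleV :: "complex \<Rightarrow> 'v::ab_group_add \<Rightarrow> 'v"
    and V :: "nat \<Rightarrow> 'v set"
    and \<rho> :: "nat \<Rightarrow> 'g \<Rightarrow> 'v \<Rightarrow> 'v"
    and p :: "nat \<Rightarrow> complex"
    and scaleM :: "complex \<Rightarrow> 'm::ab_group_add \<Rightarrow> 'm"
    and M :: "'m set"
    and \<sigma> :: "'g \<Rightarrow> 'm \<Rightarrow> 'm"
    and T :: "(((nat \<Rightarrow> 'v) \<Rightarrow> complex) \<Rightarrow> complex) set"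
    and \<tau> :: "'g poly \<Rightarrow> (((nat \<Rightarrow> 'v) \<Rightarrow> complex) \<Rightarrow> complex) \<Rightarrow> (((nat \<Rightarrow> 'v) \<Rightarrow> complex) \<Rightarrow> complex)"
    and \<tau>0 :: "'g \<Rightarrow> (((nat \<Rightarrow> 'v) \<Rightarrow> complex) \<Rightarrow> complex) \<Rightarrow> (((nat \<Rightarrow> 'v) \<Rightarrow> complex) \<Rightarrow> complex)"
    and W :: "(((nat \<Rightarrow> 'v) \<Rightarrow> complex) \<Rightarrow> complex) set"
  assumes "reductive_lie_algebra scale bracket"
    and "finite_dim scale UNIV"
    and "d \<ge> 1"
    and "\<And>i. i < d \<Longrightarrow> irreducible_lie_module scale bracket scaleV (V i) (\<rho> i)"
    and "\<And>i. i < d \<Longrightarrow> finite_dim scaleV (V i)"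
    and "inj_on p {..<d}"
    and "irreducible_lie_module scale bracket scaleM M \<sigma>"
    and "finite_dim scaleM M"
  defines "T \<equiv> tensor_space scaleV d V"
    and "\<tau> \<equiv> evaluation_act scale scaleV d V \<rho> p"
    and "\<tau>0 \<equiv> \<lambda>x. \<tau> (current_elem scale x 1)"
    and "W \<equiv> isotypic_component tensor_scale T \<tau>0 scaleM M \<sigma>"
  assumes "W \<noteq> {0}"
  shows "irreducible_under tensor_scale
           (range \<tau>0 \<union> uea_act tensor_scale \<tau> ` current_uea_invariants scale bracket) W"
proof -
  interpret lie_algebra scale bracket using assms(1) by (simp add: reductive_lie_algebra_def)
  obtain Bg where Bg: "finite Bg" "independent Bg" "span Bg = UNIV"
    using finite_dim_basis[OF assms(2)] by metis
  obtain P where P: "\<And>i j. i < d \<Longrightarrow> j < d \<Longrightarrow> poly (P i) (p j) = (if i = j then 1 else 0)"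
    using lagrange_polynomials[OF assms(6)] by metis
  have modules: "lie_module scale bracket scaleV (V i) (\<rho> i)"
    and irreducible: "irreducible_under scaleV (range (\<rho> i)) (V i)" if "i < d" for i
    using assms(4)[OF that] by (simp_all add: irreducible_lie_module_def)
  have data: "evaluation_data scale bracket d scaleV V \<rho>"
    by (intro evaluation_data.intro evaluation_data_axioms.intro lie_algebra_axioms modules)
  have letters: "lagrange_letters scale bracket Bg d p P"
    by (intro lagrange_letters.intro lagrange_letters_axioms.intro lie_algebra_axioms Bg P)
  interpret evaluation_setup scale bracket d scaleV V \<rho> p Bg P
    by (intro evaluation_setup.intro evaluation_setup_axioms.intro data letters assms(3,5) irreducible)
  show ?thesis
    unfolding \<tau>0_def \<tau>_def
    by (rule isotypic_component_irreducible[OF assms(1,2,7)])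
       (use \<open>W \<noteq> {0}\<close> in \<open>simp_all add: W_def \<tau>0_def \<tau>_def T_def\<close>)
qed

end
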